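(* Let $p\geq 11$ be a prime, $k\geq 1$ an integer, $q=p^k$, and let $G=\mathrm{SL}(3,2)$ be the group of invertible $3\times 3$ matrices over $\mathbb F_2$. Then the unit group $\mathcal U(\mathbb F_q G)$ of the group algebra $\mathbb F_qG$ is as follows. (i) If $k$ is even, or if $k$ is odd and $p\equiv 1,2,-3 \pmod 7$, then $$\mathcal U(\mathbb F_qG)\cong \mathbb F_q^\times\times \mathrm{GL}(6,\mathbb F_q)\times\mathrm{GL}(7,\mathbb F_q)\times\mathrm{GL}(8,\mathbb F_q)\times\mathrm{GL}(3,\mathbb F_q)\times\mathrm{GL}(3,\mathbb F_q).$$ (ii) If $k$ is odd and $p\equiv -1,-2,3\pmod 7$, then $$\mathcal U(\mathbb F_qG)\cong \mathbb F_q^\times\times \mathrm{GL}(6,\mathbb F_q)\times\mathrm{GL}(7,\mathbb F_q)\times\mathrm{GL}(8,\mathbb F_q)\times\mathrm{GL}(3,\mathbb F_{q^2}).$$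
   Context: $\mathbb F_q$ denotes the finite field with $q$ elements, $\mathbb F_q^\times$ its multiplicative group, and $\mathrm{GL}(n,\mathbb F)$ the group of invertible $n\times n$ matrices over $\mathbb F$. The unit group $\mathcal U(\mathbb F_qG)$ is the group of invertible elements of the group algebra $\mathbb F_qG$. (The paper writes the direct products with the symbol $\oplus$.) *)

theory Defs
  imports "HOL-Algebra.Algebra" "HOL-Number_Theory.Residues"
begin

definition mat_ring :: "('a, 'm) ring_scheme \<Rightarrow> nat \<Rightarrow> (nat \<Rightarrow> nat \<Rightarrow> 'a) ring" where
  "mat_ring R n =
    \<lparr>carrier = {M. \<forall>i j. if i < n \<and> j < n then M i j \<in> carrier R else M i j = \<zero>\<^bsub>R\<^esub>},
     monoid.mult = (\<lambda>M N i j. if i < n \<and> j < n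
                        then (\<Oplus>\<^bsub>R\<^esub> l\<in>{..<n}. M i l \<otimes>\<^bsub>R\<^esub> N l j) else \<zero>\<^bsub>R\<^esub>),
     one = (\<lambda>i j. if i < n \<and> j < n \<and> i = j then \<one>\<^bsub>R\<^esub> else \<zero>\<^bsub>R\<^esub>),
     ring.zero = (\<lambda>i j. \<zero>\<^bsub>R\<^esub>),
     ring.add = (\<lambda>M N i j. M i j \<oplus>\<^bsub>R\<^esub> N i j)\<rparr>"

definition GL :: "('a, 'm) ring_scheme \<Rightarrow> nat \<Rightarrow> (nat \<Rightarrow> nat \<Rightarrow> 'a) monoid" where
  "GL R n = units_of (mat_ring R n)"

definition SL32 :: "(nat \<Rightarrow> nat \<Rightarrow> int) monoid" where
  "SL32 = GL (residue_ring 2) 3"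

definition group_algebra :: "('a, 'm) ring_scheme \<Rightarrow> ('g, 'n) monoid_scheme \<Rightarrow> ('g \<Rightarrow> 'a) ring" where
  "group_algebra R G =
    \<lparr>carrier = carrier G \<rightarrow>\<^sub>E carrier R,
     monoid.mult = (\<lambda>f g. \<lambda>x\<in>carrier G. \<Oplus>\<^bsub>R\<^esub> y\<in>carrier G. f y \<otimes>\<^bsub>R\<^esub> g (inv\<^bsub>G\<^esub> y \<otimes>\<^bsub>G\<^esub> x)),
     one = (\<lambda>x\<in>carrier G. if x = \<one>\<^bsub>G\<^esub> then \<one>\<^bsub>R\<^esub> else \<zero>\<^bsub>R\<^esub>),
     ring.zero = (\<lambda>x\<in>carrier G. \<zero>\<^bsub>R\<^esub>),
     ring.add = (\<lambda>f g. \<lambda>x\<in>carrier G. f x \<oplus>\<^bsub>R\<^esub> g x)\<rparr>"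

end

theory Submission
  imports Defs "HOL-Number_Theory.Quadratic_Reciprocity" "HOL-Computational_Algebra.Polynomial"
begin

text \<open>
  The group algebra is decomposed by explicit representations. Over the integers, \<open>SL(3,2)\<close> has absolutely
  irreducible representations of degrees 1, 6 (points of the Fano plane), 7 (induced from the sign character of a
  point stabiliser) and 8 (Steinberg), and it has a representation \<open>\<rho>\<close> of degree 3 over \<open>\<int>[\<alpha>]\<close>, where
  \<open>\<alpha>\<^sup>2 + \<alpha> + 2 = 0\<close>, that is not equivalent to its conjugate. Each of them is generated by a vector that spans an
  eigenline of a subgroup \<open>H\<close>, so an intertwiner is determined by an eigenvector of \<open>H\<close>; finitely many sums over \<open>H\<close>
  then give Schur's orthogonality relations. As 168 is invertible modulo \<open>p\<close>, these relations make the map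
  from the group algebra to the product of the integral blocks and of the two integral coordinate matrices of
  \<open>\<rho> = X + \<alpha> Y\<close> surjective, hence bijective by counting. If \<open>-7\<close> is a square in the field, the two roots of
  \<open>x\<^sup>2 + x + 2\<close> turn \<open>(X, Y)\<close> into two matrix blocks; otherwise \<open>X + \<alpha> Y\<close> is an arbitrary matrix over the quadratic
  extension. Quadratic reciprocity decides which case occurs.\<close>

section \<open>The group as frames over the field with two elements\<close>

text \<open>Schur's relations are proved in characteristic 0. There \<open>\<int>[\<alpha>]\<close>
  is torsion-free, so an averaged matrix can be determined after multiplication by a group order or
  a degree, and nothing is ever divided. Only the final constants \<open>168 / d\<close> are
  inverted in the field; they divide \<open>168 = 2^3 * 3 * 7\<close>, and \<open>p\<close> exceeds
  7.

  The obstacle is that \<open>x^2 + x + 2\<close>, of discriminant -7, need not have a root in the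
  field. The two conjugate representations of degree 3 are therefore used only inside
  \<open>\<int>[\<alpha>]\<close>; what is carried over to the field are
  \<open>1 + 36 + 64 + 49 + 9 + 9 = 168\<close> integer functions, with \<open>X\<close> and
  \<open>Y\<close> in place of the conjugate pair. Surjectivity is thus proved once, for both cases.

  In the second case the field with \<open>q^2\<close> elements is an arbitrary one, unrelated to
  the given field of order \<open>q\<close>. An embedding is constructed by presenting the small
  field as a quotient of the integral polynomials by a monic polynomial and
  \<open>p\<close>.\<close>

text \<open>\<open>Za a b\<close> stands for \<open>a + b \<alpha>\<close> with \<open>\<alpha>\<^sup>2 = - \<alpha> - 2\<close>.\<close>

datatype za = Za (zre: int) (zim: int)

instantiation za :: comm_ring_1
begin
definition zero_za where "0 = Za 0 0"
definition one_za where "1 = Za 1 0"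
definition plus_za where "x + y = Za (zre x + zre y) (zim x + zim y)"
definition minus_za where "x - y = Za (zre x - zre y) (zim x - zim y)"
definition uminus_za where "- x = Za (- zre x) (- zim x)"
definition times_za where
  "x * y = Za (zre x * zre y - 2 * (zim x * zim y)) (zre x * zim y + zim x * zre y - zim x * zim y)"
instance
  by standard (auto simp: zero_za_def one_za_def plus_za_def minus_za_def uminus_za_def times_za_def
      algebra_simps intro!: za.expand)
end

type_synonym f2vec = "bool \<times> bool \<times> bool"
text \<open>A matrix is the triple of its columns.\<close>

type_synonym f2mat = "f2vec \<times> f2vec \<times> f2vec"

abbreviation "e1 \<equiv> (True, False, False)"
abbreviation "e2 \<equiv> (False, True, False)"
abbreviation "e3 \<equiv> (False, False, True)"
abbreviation "e12 \<equiv> (True, True, False)"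
abbreviation "e13 \<equiv> (True, False, True)"
abbreviation "e23 \<equiv> (False, True, True)"
abbreviation "e123 \<equiv> (True, True, True)"

fun f2_add :: "f2vec \<Rightarrow> f2vec \<Rightarrow> f2vec" where
  "f2_add (a, b, c) (a', b', c') = (a \<noteq> a', b \<noteq> b', c \<noteq> c')"

fun f2_app :: "f2mat \<Rightarrow> f2vec \<Rightarrow> f2vec" where
  "f2_app (p, q, r) (a, b, c) =
     f2_add (if a then p else (False, False, False))
       (f2_add (if b then q else (False, False, False)) (if c then r else (False, False, False)))"

fun f2_mult :: "f2mat \<Rightarrow> f2mat \<Rightarrow> f2mat" where
  "f2_mult x (p, q, r) = (f2_app x p, f2_app x q, f2_app x r)"

definition f2_one :: f2mat where "f2_one = (e1, e2, e3)"

fun frame :: "f2mat \<Rightarrow> bool" where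
  "frame (p, q, r) = (let z = (False, False, False) in
     p \<noteq> z \<and> q \<noteq> z \<and> q \<noteq> p \<and> r \<noteq> z \<and> r \<noteq> p \<and> r \<noteq> q \<and> r \<noteq> f2_add p q)"

definition f2_vecs :: "f2vec list" where
  "f2_vecs = [e3, e2, e23, e1, e13, e12, e123]"

definition frames :: "f2mat list" where
  "frames = filter frame (List.product f2_vecs (List.product f2_vecs f2_vecs))"

text \<open>Column reduction: \<open>piv p q\<close> is the entry of \<open>q\<close> in the row of the leading entry of \<open>p\<close>, so \<open>red p q\<close> is the
  normal form of \<open>q\<close> modulo \<open>p\<close>. Thus \<open>(p, red p q)\<close> encodes the flag of the frame \<open>(p, q, r)\<close>; flags are
  numbered by \<open>fpos\<close>.\<close>

fun piv :: "f2vec \<Rightarrow> f2vec \<Rightarrow> bool" where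
  "piv (a, b, c) (a', b', c') = (if a then a' else if b then b' else c')"

definition red :: "f2vec \<Rightarrow> f2vec \<Rightarrow> f2vec" where
  "red p q = (if piv p q then f2_add q p else q)"

text \<open>The bits \<open>a b c\<close> read as a binary number, minus one, so that the seven
  points are numbered 0 to 6.\<close>

fun pos :: "f2vec \<Rightarrow> nat" where
  "pos (a, b, c) = (if a then if b then if c then 6 else 5 else if c then 4 else 3
     else if b then if c then 2 else 1 else 0)"

text \<open>The coordinate of the leading entry of the first vector is dropped. The two other bits,
  as a binary number minus one, number the three lines through that point.\<close>

fun pos2 :: "f2vec \<Rightarrow> f2vec \<Rightarrow> nat" where
  "pos2 (a, b, c) (a', b', c') =
     (let (x, y) = (if a then (b', c') else if b then (a', c') else (a', b')) in
      if x then if y then 2 else 1 else 0)"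

fun fpos :: "f2mat \<Rightarrow> nat" where
  "fpos (p, q, r) = 3 * pos p + pos2 p (red p q)"

text \<open>Each \<open>v\<close> below maps a frame \<open>x\<close> to the image under \<open>x\<close> of the first basis vector of the representation, and each
  \<open>base\<close> lists frames that map the first basis vector to the successive basis vectors. In degree 6 the
  seven points have sum zero; in degree 7 the sign is that of the pair \<open>q, r\<close> as an element of the symmetric
  group \<open>GL(2,2)\<close> acting modulo \<open>p\<close>; in degree 8 the 21 flags are subject to the relations that the three flags at any
  point or line have sum zero; in degree 3 the sign is a character of the unitriangular group whose
  kernel is cyclic of order 4.\<close>

definition tab6 :: "int list list" where
  "tab6 = [[0, 1, 0, 0, 0, 0],
    [0, 0, 1, 0, 0, 0],
    [0, 0, 0, 1, 0, 0],
    [1, 0, 0, 0, 0, 0],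
    [0, 0, 0, 0, 1, 0],
    [0, 0, 0, 0, 0, 1],
    [-1, -1, -1, -1, -1, -1]]"
definition tab7 :: "int list list" where
  "tab7 = [[0, 1, 0, 0, 0, 0, 0],
    [0, 0, 1, 0, 0, 0, 0],
    [0, 0, 0, 1, 0, 0, 0],
    [1, 0, 0, 0, 0, 0, 0],
    [0, 0, 0, 0, 1, 0, 0],
    [0, 0, 0, 0, 0, 1, 0],
    [0, 0, 0, 0, 0, 0, 1]]"
definition tab8 :: "int list list" where
  "tab8 = [[0, -1, 1, 0, 1, -1, 0, 1],
    [1, 1, 0, 1, 0, 1, 0, 0],
    [-1, 0, -1, -1, -1, 0, 0, -1],
    [0, 1, 0, 0, 0, 0, 1, -1],
    [0, 0, 0, 0, 0, 0, 0, 1],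
    [0, -1, 0, 0, 0, 0, -1, 0],
    [0, 0, -1, 0, -1, 1, -1, 0],
    [0, 0, 0, 0, 1, -1, 1, 0],
    [0, 0, 1, 0, 0, 0, 0, 0],
    [-1, 0, 0, 0, 0, -1, 0, 0],
    [1, 0, 0, 0, 0, 0, 0, 0],
    [0, 0, 0, 0, 0, 1, 0, 0],
    [0, -1, 0, -1, 0, 0, 0, 0],
    [0, 1, 0, 0, 0, 0, 0, 0],
    [0, 0, 0, 1, 0, 0, 0, 0],
    [1, 0, 1, 1, 0, 0, 0, 1],
    [-1, 0, 0, 0, 0, 0, 0, -1],
    [0, 0, -1, -1, 0, 0, 0, 0],
    [0, 0, 0, 0, 1, 0, 0, 0],
    [0, 0, 0, 0, 0, 0, 1, 0],
    [0, 0, 0, 0, -1, 0, -1, 0]]"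
definition tab3 :: "za list list" where
  "tab3 = [[Za (-2) 0, Za 1 1, Za 0 (-1)],
    [Za 0 0, Za 1 0, Za 0 0],
    [Za 0 0, Za (-1) 0, Za 0 1],
    [Za 0 0, Za 0 0, Za 1 0],
    [Za 0 (-1), Za (-2) 0, Za 1 1],
    [Za 0 (-1), Za 0 0, Za 1 0],
    [Za 0 0, Za (-1) (-1), Za (-1) 0],
    [Za 0 1, Za 1 0, Za (-1) (-1)],
    [Za 0 1, Za 1 0, Za (-1) 0],
    [Za 1 1, Za 0 (-1), Za (-2) 0],
    [Za 1 0, Za 0 0, Za 0 0],
    [Za (-1) 0, Za 0 1, Za 0 0],
    [Za 1 1, Za 1 0, Za 0 0],
    [Za 1 0, Za (-1) (-1), Za 0 1],
    [Za (-1) 0, Za 1 0, Za 0 (-1)],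
    [Za (-1) (-1), Za 0 1, Za 1 0],
    [Za (-1) 0, Za 0 0, Za (-1) (-1)],
    [Za 1 0, Za 0 (-1), Za (-1) 0],
    [Za (-1) (-1), Za (-1) 0, Za 1 0],
    [Za (-1) 0, Za 1 1, Za 1 0],
    [Za 1 0, Za (-1) 0, Za 1 1]]"

definition v1 :: "f2mat \<Rightarrow> int list" where "v1 x = [1]"
definition v6 :: "f2mat \<Rightarrow> int list" where "v6 x = tab6 ! pos (fst x)"
text \<open>With the sum of \<open>q\<close> and \<open>r\<close> as third vector, the listed pairs
  begin the three rotations of the sequence 1, 0, 2 that belongs to the standard frame, that is, the
  even permutations.\<close>

fun v7 :: "f2mat \<Rightarrow> int list" where
  "v7 (p, q, r) = map ((*) (if (pos2 p (red p q), pos2 p (red p r)) \<in> {(1, 0), (0, 2), (2, 1)}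
     then 1 else - 1)) (tab7 ! pos p)"
definition v8 :: "f2mat \<Rightarrow> int list" where "v8 x = tab8 ! fpos x"
text \<open>For an upper unitriangular matrix the two values of \<open>piv\<close> are the entries
  next to the diagonal. The sign is 1 exactly when they agree; if both are 1, the matrix has order
  4.\<close>

fun v3 :: "f2mat \<Rightarrow> za list" where
  "v3 (p, q, r) = map ((*) (if piv p q = piv (red p q) (red p r) then 1 else - 1)) (tab3 ! fpos (p, q, r))"

definition base1 :: "f2mat list" where "base1 = [f2_one]"
definition base6 :: "f2mat list" where
  "base6 = [(e1, e2, e3), (e3, e1, e2), (e2, e1, e3), (e23, e1, e3),
    (e13, e2, e3), (e12, e2, e3)]"
definition base7 :: "f2mat list" where
  "base7 = [(e1, e2, e3), (e3, e1, e2), (e2, e1, e3), (e23, e1, e3),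
    (e13, e2, e3), (e12, e2, e3), (e123, e2, e3)]"
definition base8 :: "f2mat list" where
  "base8 = [(e1, e2, e3), (e13, e2, e3), (e23, e13, e3), (e13, e23, e3),
    (e123, e3, e2), (e1, e23, e3), (e123, e2, e3), (e2, e1, e3)]"
definition base3 :: "f2mat list" where "base3 = [(e1, e2, e3), (e3, e1, e2), (e2, e3, e1)]"

text \<open>Zero coefficients are skipped to shorten the evaluations by
  \<open>code_simp\<close>.\<close>

definition lincomb :: "nat \<Rightarrow> 'a::comm_ring_1 list \<Rightarrow> 'a list list \<Rightarrow> 'a list" where
  "lincomb n cs vs = foldr (\<lambda>(c, v) w. if c = 0 then w else map2 (+) (map ((*) c) v) w)
     (zip cs vs) (replicate n 0)"

text \<open>These elementary matrices add row 2 to row 1, row 3 to row 2, row 2 to row 3 and row 1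
  to row 2. The two remaining ones are commutators of these.\<close>

definition gens :: "f2mat list" where
  "gens = [(e1, e12, e3), (e1, e2, e23), (e1, e23, e3), (e12, e2, e3)]"

text \<open>\<open>cs\<close> holds the columns of the matrix of \<open>s\<close>, which are the
  images of the basis vectors. The test asks that this one matrix take \<open>v x\<close> to
  \<open>v (s x)\<close> for all 168 frames, so that every linear relation between the vectors
  \<open>v x\<close> is respected.\<close>

definition closed_under where
  "closed_under v gs s cs = list_all (\<lambda>x. lincomb (length gs) (v x) cs = v (f2_mult s x)) frames"
definition closed_all where
  "closed_all v gs = list_all (\<lambda>s. closed_under v gs s (map (\<lambda>g. v (f2_mult s g)) gs)) gens"

lemma closed_v6: "closed_all v6 base6" by code_simp
lemma closed_v7: "closed_all v7 base7" by code_simp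
lemma closed_v8: "closed_all v8 base8" by code_simp
lemma closed_v3: "closed_all v3 base3" by code_simp
lemma length_frames: "length frames = 168" by code_simp

lemma za_simps [simp]:
  "zre 0 = 0" "zim 0 = 0" "zre 1 = 1" "zim 1 = 0"
  "zre (x + y) = zre x + zre y" "zim (x + y) = zim x + zim y"
  "zre (x - y) = zre x - zre y" "zim (x - y) = zim x - zim y"
  "zre (- x) = - zre x" "zim (- x) = - zim x"
  "zre (x * y) = zre x * zre y - 2 * (zim x * zim y)"
  "zim (x * y) = zre x * zim y + zim x * zre y - zim x * zim y"
  by (auto simp: zero_za_def one_za_def plus_za_def minus_za_def uminus_za_def times_za_def)

lemma za_eq_iff: "x = y \<longleftrightarrow> zre x = zre y \<and> zim x = zim y"
  by (cases x; cases y) auto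

lemma za_of_nat [simp]: "zre (of_nat n) = int n" "zim (of_nat n) = 0"
  by (induction n) auto

lemma za_of_int [simp]: "zre (of_int n) = n" "zim (of_int n) = 0"
  by (cases n; simp)+

lemma za_sum [simp]: "zre (sum f A) = (\<Sum>x\<in>A. zre (f x))" "zim (sum f A) = (\<Sum>x\<in>A. zim (f x))"
  by (induction A rule: infinite_finite_induct) auto

lemma za_torsion_free: "of_nat n * (x::za) = 0 \<Longrightarrow> n > 0 \<Longrightarrow> x = 0"
  by (auto simp: za_eq_iff)

text \<open>The other root of \<open>x^2 + x + 2\<close> is \<open>- 1 - \<alpha>\<close>.\<close>

definition zcnj :: "za \<Rightarrow> za" where "zcnj x = Za (zre x - zim x) (- zim x)"

lemma zcnj_simps [simp]: "zre (zcnj x) = zre x - zim x" "zim (zcnj x) = - zim x"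
  by (auto simp: zcnj_def)

lemma zcnj_hom: "zcnj (x + y) = zcnj x + zcnj y" "zcnj (x * y) = zcnj x * zcnj y"
  "zcnj 0 = 0" "zcnj 1 = 1" "zcnj (of_int n) = of_int n"
  by (auto simp: za_eq_iff algebra_simps)

lemma zcnj_sum: "zcnj (sum f A) = (\<Sum>x\<in>A. zcnj (f x))"
  by (auto simp: za_eq_iff sum_subtractf sum_negf)

section \<open>Matrix representations and Schur's relations\<close>

definition mat_rep :: "('g, 'm) monoid_scheme \<Rightarrow> nat \<Rightarrow> ('g \<Rightarrow> nat \<Rightarrow> nat \<Rightarrow> 'a::comm_ring_1) \<Rightarrow> bool" where
  "mat_rep G d \<rho> \<longleftrightarrow>
     (\<forall>g\<in>carrier G. \<forall>h\<in>carrier G. \<forall>i<d. \<forall>j<d. \<rho> (g \<otimes>\<^bsub>G\<^esub> h) i j = (\<Sum>l<d. \<rho> g i l * \<rho> h l j)) \<and>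
     (\<forall>i<d. \<forall>j<d. \<rho> \<one>\<^bsub>G\<^esub> i j = of_bool (i = j))"

lemma mat_rep_mult:
  "mat_rep G d \<rho> \<Longrightarrow> g \<in> carrier G \<Longrightarrow> h \<in> carrier G \<Longrightarrow> i < d \<Longrightarrow> j < d \<Longrightarrow>
    \<rho> (g \<otimes>\<^bsub>G\<^esub> h) i j = (\<Sum>l<d. \<rho> g i l * \<rho> h l j)"
  by (simp add: mat_rep_def)

lemma mat_rep_one: "mat_rep G d \<rho> \<Longrightarrow> i < d \<Longrightarrow> j < d \<Longrightarrow> \<rho> \<one>\<^bsub>G\<^esub> i j = of_bool (i = j)"
  by (simp add: mat_rep_def)

text \<open>For fixed \<open>l\<close> and \<open>i\<close>, as a matrix in \<open>k\<close> and
  \<open>j\<close>, this is the sum over the group of \<open>\<rho>' g * E * \<rho> (inv g)\<close>,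
  where \<open>E\<close> is the elementary matrix with its 1 in row \<open>l\<close> and column
  \<open>i\<close>.\<close>

definition avg :: "('g, 'm) monoid_scheme \<Rightarrow> ('g \<Rightarrow> nat \<Rightarrow> nat \<Rightarrow> 'a::comm_ring_1) \<Rightarrow> ('g \<Rightarrow> nat \<Rightarrow> nat \<Rightarrow> 'a) \<Rightarrow>
    nat \<Rightarrow> nat \<Rightarrow> nat \<Rightarrow> nat \<Rightarrow> 'a" where
  "avg G \<rho>' \<rho> l i k j = (\<Sum>g\<in>carrier G. \<rho>' g k l * \<rho> (inv\<^bsub>G\<^esub> g) i j)"

context group
begin

lemma sum_translate: "h \<in> carrier G \<Longrightarrow> (\<Sum>g\<in>carrier G. f (h \<otimes> g)) = (\<Sum>g\<in>carrier G. f g)"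
  by (rule sum.reindex_bij_witness[where i = "\<lambda>g. inv h \<otimes> g" and j = "\<lambda>g. h \<otimes> g"])
    (auto simp: m_assoc[symmetric])

lemma sum_inv: "(\<Sum>g\<in>carrier G. f (inv g)) = (\<Sum>g\<in>carrier G. f g)"
  by (rule sum.reindex_bij_witness[where i = "\<lambda>g. inv g" and j = "\<lambda>g. inv g"]) auto

text \<open>The sum is reindexed by \<open>inv g\<close>. This exchanges the two representations, so
  that orthogonality needs a proof in one order only.\<close>

lemma avg_swap: "avg G \<rho>' \<rho> l i k j = avg G \<rho> \<rho>' j k i l"
  unfolding avg_def
  by (subst sum_inv[symmetric, of "\<lambda>g. \<rho>' g k l * \<rho> (inv g) i j"])
    (auto intro!: sum.cong simp: mult.commute)

lemma avg_intertwines: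
  assumes "mat_rep G d \<rho>" "mat_rep G d' \<rho>'" "h \<in> carrier G" "k < d'" "l < d'" "i < d" "j < d"
  shows "(\<Sum>m<d'. \<rho>' h k m * avg G \<rho>' \<rho> l i m j) = (\<Sum>m<d. avg G \<rho>' \<rho> l i k m * \<rho> h m j)"
proof -
  have "(\<Sum>m<d'. \<rho>' h k m * avg G \<rho>' \<rho> l i m j)
      = (\<Sum>g\<in>carrier G. (\<Sum>m<d'. \<rho>' h k m * \<rho>' g m l) * \<rho> (inv g) i j)"
    unfolding avg_def sum_distrib_left sum_distrib_right
    by (subst sum.swap) (simp add: mult.assoc)
  \<comment> \<open>Writing \<open>inv g\<close> as \<open>inv (h \<otimes> g) \<otimes> h\<close>
    makes the summand a function of \<open>h \<otimes> g\<close>, ready for translation.\<close>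
  also have "\<dots> = (\<Sum>g\<in>carrier G. \<rho>' (h \<otimes> g) k l * \<rho> (inv (h \<otimes> g) \<otimes> h) i j)"
    using assms by (intro sum.cong) (auto simp: mat_rep_mult inv_mult_group m_assoc)
  also have "\<dots> = (\<Sum>g\<in>carrier G. \<rho>' g k l * \<rho> (inv g \<otimes> h) i j)"
    using assms by (intro sum_translate) auto
  also have "\<dots> = (\<Sum>g\<in>carrier G. \<Sum>m<d. \<rho>' g k l * (\<rho> (inv g) i m * \<rho> h m j))"
    using assms by (intro sum.cong) (auto simp: mat_rep_mult sum_distrib_left)
  also have "\<dots> = (\<Sum>m<d. avg G \<rho>' \<rho> l i k m * \<rho> h m j)"
    unfolding avg_def sum_distrib_right by (subst sum.swap) (simp add: mult.assoc)
  finally show ?thesis .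
qed

text \<open>The first basis vector spans an eigenline of \<open>H\<close> with eigenvalue \<open>\<epsilon>\<close>, so its image under an
  intertwiner is fixed, up to the factor \<open>card H\<close>, by the sum of the \<open>\<epsilon> h \<cdot> \<rho>' h\<close>.\<close>

lemma avg_eigenline:
  fixes \<rho> \<rho>' :: "'a \<Rightarrow> nat \<Rightarrow> nat \<Rightarrow> za"
  assumes rep: "mat_rep G d \<rho>" "mat_rep G d' \<rho>'"
    and H: "finite H" "H \<noteq> {}" "H \<subseteq> carrier G"
    and line: "\<And>h m. h \<in> H \<Longrightarrow> m < d \<Longrightarrow> \<rho> h m 0 = (if m = 0 then \<epsilon> h else 0)"
    and unit: "\<And>h. h \<in> H \<Longrightarrow> \<epsilon> h * \<epsilon> h = 1"
    and ker: "\<And>m. m < d' \<Longrightarrow> (\<Sum>h\<in>H. \<epsilon> h * \<rho>' h k m) = 0"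
    and idx: "0 < d" "k < d'" "l < d'" "i < d"
  shows "avg G \<rho>' \<rho> l i k 0 = 0"
proof -
  have eig: "(\<Sum>m<d'. \<rho>' h k m * avg G \<rho>' \<rho> l i m 0) = \<epsilon> h * avg G \<rho>' \<rho> l i k 0" if "h \<in> H" for h
  proof -
    have "(\<Sum>m<d'. \<rho>' h k m * avg G \<rho>' \<rho> l i m 0) = (\<Sum>m<d. avg G \<rho>' \<rho> l i k m * \<rho> h m 0)"
      using avg_intertwines[OF rep, of h k l i 0] that H idx by auto
    also have "\<dots> = (\<Sum>m<d. if m = 0 then avg G \<rho>' \<rho> l i k 0 * \<epsilon> h else 0)"
      using line[OF that] by (intro sum.cong) auto
    also have "\<dots> = \<epsilon> h * avg G \<rho>' \<rho> l i k 0"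
      using idx by (simp add: mult.commute)
    finally show ?thesis .
  qed
  have "of_nat (card H) * avg G \<rho>' \<rho> l i k 0 = (\<Sum>h\<in>H. \<epsilon> h * (\<epsilon> h * avg G \<rho>' \<rho> l i k 0))"
    by (simp add: mult.assoc[symmetric] unit)
  also have "\<dots> = (\<Sum>h\<in>H. \<epsilon> h * (\<Sum>m<d'. \<rho>' h k m * avg G \<rho>' \<rho> l i m 0))"
    by (simp add: eig)
  also have "\<dots> = (\<Sum>m<d'. (\<Sum>h\<in>H. \<epsilon> h * \<rho>' h k m) * avg G \<rho>' \<rho> l i m 0)"
    unfolding sum_distrib_left sum_distrib_right by (subst sum.swap) (simp add: mult.assoc)
  also have "\<dots> = 0"
    using ker by simp
  finally show ?thesis
    using za_torsion_free H by (metis card_gt_0_iff)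
qed

text \<open>\<open>g\<close> moves the first basis vector to the \<open>j\<close>-th one, so the
  intertwining property for \<open>g\<close> recovers column \<open>j\<close> from column 0.\<close>

lemma avg_column:
  assumes rep: "mat_rep G d \<rho>" "mat_rep G d' \<rho>'" and g: "g \<in> carrier G"
    and cyc: "\<And>m. m < d \<Longrightarrow> \<rho> g m 0 = of_bool (m = j)"
    and idx: "j < d" "k < d'" "l < d'" "i < d"
  shows "avg G \<rho>' \<rho> l i k j = (\<Sum>m<d'. \<rho>' g k m * avg G \<rho>' \<rho> l i m 0)"
proof -
  have "(\<Sum>m<d'. \<rho>' g k m * avg G \<rho>' \<rho> l i m 0) = (\<Sum>m<d. avg G \<rho>' \<rho> l i k m * \<rho> g m 0)"
    using idx g by (intro avg_intertwines[OF rep]) auto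
  also have "\<dots> = (\<Sum>m<d. if m = j then avg G \<rho>' \<rho> l i k j else 0)"
    using cyc by (intro sum.cong) auto
  finally show ?thesis
    using idx by simp
qed

text \<open>Each summand is conjugate to an elementary matrix and has the same trace as it.\<close>

lemma avg_trace:
  assumes "mat_rep G d \<rho>" "l < d" "i < d"
  shows "(\<Sum>k<d. avg G \<rho> \<rho> l i k k) = of_nat (card (carrier G)) * of_bool (i = l)"
proof -
  have "(\<Sum>k<d. avg G \<rho> \<rho> l i k k) = (\<Sum>g\<in>carrier G. \<Sum>k<d. \<rho> (inv g) i k * \<rho> g k l)"
    unfolding avg_def by (subst sum.swap) (simp add: mult.commute)
  also have "\<dots> = (\<Sum>g\<in>carrier G. \<rho> \<one> i l)"
    using assms mat_rep_mult[OF assms(1), symmetric] by (intro sum.cong) auto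
  finally show ?thesis
    using assms by (simp add: mat_rep_one)
qed

end

section \<open>The frames form a group of order 168\<close>

abbreviation "f2_zero \<equiv> (False, False, False)"

lemma f2_add_commute: "f2_add p q = f2_add q p"
  by (cases p; cases q) auto

lemma f2_add_assoc: "f2_add (f2_add p q) r = f2_add p (f2_add q r)"
  by (cases p; cases q; cases r) auto

lemma f2_add_left_commute: "f2_add p (f2_add q r) = f2_add q (f2_add p r)"
  by (metis f2_add_assoc f2_add_commute)

lemmas f2_add_ac = f2_add_assoc f2_add_commute f2_add_left_commute

lemma f2_add_eq_zero_iff: "f2_add p q = f2_zero \<longleftrightarrow> p = q"
  by (cases p; cases q) auto

lemma f2_add_cancel [simp]: "f2_add f2_zero p = p" "f2_add p f2_zero = p" "f2_add p p = f2_zero" "f2_add p (f2_add p q) = q"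
  by (cases p; cases q; auto)+

lemma f2_app_add: "f2_app x (f2_add p q) = f2_add (f2_app x p) (f2_app x q)"
proof -
  obtain a b c a' b' c' where "p = (a, b, c)" "q = (a', b', c')"
    by (metis prod.exhaust)
  then show ?thesis
    by (cases x; cases a; cases b; cases c; cases a'; cases b'; cases c'; simp add: f2_add_ac)
qed

lemma f2_app_zero [simp]: "f2_app x f2_zero = f2_zero"
  by (cases x) simp

lemma f2_app_one [simp]: "f2_app f2_one p = p"
  by (cases p) (auto simp: f2_one_def)

lemma f2_mult_one [simp]: "f2_mult f2_one x = x" "f2_mult x f2_one = x"
  by (cases x; auto simp: f2_one_def)+

lemma f2_app_comp: "f2_app x (f2_app y p) = f2_app (f2_mult x y) p"
  by (cases p; cases y) (auto simp: f2_app_add)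

lemma f2_mult_assoc: "f2_mult (f2_mult x y) z = f2_mult x (f2_mult y z)"
  by (cases z) (simp add: f2_app_comp)

text \<open>Linear independence of the columns in the form of a trivial kernel: in this form it
  passes to products and yields inverses without case distinctions.\<close>

lemma frame_iff: "frame x \<longleftrightarrow> (\<forall>v. f2_app x v = f2_zero \<longrightarrow> v = f2_zero)"
proof -
  obtain p q r where x: "x = (p, q, r)"
    using prod_cases3 by blast
  have all: "(\<forall>v. Q v) \<longleftrightarrow> Q f2_zero \<and> Q e1 \<and> Q e2 \<and> Q e3 \<and> Q e12 \<and> Q e13 \<and> Q e23 \<and> Q e123"
    for Q :: "f2vec \<Rightarrow> bool"
    by (simp only: split_paired_All all_bool_eq) blast
  show ?thesis
    unfolding x all by (simp add: Let_def f2_add_eq_zero_iff) (metis f2_add_commute f2_add_cancel(4))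
qed

declare frame.simps [simp del] f2_app.simps [simp del]

lemma frame_one: "frame f2_one"
  by (simp add: frame_iff)

lemma frame_mult: "frame x \<Longrightarrow> frame y \<Longrightarrow> frame (f2_mult x y)"
  by (metis frame_iff f2_app_comp)

text \<open>An injective map of a finite space is surjective, and preimages of the standard basis
  vectors are the columns of the inverse.\<close>

lemma frame_right_inverse:
  assumes "frame x"
  obtains y where "frame y" "f2_mult x y = f2_one"
proof -
  have "inj (f2_app x)"
    using assms by (metis (no_types, lifting) f2_app_add frame_iff injI f2_add_eq_zero_iff)
  then have "surj (f2_app x)"
    by (simp add: finite_UNIV_inj_surj)
  then obtain p q r where "f2_app x p = e1" "f2_app x q = e2" "f2_app x r = e3"
    by (metis surjD)
  then have "f2_mult x (p, q, r) = f2_one"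
    by (simp add: f2_one_def)
  moreover from this have "frame (p, q, r)"
    by (metis f2_app_comp f2_app_one f2_app_zero frame_iff)
  ultimately show thesis
    using that by blast
qed

definition frame_group :: "f2mat monoid" where
  "frame_group = \<lparr>carrier = {x. frame x}, monoid.mult = f2_mult, one = f2_one\<rparr>"

lemma frame_group_simps [simp]: "carrier frame_group = {x. frame x}" "monoid.mult frame_group = f2_mult" "\<one>\<^bsub>frame_group\<^esub> = f2_one"
  by (auto simp: frame_group_def)

lemma group_frame_group: "group frame_group"
proof (rule groupI)
  fix x assume "x \<in> carrier frame_group"
  then have "frame x"
    by simp
  then obtain y where y: "frame y" "f2_mult x y = f2_one"
    by (rule frame_right_inverse)
  \<comment> \<open>\<open>groupI\<close> asks for a left inverse. The right inverse
    \<open>z\<close> of \<open>y\<close> must equal \<open>x\<close> by associativity.\<close>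
  from y(1) obtain z where "frame z" "f2_mult y z = f2_one"
    by (rule frame_right_inverse)
  with y have "f2_mult y x = f2_one"
    by (metis f2_mult_assoc f2_mult_one(1) f2_mult_one(2))
  with y show "\<exists>y\<in>carrier frame_group. y \<otimes>\<^bsub>frame_group\<^esub> x = \<one>\<^bsub>frame_group\<^esub>"
    by (intro bexI[of _ y]) simp_all
qed (auto simp: frame_mult frame_one f2_mult_assoc)

lemma set_f2_vecs: "set f2_vecs = {v. v \<noteq> f2_zero}"
  by (auto simp: f2_vecs_def)

lemma frame_nonzero: "frame (p, q, r) \<Longrightarrow> p \<noteq> f2_zero \<and> q \<noteq> f2_zero \<and> r \<noteq> f2_zero"
  by (simp add: frame.simps Let_def)

lemma set_frames: "set frames = {x. frame x}"
proof (rule Set.set_eqI)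
  fix x :: f2mat
  obtain p q r where "x = (p, q, r)"
    using prod_cases3 by blast
  then show "x \<in> set frames \<longleftrightarrow> x \<in> {x. frame x}"
    using frame_nonzero[of p q r] unfolding frames_def set_filter set_product set_f2_vecs by blast
qed

lemma distinct_frames: "distinct frames"
  unfolding frames_def by (intro distinct_filter distinct_product) (auto simp: f2_vecs_def)

lemma card_frame_group: "card (carrier frame_group) = 168"
  using distinct_card[OF distinct_frames] length_frames by (simp add: set_frames)

section \<open>Generation by elementary matrices\<close>

definition clear :: "(f2mat \<Rightarrow> bool) \<Rightarrow> f2mat \<Rightarrow> f2mat \<Rightarrow> f2mat" where
  "clear c s x = (if c x then f2_mult s x else x)"

text \<open>Row reduction to the identity; each matrix adds one row to another and is an involution.
  Four steps turn the first column into \<open>e1\<close> and three turn the second into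
  \<open>e2\<close>. By independence the third column then ends in 1, and two steps clear its other
  entries.\<close>

definition elim_steps :: "((f2mat \<Rightarrow> bool) \<times> f2mat) list" where
  "elim_steps =
    [(\<lambda>((a, b, c), q, r). \<not> a \<and> b, (e1, e12, e3)),
     (\<lambda>((a, b, c), q, r). \<not> a, (e1, e2, e13)),
     (\<lambda>((a, b, c), q, r). b, (e12, e2, e3)),
     (\<lambda>((a, b, c), q, r). c, (e13, e2, e3)),
     (\<lambda>(p, (a, b, c), r). \<not> b, (e1, e2, e23)),
     (\<lambda>(p, (a, b, c), r). c, (e1, e23, e3)),
     (\<lambda>(p, (a, b, c), r). a, (e1, e12, e3)),
     (\<lambda>(p, q, (a, b, c)). a, (e1, e2, e13)),
     (\<lambda>(p, q, (a, b, c)). b, (e1, e2, e23))]"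

fun eliminate :: "f2mat \<Rightarrow> f2mat" where
  "eliminate (p, q, r) = fold (\<lambda>(c, s). clear c s) elim_steps (p, q, r)"

lemma eliminate_frames: "list_all (\<lambda>x. eliminate x = f2_one) frames"
  by code_simp

text \<open>An elimination step is undone by repeating it, so \<open>P\<close> travels back from the
  identity to \<open>x\<close>.\<close>

lemma frame_induct [consumes 1, case_names gen mult]:
  assumes "frame x" and gen: "\<And>s. s \<in> set gens \<Longrightarrow> P s"
    and mult: "\<And>x y. frame x \<Longrightarrow> frame y \<Longrightarrow> P x \<Longrightarrow> P y \<Longrightarrow> P (f2_mult x y)"
  shows "P x"
proof -
  let ?a = "(e1, e12, e3)" and ?b = "(e1, e2, e23)" and ?c = "(e1, e23, e3)" and ?d = "(e12, e2, e3)"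
  have P: "P ?a" "P ?b" "P ?c" "P ?d"
    by (auto intro!: gen simp: gens_def)
  \<comment> \<open>For involutions the square of a product is a commutator. The two commutators add
    row 3 to row 1 and row 1 to row 3, the matrices still missing for \<open>elim_steps\<close>; the
    square of \<open>?a\<close> is the identity.\<close>
  have "P (f2_mult (f2_mult ?a ?b) (f2_mult ?a ?b))" "P (f2_mult (f2_mult ?c ?d) (f2_mult ?c ?d))" "P (f2_mult ?a ?a)"
    by (intro mult P frame_mult; simp add: Let_def frame.simps)+
  then have P': "P (e1, e2, e13)" "P (e13, e2, e3)" "P f2_one"
    by (simp_all add: f2_one_def f2_app.simps)
  have step: "P (clear c s x) \<longrightarrow> P x" if "P s" "frame s" "f2_mult s s = f2_one" "frame x" for c s x
    using that mult[of s "f2_mult s x"] unfolding clear_def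
    by (auto simp: f2_mult_assoc[symmetric] frame_mult)
  have frame_clear: "frame (clear c s x)" if "frame s" "frame x" for c s x
    using that by (simp add: clear_def frame_mult)
  define Q where "Q s \<longleftrightarrow> P s \<and> frame s \<and> f2_mult s s = f2_one" for s
  have fold: "P x" if "list_all (Q \<circ> snd) cs" "frame x" "P (fold (\<lambda>(c, s). clear c s) cs x)" for cs x
    using that
  proof (induction cs arbitrary: x)
    case (Cons cs css)
    have s: "P (snd cs)" "frame (snd cs)" "f2_mult (snd cs) (snd cs) = f2_one"
      using Cons.prems(1) by (simp_all add: Q_def)
    have "P (clear (fst cs) (snd cs) x)"
      by (rule Cons.IH) (use Cons.prems s in \<open>simp_all add: frame_clear case_prod_beta\<close>)
    with s Cons.prems(2) step[of "snd cs" x "fst cs"] show ?case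
      by blast
  qed auto
  have "list_all (Q \<circ> snd) elim_steps"
    using P P' by (simp add: elim_steps_def Q_def Let_def f2_one_def f2_app.simps frame.simps)
  then have "P (eliminate x) \<Longrightarrow> P x"
    using fold[of elim_steps x] assms(1) by (cases x) (simp only: eliminate.simps)
  moreover have "eliminate x = f2_one"
    using eliminate_frames assms(1) unfolding list_all_iff set_frames by blast
  ultimately show ?thesis
    using P' by simp
qed

section \<open>Representation matrices from the vector tables\<close>

lemma length_lincomb:
  assumes "\<forall>v\<in>set vs. length v = n"
  shows "length (lincomb n cs vs) = n"
  using assms unfolding lincomb_def
  by (induction vs arbitrary: cs) (auto simp: zip_Cons split: list.splits)

lemma lincomb_nth:
  assumes "length cs = length vs" "\<forall>v\<in>set vs. length v = n" "i < n"
  shows "lincomb n cs vs ! i = (\<Sum>j<length vs. cs ! j * vs ! j ! i)"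
  using assms(1,2)
proof (induction cs vs rule: list_induct2)
  case Nil
  then show ?case
    using assms(3) by (simp add: lincomb_def)
next
  case (Cons c cs v vs)
  have len: "length (lincomb n cs vs) = n"
    using Cons.prems by (intro length_lincomb) auto
  have "lincomb n (c # cs) (v # vs) ! i = c * v ! i + lincomb n cs vs ! i"
    using Cons.prems assms(3) len by (auto simp: lincomb_def)
  then show ?case
    using Cons by (simp add: sum.lessThan_Suc_shift del: sum.lessThan_Suc)
qed

definition repmat :: "(f2mat \<Rightarrow> 'a::comm_ring_1 list) \<Rightarrow> f2mat list \<Rightarrow> f2mat \<Rightarrow> nat \<Rightarrow> nat \<Rightarrow> 'a" where
  "repmat v gs g i j = v (f2_mult g (gs ! j)) ! i"

definition based :: "(f2mat \<Rightarrow> 'a::comm_ring_1 list) \<Rightarrow> f2mat list \<Rightarrow> bool" where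
  "based v gs \<longleftrightarrow> list_all (\<lambda>x. length (v x) = length gs) frames \<and> list_all frame gs \<and> gs ! 0 = f2_one \<and>
     map v gs = map (\<lambda>i. map (\<lambda>j. if i = j then 1 else 0) [0..<length gs]) [0..<length gs]"

lemma based_v1: "based v1 base1" by code_simp
lemma based_v6: "based v6 base6" by code_simp
lemma based_v7: "based v7 base7" by code_simp
lemma based_v8: "based v8 base8" by code_simp
lemma based_v3: "based v3 base3" by code_simp
lemma closed_v1: "closed_all v1 base1" by code_simp

lemma based_length: "based v gs \<Longrightarrow> frame x \<Longrightarrow> length (v x) = length gs"
  unfolding based_def list_all_iff set_frames by blast

lemma based_frame: "based v gs \<Longrightarrow> j < length gs \<Longrightarrow> frame (gs ! j)"
  unfolding based_def list_all_iff by simp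

lemma based_nth:
  assumes "based v gs" "i < length gs" "j < length gs"
  shows "v (gs ! j) ! i = of_bool (i = j)"
proof -
  have "v (gs ! j) = map v gs ! j"
    using assms by simp
  also have "\<dots> = map (\<lambda>i. if j = i then 1 else 0) [0..<length gs]"
    using assms by (simp add: based_def)
  finally show ?thesis
    using assms by auto
qed

lemma repmat_first: "based v gs \<Longrightarrow> repmat v gs g i 0 = v g ! i"
  by (simp add: repmat_def based_def)

lemma frame_gens: "s \<in> set gens \<Longrightarrow> frame s"
  by (auto simp: gens_def frame.simps Let_def)

text \<open>The finite check gives the generators. Products follow because \<open>x\<close> is
  arbitrary: the columns of the matrix of \<open>h\<close> are again vectors attached to frames, so
  the claim for \<open>g\<close> applies to them. Multiplicativity of \<open>repmat\<close> is the
  instance where \<open>x\<close> is \<open>h\<close> times a frame of \<open>gs\<close>.\<close>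

lemma repmat_apply:
  assumes "closed_all v gs" "based v gs" "frame g" "frame x" "i < length gs"
  shows "(\<Sum>j<length gs. repmat v gs g i j * v x ! j) = v (f2_mult g x) ! i"
  using assms(3,4,5)
proof (induction arbitrary: x i rule: frame_induct)
  case (gen s)
  let ?vs = "map (\<lambda>g. v (f2_mult s g)) gs"
  have len: "length (v y) = length gs" if "frame y" for y
    using assms(2) that by (rule based_length)
  have "lincomb (length gs) (v x) ?vs = v (f2_mult s x)"
    using assms(1) gen unfolding closed_all_def closed_under_def list_all_iff set_frames by blast
  moreover have "\<forall>v\<in>set ?vs. length v = length gs"
  proof
    fix w
    assume "w \<in> set ?vs"
    then obtain g where w: "w = v (f2_mult s g)" and g: "g \<in> set gs"
      unfolding set_map by (rule imageE)
    from g have "frame g"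
      using assms(2) unfolding based_def list_all_iff by blast
    then show "length w = length gs"
      using frame_gens[OF gen(1)] by (simp add: w len frame_mult)
  qed
  ultimately show ?case
    using lincomb_nth[of "v x" ?vs "length gs" i] gen len[of x] by (simp add: repmat_def mult.commute)
next
  case (mult g h)
  have "(\<Sum>j<length gs. repmat v gs (f2_mult g h) i j * v x ! j)
      = (\<Sum>j<length gs. (\<Sum>l<length gs. repmat v gs g i l * repmat v gs h l j) * v x ! j)"
    using mult based_frame[OF assms(2)]
    by (intro sum.cong refl) (simp add: repmat_def[of v gs "f2_mult g h"] repmat_def[of v gs h] f2_mult_assoc frame_mult)
  also have "\<dots> = (\<Sum>l<length gs. repmat v gs g i l * (\<Sum>j<length gs. repmat v gs h l j * v x ! j))"
    unfolding sum_distrib_left sum_distrib_right by (subst sum.swap) (simp add: mult.assoc)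
  also have "\<dots> = v (f2_mult (f2_mult g h) x) ! i"
    using mult by (simp add: f2_mult_assoc frame_mult)
  finally show ?case .
qed

lemma mat_rep_repmat:
  assumes "closed_all v gs" "based v gs"
  shows "mat_rep frame_group (length gs) (repmat v gs)"
  unfolding mat_rep_def
proof (intro conjI ballI allI impI)
  fix g h i j
  assume gh: "g \<in> carrier frame_group" "h \<in> carrier frame_group" and ij: "i < length gs" "j < length gs"
  then have *: "frame g" "frame (f2_mult h (gs ! j))"
    using based_frame[OF assms(2)] by (auto intro: frame_mult)
  show "repmat v gs (g \<otimes>\<^bsub>frame_group\<^esub> h) i j = (\<Sum>l<length gs. repmat v gs g i l * repmat v gs h l j)"
    using repmat_apply[OF assms * ij(1)] by (simp add: repmat_def[of v gs h] repmat_def[of v gs "f2_mult g h"] f2_mult_assoc)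
next
  fix i j
  assume "i < length gs" "j < length gs"
  then show "repmat v gs \<one>\<^bsub>frame_group\<^esub> i j = of_bool (i = j)"
    by (simp add: repmat_def based_nth[OF assms(2)])
qed

section \<open>The six absolutely irreducible representations\<close>

text \<open>The order of the degrees matters: the sum over the stabiliser \<open>stab b\<close>, twisted by its character \<open>eps b\<close> on the
  first basis vector, vanishes in every later representation except the conjugate of the same one. The
  stabiliser of a flag fixes vectors in degree 6, so 8 has to come after 6.\<close>

definition blockdim :: "nat \<Rightarrow> nat" where
  "blockdim b = [1, 6, 8, 7, 3, 3] ! b"

definition ivec :: "nat \<Rightarrow> f2mat \<Rightarrow> int list" where
  "ivec b = [v1, v6, v8, v7] ! b"

definition ibase :: "nat \<Rightarrow> f2mat list" where
  "ibase b = [base1, base6, base8, base7] ! b"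

definition stab :: "nat \<Rightarrow> f2mat list" where
  "stab b = (if b = 0 then frames
    else if b = 1 \<or> b = 3 then filter (\<lambda>x. fst x = e1) frames
    else filter (\<lambda>x. fst x = e1 \<and> (fst (snd x) = e2 \<or> fst (snd x) = e12)) frames)"

text \<open>In degrees 7 and 3 the eigenvalue is read off as the first coordinate of the image of
  the first basis vector; \<open>line_int\<close> and \<open>line_za\<close> confirm that the other
  coordinates vanish.\<close>

definition eps :: "nat \<Rightarrow> f2mat \<Rightarrow> int" where
  "eps b h = (if b < 3 then 1 else if b = 3 then hd (v7 h) else zre (hd (v3 h)))"

text \<open>One column of the operator that sums \<open>c h\<close> times the action of
  \<open>h\<close> over \<open>H\<close>. For \<open>c = eps b\<close> and \<open>H = stab b\<close>
  it is the order of \<open>H\<close> times the projection onto the eigenspace of \<open>H\<close>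
  for the character \<open>eps b\<close>.\<close>

definition stab_sum :: "nat \<Rightarrow> (f2mat \<Rightarrow> 'a::comm_ring_1) \<Rightarrow> (f2mat \<Rightarrow> 'a list) \<Rightarrow> f2mat list \<Rightarrow> f2mat \<Rightarrow> 'a list" where
  "stab_sum n c v H g = lincomb n (map c H) (map (\<lambda>h. v (f2_mult h g)) H)"

lemma line_int: "list_all (\<lambda>b. list_all (\<lambda>h. ivec b h = eps b h # replicate (blockdim b - 1) 0 \<and> eps b h * eps b h = 1) (stab b)) [0..<4]"
  by code_simp

lemma line_za: "list_all (\<lambda>h. v3 h = [Za (eps 4 h) 0, 0, 0] \<and> eps 4 h * eps 4 h = 1) (stab 4)"
  by code_simp

text \<open>The projection vanishes on a basis, so representation \<open>b'\<close> has no nonzero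
  vector on which \<open>stab b\<close> acts through \<open>eps b\<close>.\<close>

definition kill :: "nat \<Rightarrow> nat \<Rightarrow> bool" where
  "kill b b' = list_all (\<lambda>g. stab_sum (blockdim b') (eps b) (ivec b') (stab b) g = replicate (blockdim b') 0) (ibase b')"

definition kill3 :: "nat \<Rightarrow> bool" where
  "kill3 b = list_all (\<lambda>g. stab_sum 3 (\<lambda>h. Za (eps b h) 0) v3 (stab b) g = [0, 0, 0]) base3"

lemma kill01: "kill 0 1" by code_simp
lemma kill02: "kill 0 2" by code_simp
lemma kill03: "kill 0 3" by code_simp
lemma kill12: "kill 1 2" by code_simp
lemma kill13: "kill 1 3" by code_simp
lemma kill23: "kill 2 3" by code_simp
lemma kill3_0: "kill3 0" by code_simp
lemma kill3_123: "kill3 1 \<and> kill3 2 \<and> kill3 3" by code_simp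

text \<open>The projection maps into the line of the first basis vector, so the eigencharacter
  occurs with multiplicity one. This is what forces a self-intertwiner to be scalar.\<close>

lemma keep_int: "list_all (\<lambda>b. list_all (\<lambda>g. tl (stab_sum (blockdim b) (eps b) (ivec b) (stab b) g) =
  replicate (blockdim b - 1) 0) (ibase b)) [0..<4]"
  by code_simp

lemma keep_za: "list_all (\<lambda>g. tl (stab_sum 3 (\<lambda>h. Za (eps 4 h) 0) v3 (stab 4) g) = [0, 0]) base3"
  by code_simp

definition irep :: "nat \<Rightarrow> f2mat \<Rightarrow> nat \<Rightarrow> nat \<Rightarrow> int" where
  "irep b = repmat (ivec b) (ibase b)"

definition rep3 :: "f2mat \<Rightarrow> nat \<Rightarrow> nat \<Rightarrow> za" where
  "rep3 = repmat v3 base3"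

text \<open>With all six representations over \<open>\<int>[\<alpha>]\<close>, one argument covers
  the integral ones and the conjugate pair 4, 5.\<close>

definition zrep :: "nat \<Rightarrow> f2mat \<Rightarrow> nat \<Rightarrow> nat \<Rightarrow> za" where
  "zrep b g i j = (if b < 4 then of_int (irep b g i j) else if b = 4 then rep3 g i j else zcnj (rep3 g i j))"

definition zbase :: "nat \<Rightarrow> f2mat list" where
  "zbase b = (if b < 4 then ibase b else base3)"

lemma less_4_cases: "b < 4 \<Longrightarrow> b = 0 \<or> b = 1 \<or> b = 2 \<or> b = (3::nat)"
  by auto

lemma less_6_cases: "b < 6 \<Longrightarrow> b < 4 \<or> b = 4 \<or> b = (5::nat)"
  by auto

lemma irep_closed: "b < 4 \<Longrightarrow> closed_all (ivec b) (ibase b)"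
  using closed_v1 closed_v6 closed_v8 closed_v7 by (auto dest!: less_4_cases simp: ivec_def ibase_def)

lemma irep_based: "b < 4 \<Longrightarrow> based (ivec b) (ibase b)"
  using based_v1 based_v6 based_v8 based_v7 by (auto dest!: less_4_cases simp: ivec_def ibase_def)

lemma length_ibase: "b < 4 \<Longrightarrow> length (ibase b) = blockdim b"
  by (auto dest!: less_4_cases simp: ibase_def blockdim_def base1_def base6_def base8_def base7_def)

lemma length_base3: "length base3 = 3"
  by (simp add: base3_def)

lemma blockdim_45 [simp]: "blockdim 4 = 3" "blockdim 5 = 3"
  by (simp_all add: blockdim_def)

lemma blockdim_pos: "b < 6 \<Longrightarrow> 0 < blockdim b"
  by (auto dest!: less_6_cases less_4_cases simp: blockdim_def)

lemma mat_rep_irep: "b < 4 \<Longrightarrow> mat_rep frame_group (blockdim b) (irep b)"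
  using mat_rep_repmat[OF irep_closed irep_based, of b] by (simp add: irep_def length_ibase)

lemma mat_rep_rep3: "mat_rep frame_group 3 rep3"
  using mat_rep_repmat[OF closed_v3 based_v3] by (simp add: rep3_def length_base3)

lemma mat_rep_zrep:
  assumes "b < 6"
  shows "mat_rep frame_group (blockdim b) (zrep b)"
proof -
  consider "b < 4" | "b = 4" | "b = 5"
    using assms by linarith
  then show ?thesis
  proof cases
    case 1
    then show ?thesis
      using mat_rep_irep[of b] by (auto simp: mat_rep_def zrep_def)
  next
    case 2
    then show ?thesis
      using mat_rep_rep3 by (simp add: mat_rep_def zrep_def)
  next
    case 3
    then show ?thesis
      using mat_rep_rep3 by (simp add: mat_rep_def zrep_def zcnj_sum zcnj_hom of_bool_def)
  qed
qed

lemma zbase_frame: "b < 6 \<Longrightarrow> j < blockdim b \<Longrightarrow> frame (zbase b ! j)"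
  using based_frame[OF irep_based, of b] based_frame[OF based_v3]
  by (auto dest!: less_6_cases simp: zbase_def length_ibase length_base3)

lemma zrep_base:
  assumes "b < 6" "i < blockdim b" "j < blockdim b"
  shows "zrep b (zbase b ! j) i 0 = of_bool (i = j)"
proof -
  consider "b < 4" | "b = 4" | "b = 5"
    using assms by linarith
  then show ?thesis
  proof cases
    case 1
    then show ?thesis
      using assms based_nth[OF irep_based, of b i j]
      by (simp add: zrep_def irep_def zbase_def repmat_first[OF irep_based] length_ibase)
  qed (use assms based_nth[OF based_v3, of i j] in
      \<open>auto simp: zrep_def rep3_def zbase_def repmat_first[OF based_v3] length_base3 zcnj_hom\<close>)
qed

lemma stab_frame: "h \<in> set (stab b) \<Longrightarrow> frame h"
  using set_frames by (auto simp: stab_def split: if_splits)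

lemma distinct_stab: "distinct (stab b)"
  by (simp add: stab_def distinct_frames)

lemma stab_nonempty: "set (stab b) \<noteq> {}"
proof -
  have "f2_one \<in> set (stab b)"
    using frame_one set_frames unfolding stab_def f2_one_def by simp
  then show ?thesis
    by (metis empty_iff)
qed

lemma eps_stab_5: "eps 5 = eps 4" "stab 5 = stab 4"
  by (rule ext, simp add: eps_def) (simp add: stab_def)

lemma eps_square:
  assumes "b < 6" "h \<in> set (stab b)"
  shows "eps b h * eps b h = 1"
proof -
  consider "b < 4" | "b = 4" | "b = 5"
    using assms by linarith
  then show ?thesis
  proof cases
    case 1
    then have "b \<in> set [0..<4]"
      by simp
    then show ?thesis
      using line_int assms unfolding list_all_iff by blast
  next
    case 2
    then show ?thesis
      using line_za assms unfolding list_all_iff by blast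
  next
    case 3
    then have "eps b = eps 4" "stab b = stab 4"
      using eps_stab_5 by simp_all
    then show ?thesis
      using line_za assms unfolding list_all_iff by metis
  qed
qed

lemma za_of_int_eq: "of_int n = Za n 0"
  by (simp add: za_eq_iff)

lemma zrep_line:
  assumes "b < 6" "h \<in> set (stab b)" "m < blockdim b"
  shows "zrep b h m 0 = (if m = 0 then of_int (eps b h) else 0)"
proof -
  have 4: "rep3 h m 0 = (if m = 0 then of_int (eps 4 h) else 0)" if "h \<in> set (stab 4)" "m < 3"
  proof -
    have "v3 h = [Za (eps 4 h) 0, 0, 0]"
      using line_za that unfolding list_all_iff by blast
    then show ?thesis
      using that by (auto simp: rep3_def repmat_first[OF based_v3] za_of_int_eq nth_Cons split: nat.split)
  qed
  consider "b < 4" | "b = 4" | "b = 5"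
    using assms by linarith
  then show ?thesis
  proof cases
    case 1
    then have "b \<in> set [0..<4]"
      by simp
    then have "ivec b h = eps b h # replicate (blockdim b - 1) 0"
      using line_int assms unfolding list_all_iff by blast
    then show ?thesis
      using 1 assms by (auto simp: zrep_def irep_def repmat_first[OF irep_based] nth_Cons split: nat.split)
  next
    case 2
    then show ?thesis
      using 4 assms by (simp add: zrep_def)
  next
    case 3
    then have "eps b = eps 4" "stab b = stab 4"
      using eps_stab_5 by simp_all
    then show ?thesis
      using 3 4 assms by (simp add: zrep_def zcnj_hom)
  qed
qed

lemma stab_sum_nth:
  assumes "based v gs" "distinct H" "\<And>h. h \<in> set H \<Longrightarrow> frame h" "k < length gs" "m < length gs"
  shows "(\<Sum>h\<in>set H. c h * repmat v gs h k m) = stab_sum (length gs) c v H (gs ! m) ! k"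
proof -
  let ?vs = "map (\<lambda>h. v (f2_mult h (gs ! m))) H"
  have "\<forall>w\<in>set ?vs. length w = length gs"
  proof
    fix w
    assume "w \<in> set ?vs"
    then obtain h where w: "w = v (f2_mult h (gs ! m))" and h: "h \<in> set H"
      unfolding set_map by (rule imageE)
    then show "length w = length gs"
      unfolding w by (intro based_length[OF assms(1)] frame_mult assms(3) based_frame[OF assms(1) assms(5)])
  qed
  then have "stab_sum (length gs) c v H (gs ! m) ! k = (\<Sum>j<length H. c (H ! j) * repmat v gs (H ! j) k m)"
    unfolding stab_sum_def using assms(4) by (subst lincomb_nth) (auto simp: repmat_def)
  also have "\<dots> = sum_list (map (\<lambda>h. c h * repmat v gs h k m) H)"
    by (simp add: sum_list_sum_nth atLeast0LessThan)
  also have "\<dots> = (\<Sum>h\<in>set H. c h * repmat v gs h k m)"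
    using assms(2) by (simp add: sum_list_distinct_conv_sum_set)
  finally show ?thesis
    by simp
qed

lemma kill_all: "b < b' \<Longrightarrow> b' < 4 \<Longrightarrow> kill b b'"
  using kill01 kill02 kill03 kill12 kill13 kill23 by (auto dest!: less_4_cases simp: numeral_eq_Suc less_Suc_eq)

lemma kill3_all: "b < 4 \<Longrightarrow> kill3 b"
  using kill3_0 kill3_123 by (auto dest!: less_4_cases)

lemma irep_kill:
  assumes "b < b'" "b' < 4" "k < blockdim b'" "m < blockdim b'"
  shows "(\<Sum>h\<in>set (stab b). eps b h * irep b' h k m) = 0"
proof -
  have "ibase b' ! m \<in> set (ibase b')"
    using assms by (simp add: length_ibase)
  then have "stab_sum (blockdim b') (eps b) (ivec b') (stab b) (ibase b' ! m) = replicate (blockdim b') 0"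
    using kill_all[OF assms(1,2)] unfolding kill_def list_all_iff by blast
  then show ?thesis
    using stab_sum_nth[where H = "stab b" and k = k and m = m and c = "eps b", OF irep_based[OF assms(2)] distinct_stab stab_frame] assms
    by (simp add: irep_def length_ibase)
qed

lemma irep_keep:
  assumes "b < 4" "k < blockdim b" "0 < k" "m < blockdim b"
  shows "(\<Sum>h\<in>set (stab b). eps b h * irep b h k m) = 0"
proof -
  let ?w = "stab_sum (blockdim b) (eps b) (ivec b) (stab b) (ibase b ! m)"
  have "ibase b ! m \<in> set (ibase b)" "b \<in> set [0..<4]"
    using assms by (simp_all add: length_ibase)
  then have tl: "tl ?w = replicate (blockdim b - 1) 0"
    using keep_int unfolding list_all_iff by blast
  have "?w ! k = tl ?w ! (k - 1)"
    using tl assms by (cases ?w; cases k) (auto simp: nth_tl)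
  then show ?thesis
    using stab_sum_nth[where H = "stab b" and k = k and m = m and c = "eps b", OF irep_based[OF assms(1)] distinct_stab stab_frame] assms tl
    by (simp add: irep_def length_ibase)
qed

lemma rep3_kill:
  assumes "b < 4" "k < 3" "m < 3"
  shows "(\<Sum>h\<in>set (stab b). of_int (eps b h) * rep3 h k m) = 0"
proof -
  have "base3 ! m \<in> set base3"
    using assms by (simp add: length_base3)
  then have "stab_sum 3 (\<lambda>h. Za (eps b h) 0) v3 (stab b) (base3 ! m) = [0, 0, 0]"
    using kill3_all[OF assms(1)] unfolding kill3_def list_all_iff by blast
  then show ?thesis
    using stab_sum_nth[where H = "stab b" and k = k and m = m and c = "\<lambda>h. of_int (eps b h)", OF based_v3 distinct_stab stab_frame] assms
    by (auto simp: rep3_def length_base3 za_of_int_eq nth_Cons numeral_eq_Suc split: nat.splits)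
qed

lemma rep3_keep:
  assumes "k < 3" "0 < k" "m < 3"
  shows "(\<Sum>h\<in>set (stab 4). of_int (eps 4 h) * rep3 h k m) = 0"
proof -
  let ?w = "stab_sum 3 (\<lambda>h. Za (eps 4 h) 0) v3 (stab 4) (base3 ! m)"
  have "base3 ! m \<in> set base3"
    using assms by (simp add: length_base3)
  then have tl: "tl ?w = [0, 0]"
    using keep_za unfolding list_all_iff by blast
  have "?w ! k = tl ?w ! (k - 1)"
    using tl assms by (cases ?w; cases k) auto
  also have "\<dots> = 0"
    using tl assms by (auto simp: nth_Cons split: nat.split)
  finally show ?thesis
    using stab_sum_nth[where H = "stab 4" and k = k and m = m and c = "\<lambda>h. of_int (eps 4 h)", OF based_v3 distinct_stab stab_frame] assms
    by (simp add: rep3_def length_base3 za_of_int_eq)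
qed

text \<open>Row 0 is left out when \<open>b'\<close> is \<open>b\<close> or its conjugate. There the
  eigenline survives: \<open>eps\<close> is integral, so conjugate representations share the
  eigenline and the character.\<close>

lemma zrep_kernel:
  assumes "b \<le> b'" "b' < 6" "k < blockdim b'" "m < blockdim b'"
    and "b < b' \<and> \<not> (b = 4 \<and> b' = 5) \<or> 0 < k"
  shows "(\<Sum>h\<in>set (stab b). of_int (eps b h) * zrep b' h k m) = 0"
proof -
  have conj: "(\<Sum>h\<in>set (stab b). of_int (eps b h) * zcnj (rep3 h k m))
      = zcnj (\<Sum>h\<in>set (stab b). of_int (eps b h) * rep3 h k m)"
    by (simp add: zcnj_sum zcnj_hom)
  consider "b' < 4" "b < b'" | "b' < 4" "b = b'" | "b < 4" "b' = 4 \<or> b' = 5" | "b = 4 \<or> b = 5" "b' = 4 \<or> b' = 5"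
    using assms by linarith
  then show ?thesis
  proof cases
    case 1
    then show ?thesis
      using assms irep_kill[of b b' k m] by (simp add: zrep_def flip: of_int_mult of_int_sum)
  next
    case 2
    then show ?thesis
      using assms irep_keep[of b k m] by (simp add: zrep_def flip: of_int_mult of_int_sum)
  next
    case 3
    then show ?thesis
      using assms rep3_kill[of b k m] conj by (auto simp: zrep_def zcnj_hom)
  next
    case 4
    have "eps b = eps 4" "stab b = stab 4"
      using 4(1) by (auto simp only: eps_stab_5)
    moreover have "k < 3" "0 < k" "m < 3"
      using 4 assms by auto
    ultimately have "(\<Sum>h\<in>set (stab b). of_int (eps b h) * rep3 h k m) = 0"
      using rep3_keep[of k m] by (simp only:)
    then show ?thesis
      using 4(2) conj by (auto simp: zrep_def zcnj_hom(3))
  qed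
qed

lemma avg_zrep_less:
  assumes bb': "b < b'" "b' < 6" and idx: "l < blockdim b'" "i < blockdim b" "k < blockdim b'" "j < blockdim b"
  shows "avg frame_group (zrep b') (zrep b) l i k j = 0"
proof -
  interpret group frame_group by (rule group_frame_group)
  let ?M = "avg frame_group (zrep b') (zrep b) l i"
  have b: "b < 6"
    using bb' by simp
  note rep = mat_rep_zrep[OF b] mat_rep_zrep[OF bb'(2)]
  have first: "?M k 0 = 0" if "\<not> (b = 4 \<and> b' = 5) \<or> 0 < k" "k < blockdim b'" for k
  proof (rule avg_eigenline[OF rep, where H = "set (stab b)" and \<epsilon> = "\<lambda>h. of_int (eps b h)"])
    show "(\<Sum>h\<in>set (stab b). of_int (eps b h) * zrep b' h k m) = 0" if "m < blockdim b'" for m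
      using zrep_kernel[of b b' k m] bb' that \<open>k < blockdim b'\<close> \<open>\<not> (b = 4 \<and> b' = 5) \<or> 0 < k\<close> by auto
    show "set (stab b) \<subseteq> carrier frame_group"
      using stab_frame by (simp add: subsetI)
    show "of_int (eps b h) * of_int (eps b h) = (1::za)" if "h \<in> set (stab b)" for h
      using eps_square[OF b that] by (simp flip: of_int_mult)
    show "zrep b h m 0 = (if m = 0 then of_int (eps b h) else 0)" if "h \<in> set (stab b)" "m < blockdim b" for h m
      using zrep_line[OF b that] .
  qed (use idx that stab_nonempty blockdim_pos[OF b] in auto)
  have col: "?M k j = (\<Sum>m<blockdim b'. zrep b' (zbase b ! j) k m * ?M m 0)" if "k < blockdim b'" "j < blockdim b" for k j
    using zbase_frame[OF b that(2)] zrep_base[OF b] idx that by (intro avg_column[OF rep]) auto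
  show ?thesis
  proof (cases "b = 4 \<and> b' = 5")
    case False
    then show ?thesis
      using col[OF idx(3,4)] first by simp
  next
    case True
    text \<open>An intertwiner between the two conjugate representations is a scalar matrix \<open>c\<close>;
      comparing an entry that is not rational gives \<open>c = 0\<close>.\<close>
    have scalar: "?M k j = of_bool (k = j) * ?M 0 0" if "k < 3" "j < 3" for k j
    proof -
      \<comment> \<open>\<open>zbase 4\<close> and \<open>zbase 5\<close> are the same list, so one
        group element moves the first basis vector to the \<open>j\<close>-th in both
        representations.\<close>
      have "zrep 5 (zbase 4 ! j) k 0 = of_bool (k = j)"
        using zrep_base[of 5 k j] that by (simp add: zbase_def)
      moreover have "?M k j = (\<Sum>m<3. zrep 5 (zbase 4 ! j) k m * ?M m 0)"
        using col[of k j] that True by simp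
      moreover have "?M 1 0 = 0" "?M 2 0 = 0"
        using first[of 1] first[of 2] True by simp_all
      ultimately show ?thesis
        by (simp add: numeral_3_eq_3 numeral_2_eq_2)
    qed
    define h :: f2mat where "h = (e1, e12, e3)"
    have h: "h \<in> carrier frame_group"
      by (simp add: h_def frame.simps Let_def)
    have "(\<Sum>m<blockdim b'. zrep b' h 0 m * ?M m 2) = (\<Sum>m<blockdim b. ?M 0 m * zrep b h m 2)"
      using idx True by (intro avg_intertwines[OF rep h]) auto
    then have "zrep 5 h 0 2 * ?M 0 0 = ?M 0 0 * zrep 4 h 0 2"
      using True scalar[of 0 2] scalar[of 1 2] scalar[of 2 2] scalar[of 0 1]
      by (simp add: numeral_3_eq_3 numeral_2_eq_2)
    moreover have "rep3 h 0 2 = Za (-1) (-1)"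
      unfolding rep3_def repmat_def h_def by code_simp
    ultimately have "?M 0 0 * Za 1 2 = 0"
      by (simp add: zrep_def za_eq_iff algebra_simps)
    \<comment> \<open>\<open>1 + 2 \<alpha>\<close> is the difference of the conjugate entries
      \<open>\<alpha>\<close> and \<open>- 1 - \<alpha>\<close>. Its square is the integer -7, which
      can be cancelled.\<close>
    then have "?M 0 0 * (Za 1 2 * Za 1 2) = 0"
      by (simp flip: mult.assoc)
    then have "?M 0 0 = 0"
      by (simp add: za_eq_iff)
    then show ?thesis
      using scalar idx True by simp
  qed
qed

text \<open>The first column of the averaged matrix lies on the eigenline, and the group moves it to
  the other columns in the same way as the basis vectors. The matrix is therefore scalar, and its
  trace determines the scalar.\<close>

lemma avg_zrep_eq:
  assumes b: "b < 6" and idx: "l < blockdim b" "i < blockdim b" "k < blockdim b" "j < blockdim b"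
  shows "avg frame_group (zrep b) (zrep b) l i k j = of_int (168 div blockdim b) * of_bool (i = l \<and> k = j)"
proof -
  interpret group frame_group by (rule group_frame_group)
  let ?M = "avg frame_group (zrep b) (zrep b) l i"
  note rep = mat_rep_zrep[OF b] mat_rep_zrep[OF b]
  have first: "?M k 0 = 0" if "0 < k" "k < blockdim b" for k
  proof (rule avg_eigenline[OF rep, where H = "set (stab b)" and \<epsilon> = "\<lambda>h. of_int (eps b h)"])
    show "(\<Sum>h\<in>set (stab b). of_int (eps b h) * zrep b h k m) = 0" if "m < blockdim b" for m
      using zrep_kernel[of b b k m] b that \<open>k < blockdim b\<close> \<open>0 < k\<close> by auto
    show "set (stab b) \<subseteq> carrier frame_group"
      using stab_frame by (simp add: subsetI)
    show "of_int (eps b h) * of_int (eps b h) = (1::za)" if "h \<in> set (stab b)" for h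
      using eps_square[OF b that] by (simp flip: of_int_mult)
    show "zrep b h m 0 = (if m = 0 then of_int (eps b h) else 0)" if "h \<in> set (stab b)" "m < blockdim b" for h m
      using zrep_line[OF b that] .
  qed (use idx that stab_nonempty blockdim_pos[OF b] in auto)
  have scalar: "?M k j = of_bool (k = j) * ?M 0 0" if "k < blockdim b" "j < blockdim b" for k j
  proof -
    have "?M k j = (\<Sum>m<blockdim b. zrep b (zbase b ! j) k m * ?M m 0)"
      using zbase_frame[OF b that(2)] zrep_base[OF b] idx that by (intro avg_column[OF rep]) auto
    also have "\<dots> = (\<Sum>m<blockdim b. if m = 0 then zrep b (zbase b ! j) k 0 * ?M 0 0 else 0)"
      using first by (intro sum.cong) auto
    also have "\<dots> = zrep b (zbase b ! j) k 0 * ?M 0 0"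
      using blockdim_pos[OF b] by simp
    finally show ?thesis
      using zrep_base[OF b] that by simp
  qed
  have "(\<Sum>k<blockdim b. ?M k k) = 168 * of_bool (i = l)"
    using avg_trace[OF rep(1) idx(1,2)] by (simp add: card_frame_group del: frame_group_simps)
  moreover have "(\<Sum>k<blockdim b. ?M k k) = (\<Sum>k<blockdim b. ?M 0 0)"
  proof (intro sum.cong refl)
    fix k
    assume "k \<in> {..<blockdim b}"
    then show "?M k k = ?M 0 0"
      using scalar[of k k] by (metis lessThan_iff mult_1 of_bool_eq(2))
  qed
  ultimately have "of_nat (blockdim b) * ?M 0 0 = 168 * of_bool (i = l)"
    by simp
  also have "\<dots> = of_nat (blockdim b) * (of_int (168 div blockdim b) * of_bool (i = l))"
  proof -
    \<comment> \<open>All degrees divide 168, so the quotient is exact and the degree can be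
      cancelled.\<close>
    have "blockdim b * (168 div blockdim b) = 168"
      using b by (auto dest!: less_6_cases less_4_cases simp: blockdim_def)
    then have "(168::za) = of_nat (blockdim b) * of_nat (168 div blockdim b)"
      by (metis of_nat_mult of_nat_numeral)
    then show ?thesis
      by (simp add: mult.assoc)
  qed
  finally have "of_nat (blockdim b) * (?M 0 0 - of_int (168 div blockdim b) * of_bool (i = l)) = 0"
    by (simp add: right_diff_distrib)
  then have "?M 0 0 = of_int (168 div blockdim b) * of_bool (i = l)"
    using za_torsion_free blockdim_pos[OF b] by fastforce
  then show ?thesis
    using scalar[OF idx(3,4)] by auto
qed

lemma avg_zrep:
  assumes "b < 6" "b' < 6" "l < blockdim b'" "i < blockdim b" "k < blockdim b'" "j < blockdim b"
  shows "avg frame_group (zrep b') (zrep b) l i k j = of_int (168 div blockdim b) * of_bool (b = b' \<and> i = l \<and> k = j)"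
proof -
  interpret group frame_group by (rule group_frame_group)
  consider "b < b'" | "b = b'" | "b' < b"
    by linarith
  then show ?thesis
  proof cases
    case 3
    then show ?thesis
      using assms avg_zrep_less[of b' b j k i l] avg_swap[of "zrep b'" "zrep b" l i k j] by simp
  qed (use assms avg_zrep_less[of b b' l i k j] avg_zrep_eq[of b l i k j] in auto)
qed

section \<open>Finite sums in a ring structure\<close>

lemma (in abelian_monoid) finsum_swap:
  assumes "finite A" "finite B" "\<And>x y. x \<in> A \<Longrightarrow> y \<in> B \<Longrightarrow> f x y \<in> carrier G"
  shows "(\<Oplus>x\<in>A. \<Oplus>y\<in>B. f x y) = (\<Oplus>y\<in>B. \<Oplus>x\<in>A. f x y)"
  using assms(1,3)
proof (induction A)
  case empty
  then show ?case
    by (simp add: finsum_zero)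
next
  case (insert a A)
  have "(\<Oplus>x\<in>insert a A. \<Oplus>y\<in>B. f x y) = (\<Oplus>y\<in>B. f a y) \<oplus> (\<Oplus>x\<in>A. \<Oplus>y\<in>B. f x y)"
    using insert by (intro finsum_insert) (auto intro!: finsum_closed)
  also have "\<dots> = (\<Oplus>y\<in>B. f a y) \<oplus> (\<Oplus>y\<in>B. \<Oplus>x\<in>A. f x y)"
    using insert by simp
  also have "\<dots> = (\<Oplus>y\<in>B. f a y \<oplus> (\<Oplus>x\<in>A. f x y))"
    using insert by (intro finsum_addf[symmetric]) (auto intro!: finsum_closed)
  also have "\<dots> = (\<Oplus>y\<in>B. \<Oplus>x\<in>insert a A. f x y)"
    using insert by (intro finsum_cong') (auto intro!: finsum_insert[symmetric] finsum_closed)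
  finally show ?case .
qed

lemma (in abelian_monoid) finsum_only:
  assumes "finite A" "a \<in> A" "f a \<in> carrier G"
  shows "(\<Oplus>x\<in>A. if x = a then f x else \<zero>) = f a"
proof -
  have "(\<lambda>x. if x = a then f x else \<zero>) = (\<lambda>x. if x = a then f a else \<zero>)"
    by auto
  then show ?thesis
    using add.finprod_singleton_swap[of a A "\<lambda>x. f a"] assms by simp
qed

section \<open>Ring homomorphisms from a ring type to a ring structure\<close>

text \<open>Calculations take place in the types \<open>int\<close>, \<open>za\<close> and
  \<open>int poly\<close>, whereas the fields are records. These maps carry results from the former
  to the latter.\<close>

definition type_hom :: "('k, 'm) ring_scheme \<Rightarrow> ('a::comm_ring_1 \<Rightarrow> 'k) \<Rightarrow> bool" where
  "type_hom K h \<longleftrightarrow> (\<forall>x. h x \<in> carrier K) \<and> (\<forall>x y. h (x + y) = h x \<oplus>\<^bsub>K\<^esub> h y) \<and>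
     (\<forall>x y. h (x * y) = h x \<otimes>\<^bsub>K\<^esub> h y) \<and> h 1 = \<one>\<^bsub>K\<^esub>"

lemma type_hom_simps:
  assumes "type_hom K h"
  shows "h x \<in> carrier K" "h (x + y) = h x \<oplus>\<^bsub>K\<^esub> h y" "h (x * y) = h x \<otimes>\<^bsub>K\<^esub> h y" "h 1 = \<one>\<^bsub>K\<^esub>"
  using assms by (auto simp: type_hom_def)

context ring
begin

lemma type_hom_zero: "type_hom R h \<Longrightarrow> h 0 = \<zero>"
  by (metis add.r_cancel_one' add_0 type_hom_simps(1,2))

lemma type_hom_minus:
  assumes "type_hom R h"
  shows "h (- x) = \<ominus> h x"
proof -
  have "h (- x) \<oplus> h x = \<zero>"
    using type_hom_simps(2)[OF assms, of "- x" x] type_hom_zero[OF assms] by simp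
  then show ?thesis
    using type_hom_simps(1)[OF assms] by (metis minus_equality)
qed

lemma type_hom_sum:
  assumes "type_hom R h" "finite A"
  shows "h (sum f A) = (\<Oplus>x\<in>A. h (f x))"
  using assms(2) by (induction A) (auto simp: type_hom_zero[OF assms(1)] type_hom_simps[OF assms(1)])

definition emb :: "int \<Rightarrow> 'a" where "emb n = [n] \<cdot> \<one>"

lemma type_hom_emb: "type_hom R emb"
  unfolding type_hom_def
proof (intro conjI allI)
  fix x y :: int
  have "emb x \<otimes> emb y = [x] \<cdot> (\<one> \<otimes> ([y] \<cdot> \<one>))"
    unfolding emb_def by (intro add_pow_ldistr_int) auto
  then show "emb (x * y) = emb x \<otimes> emb y"
    by (simp add: emb_def add.int_pow_pow mult.commute)
qed (auto simp: emb_def add.int_pow_mult add.int_pow_1)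

lemmas emb_simps = type_hom_simps[OF type_hom_emb] type_hom_zero[OF type_hom_emb] type_hom_minus[OF type_hom_emb]

end

text \<open>Any root of \<open>x^2 + x + 2\<close> in the ring extends the canonical map of the
  integers to \<open>\<int>[\<alpha>]\<close>.\<close>

lemma (in cring) type_hom_za:
  assumes "\<alpha> \<in> carrier R" "\<alpha> \<otimes> \<alpha> \<oplus> \<alpha> \<oplus> emb 2 = \<zero>"
  shows "type_hom R (\<lambda>z. emb (zre z) \<oplus> emb (zim z) \<otimes> \<alpha>)"
  unfolding type_hom_def
proof (intro conjI allI)
  fix x y :: za
  show "emb (zre x) \<oplus> emb (zim x) \<otimes> \<alpha> \<in> carrier R"
    using assms by (simp add: emb_simps)
  show "emb (zre (x + y)) \<oplus> emb (zim (x + y)) \<otimes> \<alpha> =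
      emb (zre x) \<oplus> emb (zim x) \<otimes> \<alpha> \<oplus> (emb (zre y) \<oplus> emb (zim y) \<otimes> \<alpha>)"
    using assms by (simp add: emb_simps l_distr a_ac)
  have "\<alpha> \<otimes> \<alpha> = \<ominus> \<alpha> \<ominus> emb 2"
  proof -
    have "\<alpha> \<otimes> \<alpha> = (\<alpha> \<otimes> \<alpha> \<oplus> \<alpha> \<oplus> emb 2) \<oplus> (\<ominus> \<alpha> \<ominus> emb 2)"
      using assms(1) emb_simps(1)[of 2] by algebra
    then show ?thesis
      using assms emb_simps(1)[of 2] by simp
  qed
  \<comment> \<open>Two pure ring identities, with the images of integers abstracted to variables:
    the first multiplies out, the second collects terms after
    \<open>\<alpha> \<otimes> \<alpha>\<close> has been replaced.\<close>
  have expand: "(a \<oplus> b \<otimes> \<alpha>) \<otimes> (c \<oplus> d \<otimes> \<alpha>) = a \<otimes> c \<oplus> (a \<otimes> d \<oplus> b \<otimes> c) \<otimes> \<alpha> \<oplus> (b \<otimes> d) \<otimes> (\<alpha> \<otimes> \<alpha>)"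
    if "a \<in> carrier R" "b \<in> carrier R" "c \<in> carrier R" "d \<in> carrier R" for a b c d
    using that assms(1) by algebra
  have collect: "a \<oplus> b \<otimes> \<alpha> \<oplus> c \<otimes> (\<ominus> \<alpha> \<ominus> t) = (a \<ominus> t \<otimes> c) \<oplus> (b \<ominus> c) \<otimes> \<alpha>"
    if "a \<in> carrier R" "b \<in> carrier R" "c \<in> carrier R" "t \<in> carrier R" for a b c t
    using that assms(1) by algebra
  show "emb (zre (x * y)) \<oplus> emb (zim (x * y)) \<otimes> \<alpha> =
      (emb (zre x) \<oplus> emb (zim x) \<otimes> \<alpha>) \<otimes> (emb (zre y) \<oplus> emb (zim y) \<otimes> \<alpha>)"
    unfolding expand[OF emb_simps(1) emb_simps(1) emb_simps(1) emb_simps(1)] \<open>\<alpha> \<otimes> \<alpha> = \<ominus> \<alpha> \<ominus> emb 2\<close>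
    by (subst collect) (simp_all add: emb_simps a_minus_def diff_conv_add_uminus del: add_uminus_conv_diff)
qed (use assms in \<open>simp add: emb_simps\<close>)

section \<open>Representations over a ring structure and the group algebra\<close>

definition krep :: "('k, 'm) ring_scheme \<Rightarrow> ('g, 'n) monoid_scheme \<Rightarrow> nat \<Rightarrow> ('g \<Rightarrow> nat \<Rightarrow> nat \<Rightarrow> 'k) \<Rightarrow> bool" where
  "krep K G d \<rho> \<longleftrightarrow> (\<forall>g\<in>carrier G. \<forall>i<d. \<forall>j<d. \<rho> g i j \<in> carrier K) \<and>
     (\<forall>g\<in>carrier G. \<forall>h\<in>carrier G. \<forall>i<d. \<forall>j<d.
        \<rho> (g \<otimes>\<^bsub>G\<^esub> h) i j = (\<Oplus>\<^bsub>K\<^esub> l\<in>{..<d}. \<rho> g i l \<otimes>\<^bsub>K\<^esub> \<rho> h l j)) \<and>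
     (\<forall>i<d. \<forall>j<d. \<rho> \<one>\<^bsub>G\<^esub> i j = (if i = j then \<one>\<^bsub>K\<^esub> else \<zero>\<^bsub>K\<^esub>))"

lemma krep_of_mat_rep:
  assumes K: "ring K" and h: "type_hom K h" and rep: "mat_rep G d \<rho>" and e: "e \<in> hom G' G" "e \<one>\<^bsub>G'\<^esub> = \<one>\<^bsub>G\<^esub>"
  shows "krep K G' d (\<lambda>g i j. h (\<rho> (e g) i j))"
  unfolding krep_def
proof (intro conjI ballI allI impI)
  fix g g' i j
  assume gg': "g \<in> carrier G'" "g' \<in> carrier G'" and ij: "i < d" "j < d"
  interpret K: ring K by (rule K)
  have "\<rho> (e (g \<otimes>\<^bsub>G'\<^esub> g')) i j = (\<Sum>l<d. \<rho> (e g) i l * \<rho> (e g') l j)"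
    using e gg' ij mat_rep_mult[OF rep, of "e g" "e g'" i j] by (auto simp: hom_def)
  then show "h (\<rho> (e (g \<otimes>\<^bsub>G'\<^esub> g')) i j) = (\<Oplus>\<^bsub>K\<^esub>l\<in>{..<d}. h (\<rho> (e g) i l) \<otimes>\<^bsub>K\<^esub> h (\<rho> (e g') l j))"
    by (simp add: K.type_hom_sum[OF h] type_hom_simps[OF h])
qed (use type_hom_simps[OF h] mat_rep_one[OF rep] e ring.type_hom_zero[OF K h] in auto)

text \<open>Linear extension of a representation to the group algebra. \<open>\<iota>\<close> is the
  identity except when the matrices live over the quadratic extension of the coefficient field. The
  value zero outside the \<open>d\<close> by \<open>d\<close> square is what \<open>mat_ring\<close>
  requires of its elements.\<close>

definition alg_map :: "('k, 'm) ring_scheme \<Rightarrow> ('g, 'n) monoid_scheme \<Rightarrow> ('r \<Rightarrow> 'k) \<Rightarrow> nat \<Rightarrow>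
    ('g \<Rightarrow> nat \<Rightarrow> nat \<Rightarrow> 'k) \<Rightarrow> ('g \<Rightarrow> 'r) \<Rightarrow> nat \<Rightarrow> nat \<Rightarrow> 'k" where
  "alg_map K G \<iota> d \<rho> f = (\<lambda>i j. if i < d \<and> j < d
     then (\<Oplus>\<^bsub>K\<^esub> g\<in>carrier G. \<iota> (f g) \<otimes>\<^bsub>K\<^esub> \<rho> g i j) else \<zero>\<^bsub>K\<^esub>)"

locale group_algebra_rep = R: cring R + K: cring K + G: group G + hom: ring_hom_cring R K \<iota>
  for R (structure) and K (structure) and G (structure) and \<iota> +
  fixes d :: nat and \<rho>
  assumes fin: "finite (carrier G)" and rep: "krep K G d \<rho>"
begin

lemma rho_closed: "g \<in> carrier G \<Longrightarrow> i < d \<Longrightarrow> j < d \<Longrightarrow> \<rho> g i j \<in> carrier K"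
  using rep by (simp add: krep_def)

lemma alg_map_closed:
  assumes "f \<in> carrier (group_algebra R G)"
  shows "alg_map K G \<iota> d \<rho> f \<in> carrier (mat_ring K d)"
  using assms
  by (auto simp: mat_ring_def alg_map_def group_algebra_def intro!: K.finsum_closed K.m_closed rho_closed)

lemma alg_map_one: "alg_map K G \<iota> d \<rho> \<one>\<^bsub>group_algebra R G\<^esub> = \<one>\<^bsub>mat_ring K d\<^esub>"
proof (intro ext)
  fix i j
  show "alg_map K G \<iota> d \<rho> \<one>\<^bsub>group_algebra R G\<^esub> i j = \<one>\<^bsub>mat_ring K d\<^esub> i j"
  proof (cases "i < d \<and> j < d")
    case True
    have "alg_map K G \<iota> d \<rho> \<one>\<^bsub>group_algebra R G\<^esub> i j = (\<Oplus>\<^bsub>K\<^esub>g\<in>carrier G. if g = \<one>\<^bsub>G\<^esub> then \<rho> g i j else \<zero>\<^bsub>K\<^esub>)"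
      using True unfolding alg_map_def
      by (auto simp: group_algebra_def rho_closed intro!: K.finsum_cong')
    also have "\<dots> = \<rho> \<one>\<^bsub>G\<^esub> i j"
      using True fin by (intro K.finsum_only) (auto simp: rho_closed)
    also have "\<dots> = \<one>\<^bsub>mat_ring K d\<^esub> i j"
      using True rep by (simp add: krep_def mat_ring_def)
    finally show ?thesis .
  qed (auto simp: alg_map_def mat_ring_def)
qed

lemma alg_map_mult:
  assumes f: "f \<in> carrier (group_algebra R G)" and h: "h \<in> carrier (group_algebra R G)"
  shows "alg_map K G \<iota> d \<rho> (f \<otimes>\<^bsub>group_algebra R G\<^esub> h) =
    alg_map K G \<iota> d \<rho> f \<otimes>\<^bsub>mat_ring K d\<^esub> alg_map K G \<iota> d \<rho> h"
proof (intro ext)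
  fix i j
  show "alg_map K G \<iota> d \<rho> (f \<otimes>\<^bsub>group_algebra R G\<^esub> h) i j =
    (alg_map K G \<iota> d \<rho> f \<otimes>\<^bsub>mat_ring K d\<^esub> alg_map K G \<iota> d \<rho> h) i j"
  proof (cases "i < d \<and> j < d")
    case ij: True
    have fc: "\<And>g. g \<in> carrier G \<Longrightarrow> f g \<in> carrier R" and hc: "\<And>g. g \<in> carrier G \<Longrightarrow> h g \<in> carrier R"
      using f h by (auto simp: group_algebra_def)
    have rc: "\<And>g l l'. g \<in> carrier G \<Longrightarrow> l < d \<Longrightarrow> l' < d \<Longrightarrow> \<rho> g l l' \<in> carrier K"
      by (rule rho_closed)
    have "alg_map K G \<iota> d \<rho> (f \<otimes>\<^bsub>group_algebra R G\<^esub> h) i j =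
        (\<Oplus>\<^bsub>K\<^esub>x\<in>carrier G. \<Oplus>\<^bsub>K\<^esub>y\<in>carrier G. (\<iota> (f y) \<otimes>\<^bsub>K\<^esub> \<iota> (h (inv\<^bsub>G\<^esub> y \<otimes>\<^bsub>G\<^esub> x))) \<otimes>\<^bsub>K\<^esub> \<rho> x i j)"
      using ij fin unfolding alg_map_def
      by (auto simp: group_algebra_def fc hc rc Pi_def K.finsum_ldistr comp_def intro!: K.finsum_cong')
    also have "\<dots> = (\<Oplus>\<^bsub>K\<^esub>y\<in>carrier G. \<Oplus>\<^bsub>K\<^esub>x\<in>carrier G. (\<iota> (f y) \<otimes>\<^bsub>K\<^esub> \<iota> (h (inv\<^bsub>G\<^esub> y \<otimes>\<^bsub>G\<^esub> x))) \<otimes>\<^bsub>K\<^esub> \<rho> x i j)"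
      using ij fin by (intro K.finsum_swap) (auto simp: fc hc rc)
    \<comment> \<open>Substitution \<open>x = y \<otimes> z\<close> in the inner sum turns the
      convolution into a free double sum.\<close>
    also have "\<dots> = (\<Oplus>\<^bsub>K\<^esub>y\<in>carrier G. \<Oplus>\<^bsub>K\<^esub>z\<in>carrier G. (\<iota> (f y) \<otimes>\<^bsub>K\<^esub> \<iota> (h z)) \<otimes>\<^bsub>K\<^esub> \<rho> (y \<otimes>\<^bsub>G\<^esub> z) i j)"
    proof (rule K.finsum_cong'[OF refl])
      fix y
      assume y: "y \<in> carrier G"
      have im: "(\<otimes>\<^bsub>G\<^esub>) y ` carrier G = carrier G"
        using y by (rule G.surj_const_mult)
      have "(\<Oplus>\<^bsub>K\<^esub>x\<in>(\<otimes>\<^bsub>G\<^esub>) y ` carrier G. (\<iota> (f y) \<otimes>\<^bsub>K\<^esub> \<iota> (h (inv\<^bsub>G\<^esub> y \<otimes>\<^bsub>G\<^esub> x))) \<otimes>\<^bsub>K\<^esub> \<rho> x i j) =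
          (\<Oplus>\<^bsub>K\<^esub>z\<in>carrier G. (\<iota> (f y) \<otimes>\<^bsub>K\<^esub> \<iota> (h (inv\<^bsub>G\<^esub> y \<otimes>\<^bsub>G\<^esub> (y \<otimes>\<^bsub>G\<^esub> z)))) \<otimes>\<^bsub>K\<^esub> \<rho> (y \<otimes>\<^bsub>G\<^esub> z) i j)"
        using y ij by (intro K.finsum_reindex) (auto simp: fc hc rc G.inj_on_cmult)
      also have "\<dots> = (\<Oplus>\<^bsub>K\<^esub>z\<in>carrier G. (\<iota> (f y) \<otimes>\<^bsub>K\<^esub> \<iota> (h z)) \<otimes>\<^bsub>K\<^esub> \<rho> (y \<otimes>\<^bsub>G\<^esub> z) i j)"
        using y ij by (intro K.finsum_cong') (auto simp: fc hc rc G.m_assoc[symmetric])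
      finally show "(\<Oplus>\<^bsub>K\<^esub>x\<in>carrier G. (\<iota> (f y) \<otimes>\<^bsub>K\<^esub> \<iota> (h (inv\<^bsub>G\<^esub> y \<otimes>\<^bsub>G\<^esub> x))) \<otimes>\<^bsub>K\<^esub> \<rho> x i j) =
          (\<Oplus>\<^bsub>K\<^esub>z\<in>carrier G. (\<iota> (f y) \<otimes>\<^bsub>K\<^esub> \<iota> (h z)) \<otimes>\<^bsub>K\<^esub> \<rho> (y \<otimes>\<^bsub>G\<^esub> z) i j)"
        by (simp add: im)
    qed (use ij in \<open>auto simp: fc hc rc intro!: K.finsum_closed\<close>)
    also have "\<dots> = (\<Oplus>\<^bsub>K\<^esub>y\<in>carrier G. \<Oplus>\<^bsub>K\<^esub>z\<in>carrier G. \<Oplus>\<^bsub>K\<^esub>l\<in>{..<d}.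
        (\<iota> (f y) \<otimes>\<^bsub>K\<^esub> \<rho> y i l) \<otimes>\<^bsub>K\<^esub> (\<iota> (h z) \<otimes>\<^bsub>K\<^esub> \<rho> z l j))"
    proof (intro K.finsum_cong' refl)
      fix y z
      assume yz: "y \<in> carrier G" "z \<in> carrier G"
      have "(\<iota> (f y) \<otimes>\<^bsub>K\<^esub> \<iota> (h z)) \<otimes>\<^bsub>K\<^esub> \<rho> (y \<otimes>\<^bsub>G\<^esub> z) i j =
          (\<iota> (f y) \<otimes>\<^bsub>K\<^esub> \<iota> (h z)) \<otimes>\<^bsub>K\<^esub> (\<Oplus>\<^bsub>K\<^esub> l\<in>{..<d}. \<rho> y i l \<otimes>\<^bsub>K\<^esub> \<rho> z l j)"
        using rep yz ij by (simp add: krep_def)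
      also have "\<dots> = (\<Oplus>\<^bsub>K\<^esub> l\<in>{..<d}. (\<iota> (f y) \<otimes>\<^bsub>K\<^esub> \<iota> (h z)) \<otimes>\<^bsub>K\<^esub> (\<rho> y i l \<otimes>\<^bsub>K\<^esub> \<rho> z l j))"
        using yz ij by (intro K.finsum_rdistr) (auto simp: fc hc rc)
      also have "\<dots> = (\<Oplus>\<^bsub>K\<^esub>l\<in>{..<d}. (\<iota> (f y) \<otimes>\<^bsub>K\<^esub> \<rho> y i l) \<otimes>\<^bsub>K\<^esub> (\<iota> (h z) \<otimes>\<^bsub>K\<^esub> \<rho> z l j))"
        using yz ij by (intro K.finsum_cong') (auto simp: fc hc rc K.m_ac)
      finally show "(\<iota> (f y) \<otimes>\<^bsub>K\<^esub> \<iota> (h z)) \<otimes>\<^bsub>K\<^esub> \<rho> (y \<otimes>\<^bsub>G\<^esub> z) i j =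
          (\<Oplus>\<^bsub>K\<^esub>l\<in>{..<d}. (\<iota> (f y) \<otimes>\<^bsub>K\<^esub> \<rho> y i l) \<otimes>\<^bsub>K\<^esub> (\<iota> (h z) \<otimes>\<^bsub>K\<^esub> \<rho> z l j))" .
    qed (use ij in \<open>auto simp: fc hc rc intro!: K.finsum_closed\<close>)
    \<comment> \<open>With the matrix index \<open>l\<close> moved outside, the double sum over
      \<open>y\<close> and \<open>z\<close> factors for each \<open>l\<close>.\<close>
    also have "\<dots> = (\<Oplus>\<^bsub>K\<^esub>y\<in>carrier G. \<Oplus>\<^bsub>K\<^esub>l\<in>{..<d}. \<Oplus>\<^bsub>K\<^esub>z\<in>carrier G.
        (\<iota> (f y) \<otimes>\<^bsub>K\<^esub> \<rho> y i l) \<otimes>\<^bsub>K\<^esub> (\<iota> (h z) \<otimes>\<^bsub>K\<^esub> \<rho> z l j))"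
      using ij fin by (intro K.finsum_cong' refl K.finsum_swap) (auto simp: fc hc rc intro!: K.finsum_closed)
    also have "\<dots> = (\<Oplus>\<^bsub>K\<^esub>l\<in>{..<d}. \<Oplus>\<^bsub>K\<^esub>y\<in>carrier G. \<Oplus>\<^bsub>K\<^esub>z\<in>carrier G.
        (\<iota> (f y) \<otimes>\<^bsub>K\<^esub> \<rho> y i l) \<otimes>\<^bsub>K\<^esub> (\<iota> (h z) \<otimes>\<^bsub>K\<^esub> \<rho> z l j))"
      using ij fin by (intro K.finsum_swap) (auto simp: fc hc rc intro!: K.finsum_closed)
    also have "\<dots> = (\<Oplus>\<^bsub>K\<^esub>l\<in>{..<d}. (\<Oplus>\<^bsub>K\<^esub>y\<in>carrier G. \<iota> (f y) \<otimes>\<^bsub>K\<^esub> \<rho> y i l) \<otimes>\<^bsub>K\<^esub>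
        (\<Oplus>\<^bsub>K\<^esub>z\<in>carrier G. \<iota> (h z) \<otimes>\<^bsub>K\<^esub> \<rho> z l j))"
    proof (intro K.finsum_cong' refl)
      fix l
      assume l: "l \<in> {..<d}"
      have "(\<Oplus>\<^bsub>K\<^esub>y\<in>carrier G. \<iota> (f y) \<otimes>\<^bsub>K\<^esub> \<rho> y i l) \<otimes>\<^bsub>K\<^esub> (\<Oplus>\<^bsub>K\<^esub>z\<in>carrier G. \<iota> (h z) \<otimes>\<^bsub>K\<^esub> \<rho> z l j) =
         (\<Oplus>\<^bsub>K\<^esub>y\<in>carrier G. (\<iota> (f y) \<otimes>\<^bsub>K\<^esub> \<rho> y i l) \<otimes>\<^bsub>K\<^esub> (\<Oplus>\<^bsub>K\<^esub>z\<in>carrier G. \<iota> (h z) \<otimes>\<^bsub>K\<^esub> \<rho> z l j))"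
        using l ij fin by (intro K.finsum_ldistr) (auto simp: fc hc rc intro!: K.finsum_closed)
      also have "\<dots> = (\<Oplus>\<^bsub>K\<^esub>y\<in>carrier G. \<Oplus>\<^bsub>K\<^esub>z\<in>carrier G. (\<iota> (f y) \<otimes>\<^bsub>K\<^esub> \<rho> y i l) \<otimes>\<^bsub>K\<^esub> (\<iota> (h z) \<otimes>\<^bsub>K\<^esub> \<rho> z l j))"
        using l ij fin by (intro K.finsum_cong' refl K.finsum_rdistr) (auto simp: fc hc rc intro!: K.finsum_closed)
      finally show "(\<Oplus>\<^bsub>K\<^esub>y\<in>carrier G. \<Oplus>\<^bsub>K\<^esub>z\<in>carrier G. (\<iota> (f y) \<otimes>\<^bsub>K\<^esub> \<rho> y i l) \<otimes>\<^bsub>K\<^esub> (\<iota> (h z) \<otimes>\<^bsub>K\<^esub> \<rho> z l j)) =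
        (\<Oplus>\<^bsub>K\<^esub>y\<in>carrier G. \<iota> (f y) \<otimes>\<^bsub>K\<^esub> \<rho> y i l) \<otimes>\<^bsub>K\<^esub> (\<Oplus>\<^bsub>K\<^esub>z\<in>carrier G. \<iota> (h z) \<otimes>\<^bsub>K\<^esub> \<rho> z l j)" ..
    qed (use ij in \<open>auto simp: fc hc rc intro!: K.finsum_closed\<close>)
    also have "\<dots> = (alg_map K G \<iota> d \<rho> f \<otimes>\<^bsub>mat_ring K d\<^esub> alg_map K G \<iota> d \<rho> h) i j"
      using ij by (auto simp: mat_ring_def alg_map_def fc hc rc intro!: K.finsum_cong' K.finsum_closed)
    finally show ?thesis .
  qed (auto simp: alg_map_def mat_ring_def)
qed

end

section \<open>Unit groups of isomorphic monoids\<close>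

lemma units_of_DirProd: "units_of (A \<times>\<times> B) = units_of A \<times>\<times> units_of B"
proof -
  have "Units (A \<times>\<times> B) = Units A \<times> Units B"
    by (auto simp: Units_def DirProd_def)
  then show ?thesis
    by (simp add: units_of_def DirProd_def)
qed

text \<open>A bijection compatible with products and 1 transports two-sided inverses in both
  directions. The form suits bare structures such as \<open>group_algebra\<close>, for which closure
  and membership of 1 are established directly.\<close>

lemma units_of_cong:
  assumes bij: "bij_betw h (carrier A) (carrier B)"
    and closed: "\<And>x y. x \<in> carrier A \<Longrightarrow> y \<in> carrier A \<Longrightarrow> x \<otimes>\<^bsub>A\<^esub> y \<in> carrier A"
    and mult: "\<And>x y. x \<in> carrier A \<Longrightarrow> y \<in> carrier A \<Longrightarrow> h (x \<otimes>\<^bsub>A\<^esub> y) = h x \<otimes>\<^bsub>B\<^esub> h y"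
    and one: "\<one>\<^bsub>A\<^esub> \<in> carrier A" "h \<one>\<^bsub>A\<^esub> = \<one>\<^bsub>B\<^esub>"
  shows "units_of A \<cong> units_of B"
proof -
  have inj: "inj_on h (carrier A)" and im: "h ` carrier A = carrier B"
    using bij by (auto simp: bij_betw_def)
  have unit_iff: "h x \<in> Units B \<longleftrightarrow> x \<in> Units A" if x: "x \<in> carrier A" for x
  proof -
    have *: "h y \<otimes>\<^bsub>B\<^esub> h x = \<one>\<^bsub>B\<^esub> \<and> h x \<otimes>\<^bsub>B\<^esub> h y = \<one>\<^bsub>B\<^esub> \<longleftrightarrow> y \<otimes>\<^bsub>A\<^esub> x = \<one>\<^bsub>A\<^esub> \<and> x \<otimes>\<^bsub>A\<^esub> y = \<one>\<^bsub>A\<^esub>"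
      if "y \<in> carrier A" for y
      using that x mult one closed inj by (metis inj_on_contraD)
    have "h x \<in> Units B \<longleftrightarrow> (\<exists>y\<in>carrier A. h y \<otimes>\<^bsub>B\<^esub> h x = \<one>\<^bsub>B\<^esub> \<and> h x \<otimes>\<^bsub>B\<^esub> h y = \<one>\<^bsub>B\<^esub>)"
      using x by (simp add: Units_def im[symmetric])
    also have "\<dots> \<longleftrightarrow> x \<in> Units A"
      using x * unfolding Units_def by blast
    finally show ?thesis .
  qed
  have "Units A \<subseteq> carrier A" "Units B \<subseteq> carrier B"
    unfolding Units_def by blast+
  have "h ` Units A = Units B"
  proof (intro equalityI subsetI)
    fix y
    assume y: "y \<in> Units B"
    then obtain x where "x \<in> carrier A" "y = h x"
      using im \<open>Units B \<subseteq> carrier B\<close> by (metis imageE subsetD)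
    with y show "y \<in> h ` Units A"
      using unit_iff by simp
  qed (use unit_iff \<open>Units A \<subseteq> carrier A\<close> in auto)
  then have "bij_betw h (Units A) (Units B)"
    using inj \<open>Units A \<subseteq> carrier A\<close> by (auto simp: bij_betw_def intro: inj_on_subset)
  then have "h \<in> iso (units_of A) (units_of B)"
    using mult \<open>Units A \<subseteq> carrier A\<close> by (auto simp: iso_def hom_def units_of_def bij_betw_def)
  then show ?thesis
    by (rule is_isoI)
qed

section \<open>Evaluation of polynomials in a ring structure\<close>

text \<open>For \<open>h = emb\<close> and \<open>a\<close> a generator of the unit group of a
  finite field, this maps the integral polynomials onto the field and so presents it as a
  quotient.\<close>

definition pev :: "('k, 'm) ring_scheme \<Rightarrow> ('c::comm_ring_1 \<Rightarrow> 'k) \<Rightarrow> 'k \<Rightarrow> 'c poly \<Rightarrow> 'k" where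
  "pev R h a f = (\<Oplus>\<^bsub>R\<^esub>i\<in>{..degree f}. h (Polynomial.coeff f i) \<otimes>\<^bsub>R\<^esub> a [^]\<^bsub>R\<^esub> i)"

context cring
begin

lemma pev_extend:
  assumes "type_hom R h" "a \<in> carrier R" "degree f \<le> n"
  shows "pev R h a f = (\<Oplus>i\<in>{..n}. h (Polynomial.coeff f i) \<otimes> a [^] i)"
  using assms(3)
proof (induction n rule: dec_induct)
  case base
  then show ?case
    by (simp add: pev_def)
next
  case (step n)
  have "Polynomial.coeff f (Suc n) = 0"
    using step by (simp add: coeff_eq_0)
  then show ?case
    using step assms by (simp add: finsum_Suc Pi_def type_hom_simps[OF assms(1)] type_hom_zero[OF assms(1)])
qed

lemma pev_closed: "type_hom R h \<Longrightarrow> a \<in> carrier R \<Longrightarrow> pev R h a f \<in> carrier R"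
  unfolding pev_def by (auto intro!: finsum_closed simp: type_hom_simps)

lemma pev_add:
  assumes "type_hom R h" "a \<in> carrier R"
  shows "pev R h a (f + g) = pev R h a f \<oplus> pev R h a g"
proof -
  let ?n = "max (degree f) (degree g)"
  have "pev R h a (f + g) = (\<Oplus>i\<in>{..?n}. h (Polynomial.coeff (f + g) i) \<otimes> a [^] i)"
    by (intro pev_extend assms degree_add_le) auto
  also have "\<dots> = (\<Oplus>i\<in>{..?n}. h (Polynomial.coeff f i) \<otimes> a [^] i \<oplus> h (Polynomial.coeff g i) \<otimes> a [^] i)"
    using assms by (intro finsum_cong') (auto simp: type_hom_simps l_distr)
  also have "\<dots> = (\<Oplus>i\<in>{..?n}. h (Polynomial.coeff f i) \<otimes> a [^] i) \<oplus> (\<Oplus>i\<in>{..?n}. h (Polynomial.coeff g i) \<otimes> a [^] i)"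
    using assms by (intro finsum_addf) (auto simp: type_hom_simps)
  also have "\<dots> = pev R h a f \<oplus> pev R h a g"
    using pev_extend[OF assms, of f ?n] pev_extend[OF assms, of g ?n] by simp
  finally show ?thesis .
qed

lemma pev_smult:
  assumes "type_hom R h" "a \<in> carrier R"
  shows "pev R h a (Polynomial.smult c f) = h c \<otimes> pev R h a f"
proof -
  have "pev R h a (Polynomial.smult c f) = (\<Oplus>i\<in>{..degree f}. h (Polynomial.coeff (Polynomial.smult c f) i) \<otimes> a [^] i)"
    by (intro pev_extend assms degree_smult_le)
  also have "\<dots> = (\<Oplus>i\<in>{..degree f}. h c \<otimes> (h (Polynomial.coeff f i) \<otimes> a [^] i))"
    using assms by (intro finsum_cong') (auto simp: type_hom_simps m_assoc)
  also have "\<dots> = h c \<otimes> pev R h a f"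
    unfolding pev_def using assms by (intro finsum_rdistr[symmetric]) (auto simp: type_hom_simps)
  finally show ?thesis .
qed

lemma pev_0: "type_hom R h \<Longrightarrow> a \<in> carrier R \<Longrightarrow> pev R h a 0 = \<zero>"
  by (simp add: pev_def type_hom_zero)

lemma pev_pCons:
  assumes "type_hom R h" "a \<in> carrier R"
  shows "pev R h a (pCons c f) = h c \<oplus> a \<otimes> pev R h a f"
proof -
  have "pev R h a (pCons c f) = (\<Oplus>i\<in>{..Suc (degree f)}. h (Polynomial.coeff (pCons c f) i) \<otimes> a [^] i)"
    by (intro pev_extend assms degree_pCons_le)
  also have "\<dots> = (\<Oplus>i\<in>{..degree f}. h (Polynomial.coeff f i) \<otimes> a [^] (Suc i)) \<oplus> h c"
    using assms by (subst finsum_Suc2) (auto simp: type_hom_simps)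
  also have "(\<Oplus>i\<in>{..degree f}. h (Polynomial.coeff f i) \<otimes> a [^] (Suc i)) =
      (\<Oplus>i\<in>{..degree f}. a \<otimes> (h (Polynomial.coeff f i) \<otimes> a [^] i))"
    using assms by (intro finsum_cong') (auto simp: type_hom_simps m_ac)
  also have "\<dots> = a \<otimes> pev R h a f"
    unfolding pev_def using assms by (intro finsum_rdistr[symmetric]) (auto simp: type_hom_simps)
  finally show ?thesis
    using assms by (simp add: a_comm type_hom_simps pev_closed)
qed

lemma type_hom_pev:
  assumes "type_hom R h" "a \<in> carrier R"
  shows "type_hom R (pev R h a)"
proof -
  have "pev R h a (f * g) = pev R h a f \<otimes> pev R h a g" for f g
  proof (induction f)
    case 0
    then show ?case
      using assms by (simp add: pev_0 pev_closed)
  next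
    case (pCons c f)
    then show ?case
      using assms by (simp add: pev_add pev_smult pev_pCons pev_closed type_hom_simps type_hom_zero l_distr m_assoc)
  qed
  moreover have "pev R h a 1 = \<one>"
    using assms by (simp add: one_pCons pev_pCons pev_0 type_hom_simps)
  ultimately show ?thesis
    using assms by (simp add: type_hom_def pev_add pev_closed)
qed

lemma pev_monom:
  assumes "type_hom R h" "a \<in> carrier R"
  shows "pev R h a (Polynomial.monom c n) = h c \<otimes> a [^] n"
  using assms
  by (induction n) (simp_all add: monom_Suc monom_0 pev_pCons pev_0 type_hom_simps type_hom_zero m_ac)

end

text \<open>Since the leading coefficient survives \<open>h\<close>, the mapped polynomial in
  \<open>UP R\<close> keeps its degree, and the root bound there applies.\<close>

lemma (in field) card_pev_roots_le:
  assumes h: "type_hom R h" and fin: "finite (carrier R)" and lead: "h (lead_coeff f) \<noteq> \<zero>"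
  shows "card {a \<in> carrier R. pev R h a f = \<zero>} \<le> degree f"
proof -
  define F where "F i = h (Polynomial.coeff f i)" for i
  have F: "F \<in> carrier (UP R)"
    unfolding UP_def F_def
    by (auto intro!: mem_upI exI[of _ "degree f"] bound.intro simp: type_hom_simps[OF h] type_hom_zero[OF h] coeff_eq_0)
  have coeff: "UnivPoly.coeff (UP R) F i = F i" for i
    using F by (simp add: UP_def)
  interpret UP: UP_domain R "UP R"
    by unfold_locales auto
  have deg: "deg R F = degree f"
  proof (rule le_antisym)
    show "deg R F \<le> degree f"
      by (rule UP.deg_aboveI) (use F in \<open>auto simp: coeff F_def coeff_eq_0 type_hom_zero[OF h]\<close>)
    show "degree f \<le> deg R F"
      by (rule UP.deg_belowI) (use F lead in \<open>auto simp: coeff F_def\<close>)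
  qed
  have "UnivPoly.eval R R id a F = pev R h a f" for a
    using F by (simp add: UnivPoly.eval_def pev_def deg coeff F_def)
  moreover have "F \<noteq> \<zero>\<^bsub>UP R\<^esub>"
    using lead coeff[of "degree f"] by (auto simp: F_def)
  ultimately show ?thesis
    using UP.roots_bound[OF F _ fin] by (simp add: deg)
qed

section \<open>Finite fields and the square root of -7\<close>

locale finite_field = field +
  fixes p k :: nat
  assumes finite: "finite (carrier R)" and prime: "Factorial_Ring.prime p" and card: "card (carrier R) = p ^ k"
begin

lemma emb_card: "emb (int p ^ k) = \<zero>"
proof -
  have "[card (carrier R)] \<cdot> \<one> = \<zero>"
    using add.pow_order_eq_1[of \<one>] by (simp add: Coset.order_def)
  then show ?thesis
    using card by (simp add: emb_def add_pow_int_ge nat_power_eq)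
qed

lemma emb_power: "emb (x ^ n) = emb x [^] n"
  by (induction n) (simp_all add: emb_simps m_comm)

text \<open>The order of the additive group gives \<open>emb p [^] k = \<zero>\<close>, and a field
  has no nonzero nilpotent elements.\<close>

lemma emb_p: "emb (int p) = \<zero>"
proof -
  have "x = \<zero>" if "x \<in> carrier R" "x [^] n = \<zero>" for x and n :: nat
    using that by (induction n) (auto simp: integral_iff)
  moreover have "emb (int p) [^] k = \<zero>"
    using emb_card by (simp add: emb_power)
  ultimately show ?thesis
    using emb_simps(1) by blast
qed

lemma emb_coprime_nonzero:
  assumes "coprime n (int p)"
  shows "emb n \<noteq> \<zero>"
proof
  assume n: "emb n = \<zero>"
  obtain u v where "u * n + v * int p = 1"
    using bezout_int[of n "int p"] assms by (auto simp: coprime_iff_gcd_eq_1)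
  then have "emb (u * n + v * int p) = \<one>"
    by (simp add: emb_simps)
  then show False
    using n by (simp add: emb_simps emb_p)
qed

lemma emb_cong:
  assumes "[x = y] (mod int p)"
  shows "emb x = emb y"
proof -
  have "int p dvd x - y"
    using assms by (simp add: cong_iff_dvd_diff)
  then obtain t where "x - y = int p * t"
    by (rule dvdE)
  then have "x = y + int p * t"
    by simp
  then show ?thesis
    by (simp add: emb_simps emb_p)
qed

lemma generator:
  obtains a where "a \<in> carrier R" "a \<noteq> \<zero>" "carrier R - {\<zero>} = range (\<lambda>i::nat. a [^] i)"
    "\<And>i. a [^] i = \<one> \<longleftrightarrow> (p ^ k - 1) dvd i"
proof -
  interpret M: group "Multiplicative_Group.mult_of R"
    by (rule field_mult_group)
  obtain a where a: "a \<in> carrier (Multiplicative_Group.mult_of R)" "carrier (Multiplicative_Group.mult_of R) = {a [^] i | i::nat. i \<in> UNIV}"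
    using finite_field_mult_group_has_gen[OF finite] by blast
  have fin: "finite (carrier (Multiplicative_Group.mult_of R))"
    using finite by simp
  have "M.ord a = card (carrier (Multiplicative_Group.mult_of R))"
    using M.generate_pow_card[OF a(1)] M.generate_pow_on_finite_carrier[OF fin a(1)] a(2)
    by (simp add: Multiplicative_Group.nat_pow_mult_of)
  also have "\<dots> = p ^ k - 1"
    using finite card by simp
  finally have "a [^] i = \<one> \<longleftrightarrow> (p ^ k - 1) dvd i" for i :: nat
    using M.pow_eq_id[OF a(1), of i] by (simp add: Multiplicative_Group.nat_pow_mult_of)
  moreover have "carrier R - {\<zero>} = range (\<lambda>i::nat. a [^] i)"
    using a(2) by auto
  ultimately show thesis
    using that a(1) by auto
qed

lemma pow_card_minus_one:
  assumes "x \<in> carrier R" "x \<noteq> \<zero>"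
  shows "x [^] (p ^ k - 1) = \<one>"
proof -
  interpret M: group "Multiplicative_Group.mult_of R"
    by (rule field_mult_group)
  show ?thesis
    using M.pow_order_eq_1[of x] assms finite card by (simp add: Coset.order_def Multiplicative_Group.nat_pow_mult_of)
qed

lemma card_pos: "p ^ k > 1"
proof -
  have "card {\<zero>, \<one>} \<le> card (carrier R)"
    using finite by (intro card_mono) auto
  then show ?thesis
    using card by simp
qed

text \<open>Euler's criterion: if \<open>c\<close> is the \<open>m\<close>-th power of a generator,
  then \<open>c [^] t = \<one>\<close> means that \<open>2 * t\<close> divides \<open>m * t\<close>,
  hence \<open>m\<close> is even.\<close>

lemma sqrt_exists:
  assumes c: "c \<in> carrier R" "c \<noteq> \<zero>" and t: "p ^ k - 1 = 2 * t" and pow: "c [^] t = \<one>"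
  obtains y where "y \<in> carrier R" "y \<otimes> y = c"
proof -
  obtain a where a: "a \<in> carrier R" "a \<noteq> \<zero>" "carrier R - {\<zero>} = range (\<lambda>i::nat. a [^] i)"
    "\<And>i. a [^] i = \<one> \<longleftrightarrow> (p ^ k - 1) dvd i"
    using generator by metis
  from c a(3) obtain m :: nat where m: "c = a [^] m"
    by blast
  have "(p ^ k - 1) dvd m * t"
    using pow a(4)[of "m * t"] a(1) by (simp only: m nat_pow_pow)
  then have "2 * t dvd m * t"
    by (simp only: t)
  moreover have "t > 0"
    using t card_pos by (cases t) auto
  ultimately have "even m"
    by simp
  then obtain l where "m = l + l"
    by (metis evenE mult_2)
  then have "a [^] l \<otimes> a [^] l = c"
    using a(1) by (simp add: m nat_pow_mult)
  then show thesis
    using that a(1) by blast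
qed

end

text \<open>\<open>s\<close> is the geometric sum \<open>1 + p + ... + p^(k-1)\<close>, which has
  \<open>k\<close> odd terms.\<close>

lemma geometric_parity:
  fixes p :: nat
  assumes "odd p"
  obtains s where "p ^ k - 1 = (p - 1) * s" "even s \<longleftrightarrow> even k"
proof -
  have "\<exists>s. p ^ k - 1 = (p - 1) * s \<and> (even s \<longleftrightarrow> even k)"
  proof (induction k)
    case (Suc k)
    then obtain s where s: "p ^ k - 1 = (p - 1) * s" "even s \<longleftrightarrow> even k"
      by blast
    have "p \<ge> 1"
      using assms by (cases p) auto
    then have "p ^ k \<ge> 1"
      by simp
    have "p ^ Suc k - 1 = p * (p ^ k - 1) + (p - 1)"
      using \<open>p \<ge> 1\<close> \<open>p ^ k \<ge> 1\<close> by (simp add: diff_mult_distrib2)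
    also have "\<dots> = (p - 1) * (p * s + 1)"
      using s(1) by (simp add: distrib_left mult.left_commute)
    finally show ?case
      using s assms by (intro exI[of _ "p * s + 1"]) simp
  qed (auto intro: exI[of _ 0])
  then show thesis
    using that by blast
qed

lemma QuadRes_7_iff:
  fixes p :: nat
  shows "QuadRes 7 (int p) \<longleftrightarrow> p mod 7 \<in> {0, 1, 2, 4}"
proof -
  have "[y\<^sup>2 = int p] (mod 7) \<longleftrightarrow> ((y mod 7)\<^sup>2) mod 7 = int (p mod 7)" for y
    unfolding cong_def by (simp only: power_mod of_nat_mod of_nat_numeral)
  moreover have "(\<exists>y::int. ((y mod 7)\<^sup>2) mod 7 = int (p mod 7)) \<longleftrightarrow> p mod 7 \<in> {0, 1, 2, 4}"
  proof
    assume "\<exists>y::int. ((y mod 7)\<^sup>2) mod 7 = int (p mod 7)"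
    then obtain y :: int where y: "((y mod 7)\<^sup>2) mod 7 = int (p mod 7)"
      by blast
    have "y mod 7 \<in> {0..<7}"
      by simp
    also have "{0..<7} = {0, 1, 2, 3, 4, 5, 6::int}"
      by auto
    finally show "p mod 7 \<in> {0, 1, 2, 4}"
      using y by auto
  next
    assume "p mod 7 \<in> {0, 1, 2, 4}"
    \<comment> \<open>Square roots of 0, 1, 2, 4 modulo 7 are 0, 1, 3, 2.\<close>
    then have "((0 mod 7)\<^sup>2) mod 7 = int (p mod 7) \<or> ((1 mod 7)\<^sup>2) mod 7 = int (p mod 7) \<or>
        ((3 mod 7)\<^sup>2) mod 7 = int (p mod 7) \<or> ((2 mod 7)\<^sup>2) mod 7 = int (p mod 7)"
      by auto
    then show "\<exists>y::int. ((y mod 7)\<^sup>2) mod 7 = int (p mod 7)"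
      by blast
  qed
  ultimately show ?thesis
    unfolding QuadRes_def by (simp only:)
qed

text \<open>As \<open>(7 - 1) / 2\<close> is odd, reciprocity for 7 and \<open>p\<close> contributes
  the sign \<open>(-1)^((p-1)/2)\<close>, which is also the Legendre symbol of -1. The two cancel,
  and the symbol of -7 modulo \<open>p\<close> is that of \<open>p\<close> modulo 7.\<close>

lemma minus_7_power:
  fixes p :: nat
  assumes p: "Factorial_Ring.prime p" "p \<ge> 11"
  shows "[(- 7) ^ ((p - 1) div 2) = (if p mod 7 \<in> {1, 2, 4} then 1 else - 1)] (mod int p)"
proof -
  have "Factorial_Ring.prime (7::nat)"
    by (simp add: prime_nat_numeral_eq)
  have "\<not> p dvd 7"
    using p by (auto dest: dvd_imp_le)
  moreover have "\<not> 7 dvd p"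
    using p \<open>Factorial_Ring.prime (7::nat)\<close> by (metis \<open>\<not> p dvd 7\<close> primes_dvd_imp_eq dvd_refl)
  ultimately have nz: "\<not> [7 = 0] (mod int p)" "\<not> [int p = 0] (mod 7)"
    by (auto simp: cong_0_iff) (metis int_dvd_int_iff of_nat_numeral)+
  have "Legendre (int p) (int 7) * Legendre (int 7) (int p) = (- 1) ^ ((p - 1) div 2 * ((7 - 1) div 2))"
    using p \<open>Factorial_Ring.prime (7::nat)\<close> by (intro Quadratic_Reciprocity) auto
  also have "(- 1) ^ ((p - 1) div 2 * ((7 - 1) div 2)) = ((- 1) ^ ((p - 1) div 2) :: int)"
    by (simp add: power_mult power3_eq_cube)
  finally have rec: "Legendre (int p) 7 * Legendre 7 (int p) = (- 1) ^ ((p - 1) div 2)"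
    by simp
  have sq: "Legendre 7 (int p) * Legendre 7 (int p) = 1"
    using nz by (simp add: Legendre_def)
  have "(- 7) ^ ((p - 1) div 2) = (- 1) ^ ((p - 1) div 2) * (7::int) ^ ((p - 1) div 2)"
    by (rule power_minus)
  moreover have "[Legendre 7 (int p) = 7 ^ ((p - 1) div 2)] (mod int p)"
    using euler_criterion[of p 7] p by simp
  ultimately have "[(- 7) ^ ((p - 1) div 2) = (Legendre (int p) 7 * Legendre 7 (int p)) * Legendre 7 (int p)] (mod int p)"
    unfolding rec by (metis cong_mult cong_refl cong_sym)
  also have "(Legendre (int p) 7 * Legendre 7 (int p)) * Legendre 7 (int p) = Legendre (int p) 7"
    using sq by (simp add: mult.assoc)
  also have "Legendre (int p) 7 = (if p mod 7 \<in> {1, 2, 4} then 1 else - 1)"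
    using nz(2) QuadRes_7_iff[of p] \<open>\<not> 7 dvd p\<close> by (auto simp: Legendre_def mod_eq_0_iff_dvd)
  finally show ?thesis .
qed

context finite_field
begin

text \<open>\<open>(p^k - 1) / 2\<close> is \<open>(p - 1) / 2\<close> times the geometric sum
  \<open>s\<close>, so the value is the \<open>s\<close>-th power of the Legendre symbol, and
  \<open>s\<close> has the parity of \<open>k\<close>.\<close>

lemma odd_pow_card:
  assumes "p \<ge> 11"
  obtains t where "p ^ k - 1 = 2 * t" "emb (- 7) [^] t = (if p mod 7 \<in> {1, 2, 4} \<or> even k then \<one> else \<ominus> \<one>)"
proof -
  have odd: "odd p"
    using prime assms by (intro prime_odd_nat) auto
  obtain s where s: "p ^ k - 1 = (p - 1) * s" "even s \<longleftrightarrow> even k"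
    using geometric_parity[OF odd] by blast
  have "even (p - 1)"
    using odd by simp
  then obtain l where l: "p - 1 = 2 * l"
    by (rule evenE)
  let ?e = "if p mod 7 \<in> {1, 2, 4} then 1 else - 1 :: int"
  have "emb (- 7) [^] (l * s) = emb (((- 7) ^ l) ^ s)"
    by (simp only: emb_power nat_pow_pow emb_simps(1))
  also have "\<dots> = emb (?e ^ s)"
    using minus_7_power[OF prime assms] l by (intro emb_cong cong_pow) simp
  also have "?e ^ s = (if p mod 7 \<in> {1, 2, 4} \<or> even k then 1 else - 1)"
    using s(2) by simp
  finally have "emb (- 7) [^] (l * s) = (if p mod 7 \<in> {1, 2, 4} \<or> even k then \<one> else \<ominus> \<one>)"
    by (simp add: emb_simps)
  moreover have "p ^ k - 1 = 2 * (l * s)"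
    using s l by simp
  ultimately show thesis
    using that by blast
qed

lemma coprime_168:
  assumes "p \<ge> 11"
  shows "coprime 168 (int p)"
proof -
  have "\<not> p dvd 168"
  proof
    assume "p dvd 168"
    also have "(168::nat) = 2 ^ 3 * (3 * 7)"
      by simp
    finally have "p dvd 2 \<or> p dvd 3 \<or> p dvd 7"
      using prime by (metis prime_dvd_mult_iff prime_dvd_power)
    then show False
      using assms by (auto dest: dvd_imp_le)
  qed
  then have "coprime p 168"
    using prime by (rule prime_imp_coprime[rotated])
  then show ?thesis
    by (metis coprime_commute coprime_int_iff of_nat_numeral)
qed

lemma emb_dvd_168_nonzero: "p \<ge> 11 \<Longrightarrow> n dvd 168 \<Longrightarrow> emb n \<noteq> \<zero>"
  using coprime_168 emb_coprime_nonzero by (metis coprime_divisors dvd_refl)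

lemma emb_2_nonzero: "p \<ge> 11 \<Longrightarrow> emb 2 \<noteq> \<zero>"
  by (rule emb_dvd_168_nonzero) auto

text \<open>Completion of the square: roots of \<open>x^2 + x + 2\<close> correspond to square roots
  of its discriminant -7.\<close>

lemma root_iff_sqrt:
  assumes "\<alpha> \<in> carrier R"
  shows "(emb 2 \<otimes> \<alpha> \<oplus> \<one>) \<otimes> (emb 2 \<otimes> \<alpha> \<oplus> \<one>) = emb (- 7) \<oplus> emb 4 \<otimes> (\<alpha> \<otimes> \<alpha> \<oplus> \<alpha> \<oplus> emb 2)"
proof -
  have e: "emb 2 = \<one> \<oplus> \<one>"
    using emb_simps(2)[of 1 1] by (simp add: emb_simps(4))
  have e': "emb 4 = emb 2 \<otimes> emb 2" "emb (- 7) = \<one> \<ominus> emb 2 \<otimes> emb 2 \<otimes> emb 2"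
    using emb_simps(3)[of 2 2] emb_simps(3)[of 4 2] emb_simps(2)[of 1 "- 8"] emb_simps(6)[of 8]
    by (simp_all add: emb_simps(4) a_minus_def)
  have "x \<oplus> x = emb 2 \<otimes> x" if "x \<in> carrier R" for x
    unfolding e using that by (simp add: l_distr)
  then have double: "emb 2 \<otimes> \<alpha> \<oplus> emb 2 \<otimes> \<alpha> = emb 2 \<otimes> (emb 2 \<otimes> \<alpha>)"
    using assms emb_simps(1) by simp
  have "(t \<otimes> \<alpha> \<oplus> \<one>) \<otimes> (t \<otimes> \<alpha> \<oplus> \<one>) = t \<otimes> \<alpha> \<otimes> (t \<otimes> \<alpha>) \<oplus> (t \<otimes> \<alpha> \<oplus> t \<otimes> \<alpha>) \<oplus> \<one>"
    if "t \<in> carrier R" for t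
    using that assms by algebra
  moreover have "t \<otimes> \<alpha> \<otimes> (t \<otimes> \<alpha>) \<oplus> t \<otimes> (t \<otimes> \<alpha>) \<oplus> \<one> = (\<one> \<ominus> t \<otimes> t \<otimes> t) \<oplus> t \<otimes> t \<otimes> (\<alpha> \<otimes> \<alpha> \<oplus> \<alpha> \<oplus> t)"
    if "t \<in> carrier R" for t
    using that assms by algebra
  ultimately show ?thesis
    unfolding e' using emb_simps(1)[of 2] double by simp
qed

lemma root_exists:
  assumes "p \<ge> 11" "p mod 7 \<in> {1, 2, 4} \<or> even k"
  obtains \<alpha> where "\<alpha> \<in> carrier R" "\<alpha> \<otimes> \<alpha> \<oplus> \<alpha> \<oplus> emb 2 = \<zero>"
proof -
  obtain t where t: "p ^ k - 1 = 2 * t" "emb (- 7) [^] t = \<one>"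
    using odd_pow_card[OF assms(1)] assms(2) by metis
  have "emb (- 7) \<noteq> \<zero>"
  proof
    assume "emb (- 7) = \<zero>"
    then have "\<zero> [^] t = \<one>"
      using t(2) by simp
    then have "t = 0"
      using nat_pow_zero[of t] by (cases "t = 0") auto
    then show False
      using t(1) card_pos by simp
  qed
  then obtain y where y: "y \<in> carrier R" "y \<otimes> y = emb (- 7)"
    using sqrt_exists[OF emb_simps(1) _ t] by blast
  have unit: "emb 2 \<in> Units R"
    using emb_2_nonzero[OF assms(1)] by (simp add: field_Units emb_simps(1))
  define \<alpha> where "\<alpha> = inv (emb 2) \<otimes> (y \<ominus> \<one>)"
  have \<alpha>: "\<alpha> \<in> carrier R"
    using y unit by (simp add: \<alpha>_def)
  have "emb 2 \<otimes> \<alpha> = y \<ominus> \<one>"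
    using y unit by (simp add: \<alpha>_def m_assoc[symmetric] Units_closed)
  then have "emb 2 \<otimes> \<alpha> \<oplus> \<one> = y"
    using y(1) by (simp add: a_minus_def a_assoc l_neg)
  then have "emb (- 7) \<oplus> emb 4 \<otimes> (\<alpha> \<otimes> \<alpha> \<oplus> \<alpha> \<oplus> emb 2) = emb (- 7)"
    using root_iff_sqrt[OF \<alpha>] y(2) by simp
  then have "emb 4 \<otimes> (\<alpha> \<otimes> \<alpha> \<oplus> \<alpha> \<oplus> emb 2) = \<zero>"
    using \<alpha> emb_simps(1) by (intro iffD1[OF add.l_cancel_one]) auto
  moreover have "emb 4 \<noteq> \<zero>"
    using emb_simps(3)[of 2 2] emb_2_nonzero[OF assms(1)] emb_simps(1) integral_iff by auto
  ultimately have "\<alpha> \<otimes> \<alpha> \<oplus> \<alpha> \<oplus> emb 2 = \<zero>"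
    using \<alpha> emb_simps(1) integral_iff by simp
  then show thesis
    using that \<alpha> by blast
qed

text \<open>A root gives \<open>y\<close> with square -7. Then \<open>y^(q-1)\<close> equals the
  power of -7 with exponent \<open>(q-1)/2\<close>, which is -1, whereas the unit group has order
  \<open>q - 1\<close>.\<close>

lemma no_root:
  assumes "p \<ge> 11" "p mod 7 \<notin> {1, 2, 4}" "odd k" "\<alpha> \<in> carrier R"
  shows "\<alpha> \<otimes> \<alpha> \<oplus> \<alpha> \<oplus> emb 2 \<noteq> \<zero>"
proof
  assume *: "\<alpha> \<otimes> \<alpha> \<oplus> \<alpha> \<oplus> emb 2 = \<zero>"
  define y where "y = emb 2 \<otimes> \<alpha> \<oplus> \<one>"
  have y: "y \<in> carrier R" "y \<otimes> y = emb (- 7)"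
    using root_iff_sqrt[OF assms(4)] assms(4) * by (simp_all add: y_def emb_simps(1))
  obtain t where t: "p ^ k - 1 = 2 * t" "emb (- 7) [^] t = \<ominus> \<one>"
    using odd_pow_card[OF assms(1)] assms(2,3) by metis
  have "y [^] (p ^ k - 1) = (y \<otimes> y) [^] t"
    using y(1) by (simp only: t(1) nat_pow_pow[symmetric] numeral_2_eq_2 nat_pow_Suc nat_pow_0 l_one)
  then have 1: "y [^] (p ^ k - 1) = \<ominus> \<one>"
    by (simp only: y(2) t(2))
  moreover have "y \<noteq> \<zero>"
  proof
    assume "y = \<zero>"
    then have "\<ominus> \<one> = \<zero>"
      using 1 card_pos nat_pow_zero[of "p ^ k - 1"] by simp
    then show False
      by (metis add.inv_eq_1_iff one_closed zero_not_one)
  qed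
  ultimately have "\<one> = \<ominus> \<one>"
    using pow_card_minus_one[OF y(1)] by simp
  then have "emb 2 = \<zero>"
    using emb_simps(2)[of 1 1] by (simp add: emb_simps(4)) (metis one_closed r_neg)
  then show False
    using emb_2_nonzero[OF assms(1)] by simp
qed

end

section \<open>Embedding of a finite field into its quadratic extension\<close>

lemma (in finite_field) pev_all_dvd:
  assumes "a \<in> carrier R" "\<And>i. int p dvd Polynomial.coeff r i"
  shows "pev R emb a r = \<zero>"
proof -
  have "emb (Polynomial.coeff r i) = \<zero>" for i
    using assms(2)[of i] emb_cong[of "Polynomial.coeff r i" 0] by (simp add: cong_0_iff emb_simps)
  then show ?thesis
    using assms(1) by (simp add: pev_def finsum_zero)
qed

lemma (in finite_field) pow_card:
  assumes "a \<in> carrier R"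
  shows "a [^] (p ^ k) = a"
proof (cases "a = \<zero>")
  case False
  have "a [^] (Suc (p ^ k - 1)) = a"
    using pow_card_minus_one[OF assms False] assms by (simp only: nat_pow_Suc l_one)
  moreover have "Suc (p ^ k - 1) = p ^ k"
    using card_pos by simp
  ultimately show ?thesis
    by (simp only:)
next
  case True
  have "p ^ k \<noteq> 0"
    using card_pos by linarith
  then show ?thesis
    unfolding True by (rule nat_pow_zero)
qed

text \<open>The kernel of evaluation at \<open>a\<close> is generated by \<open>m\<close> and
  \<open>p\<close>. Working over the integers, \<open>m\<close> comes from a vanishing polynomial of
  least degree among those whose leading coefficient is prime to \<open>p\<close>.\<close>

lemma (in finite_field) minimal_polynomial:
  assumes a: "a \<in> carrier R"
  obtains m where "lead_coeff m = 1" "0 < degree m" "pev R emb a m = \<zero>"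
    "\<And>f. pev R emb a f = \<zero> \<Longrightarrow> \<exists>g r. f = m * g + r \<and> (r = 0 \<or> degree r < degree m) \<and> (\<forall>i. int p dvd Polynomial.coeff r i)"
proof -
  let ?ev = "pev R emb a"
  note hom = type_hom_pev[OF type_hom_emb a]
  note ev = type_hom_simps[OF hom] type_hom_minus[OF hom] pev_monom[OF type_hom_emb a] pev_smult[OF type_hom_emb a]
  have ev_diff: "?ev (f - g) = ?ev f \<ominus> ?ev g" for f g
    using ev(2)[of f "- g"] by (simp add: ev a_minus_def)
  define Q where "Q f \<longleftrightarrow> ?ev f = \<zero> \<and> \<not> int p dvd lead_coeff f" for f
  have p1: "\<not> int p dvd 1"
    using prime by (simp add: prime_nat_iff)
  \<comment> \<open>\<open>x^q - x\<close> is monic and vanishes on the field, so there is a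
    polynomial to minimise over.\<close>
  let ?F = "Polynomial.monom 1 (p ^ k) - Polynomial.monom 1 1 :: int poly"
  have "a [^] (p ^ k) = a"
    using a by (rule pow_card)
  then have evF: "?ev ?F = \<zero>"
    using a by (simp add: ev_diff ev emb_simps r_right_minus_eq)
  have degF: "degree ?F = p ^ k" "lead_coeff ?F = 1"
  proof -
    have "degree ?F \<le> p ^ k"
      using card_pos by (intro degree_diff_le) (auto simp: degree_monom_eq)
    moreover have c: "Polynomial.coeff ?F (p ^ k) = 1"
      using card_pos by simp
    ultimately show "degree ?F = p ^ k"
      by (metis le_antisym le_degree zero_neq_one)
    with c show "lead_coeff ?F = 1"
      by simp
  qed
  have "Q ?F"
    unfolding Q_def using evF degF(2) p1 by simp
  then obtain m0 where m0: "Q m0" and min: "\<And>f. Q f \<Longrightarrow> degree m0 \<le> degree f"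
    using ex_has_least_nat[of Q ?F degree] by blast
  define n where "n = degree m0"
  have "coprime (lead_coeff m0) (int p)"
    using m0 prime unfolding Q_def by (metis coprime_commute prime_imp_coprime prime_nat_int_transfer)
  then obtain u v where uv: "u * lead_coeff m0 + v * int p = 1"
    using bezout_int[of "lead_coeff m0" "int p"] by (auto simp: coprime_iff_gcd_eq_1)
  \<comment> \<open>\<open>u\<close> inverts the leading coefficient modulo \<open>p\<close>; the
    added multiple of \<open>p\<close> makes it exactly 1 and evaluates to zero.\<close>
  define m where "m = Polynomial.smult u m0 + Polynomial.monom (v * int p) n"
  have coeff_m: "Polynomial.coeff m n = 1"
    using uv by (simp add: m_def n_def)
  moreover have "degree m \<le> n"
    unfolding m_def n_def by (intro degree_add_le degree_smult_le degree_monom_le)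
  ultimately have deg_m: "degree m = n"
    by (metis le_antisym le_degree zero_neq_one)
  then have lead: "lead_coeff m = 1"
    using coeff_m by simp
  have evm: "?ev m = \<zero>"
    using m0 a unfolding m_def Q_def by (simp add: ev emb_simps emb_p)
  have "n \<noteq> 0"
  proof
    assume "n = 0"
    then have "m = 1"
      using deg_m coeff_m by (metis degree_0_id one_pCons)
    then show False
      using evm ev(4) by simp
  qed
  \<comment> \<open>By minimality the top coefficient of a vanishing polynomial of degree below
    \<open>n\<close> is divisible by \<open>p\<close>. Its monomial then vanishes too and can be
    removed, which lowers the degree.\<close>
  have small: "\<forall>i. int p dvd Polynomial.coeff r i"
    if "?ev r = \<zero>" "\<forall>i\<ge>d. Polynomial.coeff r i = 0" "d \<le> n" for r d
    using that
  proof (induction d arbitrary: r)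
    case (Suc d)
    show ?case
    proof (cases "Polynomial.coeff r d = 0")
      case True
      then have "\<forall>i\<ge>d. Polynomial.coeff r i = 0"
        using Suc.prems(2) by (metis Suc_leI le_neq_implies_less)
      then show ?thesis
        using Suc by simp
    next
      case False
      have deg: "degree r = d"
        using False Suc.prems(2) by (intro le_antisym degree_le le_degree) auto
      have dvd: "int p dvd Polynomial.coeff r d"
      proof (rule ccontr)
        assume "\<not> int p dvd Polynomial.coeff r d"
        then have "Q r"
          using Suc.prems(1) deg unfolding Q_def by simp
        from min[OF this] show False
          using deg Suc.prems(3) by (simp add: n_def)
      qed
      define r' where "r' = r - Polynomial.monom (Polynomial.coeff r d) d"
      have "?ev (Polynomial.monom (Polynomial.coeff r d) d) = \<zero>"
        using dvd by (intro pev_all_dvd a) (auto simp: coeff_monom)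
      then have "?ev r' = \<zero>"
        using Suc.prems(1) by (simp add: r'_def ev_diff)
      moreover have "\<forall>i\<ge>d. Polynomial.coeff r' i = 0"
        using Suc.prems(2) by (auto simp: r'_def coeff_monom)
      ultimately have "\<forall>i. int p dvd Polynomial.coeff r' i"
        using Suc.IH Suc.prems(3) by simp
      then have "int p dvd Polynomial.coeff r' i + Polynomial.coeff (Polynomial.monom (Polynomial.coeff r d) d) i" for i
        using dvd by (intro dvd_add) (auto simp: coeff_monom)
      then show ?thesis
        by (simp add: r'_def)
    qed
  qed simp
  have "\<exists>g r. f = m * g + r \<and> (r = 0 \<or> degree r < degree m) \<and> (\<forall>i. int p dvd Polynomial.coeff r i)"
    if f: "?ev f = \<zero>" for f
  proof -
    obtain g r where gr: "pseudo_divmod f m = (g, r)"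
      by (cases "pseudo_divmod f m")
    have "m \<noteq> 0"
      using lead by auto
    \<comment> \<open>The scaling factor of pseudo-division is a power of the leading coefficient of
      \<open>m\<close>, which is 1.\<close>
    from pseudo_divmod[OF this gr] have eq: "f = m * g + r" and r: "r = 0 \<or> degree r < degree m"
      using lead by simp_all
    have "?ev r = \<zero>"
      using f eq evm by (simp add: ev)
    moreover have "\<forall>i\<ge>n. Polynomial.coeff r i = 0"
      using r deg_m by (auto intro: coeff_eq_0)
    ultimately have "\<forall>i. int p dvd Polynomial.coeff r i"
      using small[of r n] by simp
    then show ?thesis
      using eq r by blast
  qed
  then show thesis
    using that[of m] lead evm deg_m \<open>n \<noteq> 0\<close> by simp
qed

text \<open>Modulo \<open>p\<close> the polynomial \<open>m\<close> of a generator \<open>a\<close>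
  divides \<open>x^q - x\<close>, which has \<open>q\<close> roots in the big field. The cofactor
  has degree below \<open>q\<close>, so one of these is a root \<open>b\<close> of \<open>m\<close>,
  and \<open>a\<close> can be sent to \<open>b\<close>.\<close>

lemma finite_field_embedding:
  assumes "finite_field R p k" "finite_field S p (2 * k)"
  obtains \<iota> where "\<iota> \<in> ring_hom R S"
proof -
  interpret R: finite_field R p k by fact
  interpret S: finite_field S p "2 * k" by fact
  define q where "q = p ^ k"
  have q: "q > 1" "p ^ (2 * k) - 1 = (q + 1) * (q - 1)"
    using R.card_pos by (simp_all add: q_def algebra_simps power_add mult_2 flip: power2_eq_square power_mult)
  obtain a where a: "a \<in> carrier R" "a \<noteq> \<zero>\<^bsub>R\<^esub>" "carrier R - {\<zero>\<^bsub>R\<^esub>} = range (\<lambda>i::nat. a [^]\<^bsub>R\<^esub> i)"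
    using R.generator by metis
  let ?evR = "pev R R.emb a" and ?evS = "\<lambda>b. pev S S.emb b"
  note homR = R.type_hom_pev[OF R.type_hom_emb a(1)]
  note homS = S.type_hom_pev[OF S.type_hom_emb]
  obtain m where m: "lead_coeff m = 1" "0 < degree m" "?evR m = \<zero>\<^bsub>R\<^esub>"
    and divide: "\<And>f. ?evR f = \<zero>\<^bsub>R\<^esub> \<Longrightarrow>
      \<exists>g r. f = m * g + r \<and> (r = 0 \<or> degree r < degree m) \<and> (\<forall>i. int p dvd Polynomial.coeff r i)"
    using R.minimal_polynomial[OF a(1)] by metis
  obtain b where b: "b \<in> carrier S" "?evS b m = \<zero>\<^bsub>S\<^esub>"
  proof -
    let ?F = "Polynomial.monom 1 q - Polynomial.monom 1 1 :: int poly"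
    have evF: "pev K (ring.emb K) c ?F = c [^]\<^bsub>K\<^esub> q \<ominus>\<^bsub>K\<^esub> c" if "cring K" "c \<in> carrier K" for c and K :: "('x, 'y) ring_scheme"
    proof -
      interpret K: cring K by fact
      note hom = K.type_hom_pev[OF K.type_hom_emb that(2)]
      show ?thesis
        using type_hom_simps(2)[OF hom, of "Polynomial.monom 1 q" "- Polynomial.monom 1 1"] that(2)
        by (simp add: K.type_hom_minus[OF hom] K.pev_monom[OF K.type_hom_emb] K.emb_simps a_minus_def)
    qed
    have "a [^]\<^bsub>R\<^esub> q = a"
      unfolding q_def using a(1) by (rule R.pow_card)
    then have "?evR ?F = \<zero>\<^bsub>R\<^esub>"
      using evF[OF R.is_cring a(1)] a(1) by (simp add: R.r_right_minus_eq)
    then obtain g r where gr: "?F = m * g + r" "r = 0 \<or> degree r < degree m" "\<And>i. int p dvd Polynomial.coeff r i"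
      using divide by metis
    have degF: "degree ?F = q" "lead_coeff ?F = 1"
    proof -
      have "degree ?F \<le> q"
        using q by (intro degree_diff_le) (auto simp: degree_monom_eq)
      moreover have c: "Polynomial.coeff ?F q = 1"
        using q by simp
      ultimately show "degree ?F = q"
        by (metis le_antisym le_degree zero_neq_one)
      with c show "lead_coeff ?F = 1"
        by simp
    qed
    have "g \<noteq> 0"
    proof
      assume "g = 0"
      then have "int p dvd lead_coeff ?F"
        using gr by simp
      then show False
        using degF R.prime by (simp add: prime_nat_iff)
    qed
    moreover have "m \<noteq> 0"
      using m(2) by auto
    ultimately have "degree (m * g) = degree m + degree g"
      by (simp add: degree_mult_eq)
    moreover have "lead_coeff (m * g) = lead_coeff g"
      using m(1) by (simp only: lead_coeff_mult mult_1)
    moreover have "degree r < degree (m * g)" if "r \<noteq> 0"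
      using gr(2) that \<open>degree (m * g) = degree m + degree g\<close> by simp
    then have "degree (m * g + r) = degree (m * g) \<and> lead_coeff (m * g + r) = lead_coeff (m * g)"
      using degree_add_eq_left[of r "m * g"] lead_coeff_add_le[of r "m * g"]
      by (cases "r = 0") (simp_all only: add.commute[of r] add_0_right simp_thms)
    ultimately have g: "q = degree m + degree g" "lead_coeff g = 1"
      using degF unfolding gr(1) by metis+
    \<comment> \<open>The fixed points of the \<open>q\<close>-th power map. Besides zero they
      contain the powers of a generator whose exponents are multiples of \<open>q + 1\<close>, and
      there are \<open>q - 1\<close> of these.\<close>
    define B where "B = {c \<in> carrier S. c [^]\<^bsub>S\<^esub> q = c}"
    have "q \<le> card B"
    proof -
      obtain c where c: "c \<in> carrier S" "c \<noteq> \<zero>\<^bsub>S\<^esub>" "\<And>i. c [^]\<^bsub>S\<^esub> i = \<one>\<^bsub>S\<^esub> \<longleftrightarrow> (p ^ (2 * k) - 1) dvd i"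
        using S.generator by metis
      define e where "e i = c [^]\<^bsub>S\<^esub> ((q + 1) * i)" for i :: nat
      have nz: "c [^]\<^bsub>S\<^esub> i \<noteq> \<zero>\<^bsub>S\<^esub>" for i :: nat
        using c(1,2) by (induction i) (auto simp: S.integral_iff)
      have inj: "inj_on e {..<q - 1}"
      proof (rule linorder_inj_onI')
        fix i j
        assume ij: "i \<in> {..<q - 1}" "j \<in> {..<q - 1}" "i < j"
        show "e i \<noteq> e j"
        proof
          assume eq: "e i = e j"
          have "e j = e i \<otimes>\<^bsub>S\<^esub> c [^]\<^bsub>S\<^esub> ((q + 1) * (j - i))"
          proof -
            have "(q + 1) * j = (q + 1) * i + (q + 1) * (j - i)"
              using ij(3) by (simp only: distrib_left[symmetric] le_add_diff_inverse less_imp_le)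
            then show ?thesis
              unfolding e_def using c(1) by (simp only: S.nat_pow_mult)
          qed
          then have "c [^]\<^bsub>S\<^esub> ((q + 1) * (j - i)) = \<one>\<^bsub>S\<^esub>"
            using eq nz c(1) unfolding e_def by (metis S.m_lcancel S.nat_pow_closed S.one_closed S.r_one)
          then have "(q + 1) * (q - 1) dvd (q + 1) * (j - i)"
            using c(3) q(2) by metis
          then have "q - 1 dvd j - i"
            by (metis Suc_eq_plus1 nat_mult_dvd_cancel1 zero_less_Suc)
          then show False
            using ij by (auto dest: dvd_imp_le)
        qed
      qed
      have eB: "e i \<in> B" for i
      proof -
        have "e i [^]\<^bsub>S\<^esub> (q - 1) = \<one>\<^bsub>S\<^esub>"
        proof -
          have "(p ^ (2 * k) - 1) dvd ((q + 1) * i) * (q - 1)"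
            unfolding q(2) by (rule dvdI[of _ _ i]) (simp only: mult_ac)
          then show ?thesis
            unfolding e_def using c(1,3) by (simp only: S.nat_pow_pow)
        qed
        then have "e i [^]\<^bsub>S\<^esub> (Suc (q - 1)) = e i"
          using c(1) by (simp add: e_def)
        moreover have "Suc (q - 1) = q"
          using q(1) by simp
        ultimately have "e i [^]\<^bsub>S\<^esub> q = e i"
          by (simp only:)
        then show ?thesis
          using c(1) by (simp add: B_def e_def)
      qed
      have "\<zero>\<^bsub>S\<^esub> \<in> B"
        using q(1) by (simp add: B_def S.nat_pow_zero)
      then have "insert \<zero>\<^bsub>S\<^esub> (e ` {..<q - 1}) \<subseteq> B"
        using eB by blast
      moreover have "finite B"
        using S.finite by (simp add: B_def)
      ultimately have "card (insert \<zero>\<^bsub>S\<^esub> (e ` {..<q - 1})) \<le> card B"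
        by (simp add: card_mono)
      moreover have "\<zero>\<^bsub>S\<^esub> \<notin> e ` {..<q - 1}"
      proof
        assume "\<zero>\<^bsub>S\<^esub> \<in> e ` {..<q - 1}"
        then obtain i where "\<zero>\<^bsub>S\<^esub> = e i"
          by blast
        then show False
          using nz e_def by metis
      qed
      ultimately show ?thesis
        using inj q(1) by (simp add: card_image)
    qed
    have prod: "?evS c m \<otimes>\<^bsub>S\<^esub> ?evS c g = \<zero>\<^bsub>S\<^esub>" if "c \<in> B" for c
    proof -
      have c: "c \<in> carrier S" "c [^]\<^bsub>S\<^esub> q = c"
        using that by (auto simp: B_def)
      have "?evS c m \<otimes>\<^bsub>S\<^esub> ?evS c g \<oplus>\<^bsub>S\<^esub> ?evS c r = ?evS c ?F"
        unfolding gr(1) by (simp add: type_hom_simps[OF homS[OF c(1)]])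
      also have "\<dots> = \<zero>\<^bsub>S\<^esub>"
        using evF[OF S.is_cring c(1)] c by (simp add: S.r_right_minus_eq)
      finally show ?thesis
        using S.pev_all_dvd[OF c(1) gr(3)] type_hom_simps(1)[OF homS[OF c(1)]] by simp
    qed
    have "\<exists>c\<in>B. ?evS c m = \<zero>\<^bsub>S\<^esub>"
    proof (rule ccontr)
      assume "\<not> ?thesis"
      then have "B \<subseteq> {c \<in> carrier S. ?evS c g = \<zero>\<^bsub>S\<^esub>}"
        using prod type_hom_simps(1)[OF homS] by (auto simp: B_def S.integral_iff)
      then have "card B \<le> card {c \<in> carrier S. ?evS c g = \<zero>\<^bsub>S\<^esub>}"
        using S.finite by (intro card_mono) auto
      also have "\<dots> \<le> degree g"
        using g(2) by (intro S.card_pev_roots_le S.type_hom_emb S.finite) (simp add: S.emb_simps)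
      finally show False
        using \<open>q \<le> card B\<close> g(1) m(2) by simp
    qed
    then show thesis
      using that by (auto simp: B_def)
  qed
  \<comment> \<open>Evaluation at \<open>b\<close> kills \<open>m\<close> and \<open>p\<close>,
    hence the whole kernel of evaluation at \<open>a\<close>; this makes \<open>\<iota>\<close>
    independent of the chosen polynomial.\<close>
  have ker: "?evS b f = ?evS b g" if "?evR f = ?evR g" for f g
  proof -
    have "?evR (f - g) = \<zero>\<^bsub>R\<^esub>"
      using that type_hom_simps(1,2)[OF homR] R.type_hom_minus[OF homR]
      by (metis R.r_neg add_uminus_conv_diff)
    then obtain h r where "f - g = m * h + r" "\<And>i. int p dvd Polynomial.coeff r i"
      using divide by metis
    then have "f = g + (m * h + r)" and r: "?evS b r = \<zero>\<^bsub>S\<^esub>"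
      using S.pev_all_dvd[OF b(1)] by (auto simp: algebra_simps)
    then show ?thesis
      using b(2) type_hom_simps[OF homS[OF b(1)]] by simp
  qed
  have surj: "\<exists>f. ?evR f = x" if "x \<in> carrier R" for x
  proof (cases "x = \<zero>\<^bsub>R\<^esub>")
    case True
    then show ?thesis
      using R.type_hom_zero[OF homR] by blast
  next
    case False
    with that have "x \<in> carrier R - {\<zero>\<^bsub>R\<^esub>}"
      by simp
    then obtain i :: nat where "x = a [^]\<^bsub>R\<^esub> i"
      unfolding a(3) by (rule rangeE)
    then have "?evR (Polynomial.monom 1 i) = x"
      using a(1) by (simp add: R.pev_monom[OF R.type_hom_emb] R.emb_simps)
    then show ?thesis
      by blast
  qed
  define \<iota> where "\<iota> x = ?evS b (SOME f. ?evR f = x)" for x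
  have \<iota>: "\<iota> (?evR f) = ?evS b f" for f
    unfolding \<iota>_def by (rule ker) (rule someI, rule refl)
  have "\<iota> \<in> ring_hom R S"
  proof (rule ring_hom_memI)
    fix x y
    assume "x \<in> carrier R" "y \<in> carrier R"
    then obtain f g where fg: "x = ?evR f" "y = ?evR g"
      using surj by metis
    show "\<iota> (x \<otimes>\<^bsub>R\<^esub> y) = \<iota> x \<otimes>\<^bsub>S\<^esub> \<iota> y"
      unfolding fg type_hom_simps(3)[OF homR, symmetric] \<iota> by (rule type_hom_simps(3)[OF homS[OF b(1)]])
    show "\<iota> (x \<oplus>\<^bsub>R\<^esub> y) = \<iota> x \<oplus>\<^bsub>S\<^esub> \<iota> y"
      unfolding fg type_hom_simps(2)[OF homR, symmetric] \<iota> by (rule type_hom_simps(2)[OF homS[OF b(1)]])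
    show "\<iota> x \<in> carrier S"
      unfolding fg \<iota> by (rule type_hom_simps(1)[OF homS[OF b(1)]])
  next
    show "\<iota> \<one>\<^bsub>R\<^esub> = \<one>\<^bsub>S\<^esub>"
      using \<iota>[of 1] type_hom_simps(4)[OF homR] type_hom_simps(4)[OF homS[OF b(1)]] by simp
  qed
  then show thesis
    using that by blast
qed

section \<open>Dual bases of integer functions on the group\<close>

definition blocks :: "(nat \<times> nat \<times> nat) set" where
  "blocks = (SIGMA b:{..<6}. {..<blockdim b} \<times> {..<blockdim b})"

text \<open>Blocks 4 and 5 are the coordinate matrices of a single representation, not the conjugate
  pair. All values are thus integers, with images in every field.\<close>

definition coord :: "nat \<times> nat \<times> nat \<Rightarrow> f2mat \<Rightarrow> int" where
  "coord = (\<lambda>(b, i, j) g. if b < 4 then irep b g i j else if b = 4 then zre (rep3 g i j) else zim (rep3 g i j))"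

text \<open>For the last two blocks the dual functions are the traces of \<open>r\<close> and \<open>\<alpha> r\<close> from \<open>\<int>[\<alpha>]\<close> to \<open>\<int>\<close>, where \<open>r = x + y \<alpha>\<close>
  has traces \<open>2 x - y\<close> and \<open>- x - 3 y\<close>.\<close>

definition dual :: "nat \<times> nat \<times> nat \<Rightarrow> f2mat \<Rightarrow> int" where
  "dual = (\<lambda>(b, i, j) g. let h = inv\<^bsub>frame_group\<^esub> g; r = rep3 h j i in
     if b < 4 then irep b h j i else if b = 4 then 2 * zre r - zim r else - zre r - 3 * zim r)"

lemma finite_blocks: "finite blocks"
  by (simp add: blocks_def)

text \<open>Schur's relations over \<open>\<int>[\<alpha>]\<close>, split into their coordinates
  with respect to 1 and \<open>\<alpha>\<close>. The transposed indices in \<open>dual\<close> match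
  the pairing of an entry at \<open>g\<close> with one at the inverse of \<open>g\<close>.\<close>

lemma dual_coord:
  assumes "x \<in> blocks" "y \<in> blocks"
  shows "(\<Sum>g\<in>carrier frame_group. dual x g * coord y g) = int (168 div blockdim (fst x)) * of_bool (x = y)"
proof -
  obtain b i j where x: "x = (b, i, j)"
    using prod_cases3 by blast
  obtain b' k l where y: "y = (b', k, l)"
    using prod_cases3 by blast
  have idx: "b < 6" "i < blockdim b" "j < blockdim b" "b' < 6" "k < blockdim b'" "l < blockdim b'"
    using assms by (auto simp: x y blocks_def)
  let ?G = "carrier frame_group"
  have avg: "(\<Sum>g\<in>?G. zrep c' g k l * zrep c (inv\<^bsub>frame_group\<^esub> g) j i) = of_int (168 div blockdim c) * of_bool (c = c' \<and> j = l \<and> k = i)"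
    if "c < 6" "c' < 6" "i < blockdim c" "j < blockdim c" "k < blockdim c'" "l < blockdim c'" for c c'
    using avg_zrep[of c c' l j k i] that by (simp add: avg_def)
  consider "b < 4" "b' < 4" | "b < 4" "b' = 4 \<or> b' = 5" | "b = 4 \<or> b = 5" "b' < 4" | "b = 4 \<or> b = 5" "b' = 4 \<or> b' = 5"
    using idx by linarith
  then show ?thesis
  proof cases
    case 1
    have "of_int (\<Sum>g\<in>?G. dual x g * coord y g) = (\<Sum>g\<in>?G. zrep b' g k l * zrep b (inv\<^bsub>frame_group\<^esub> g) j i)"
      using 1 by (simp add: x y dual_def coord_def zrep_def mult.commute)
    also have "\<dots> = of_int (int (168 div blockdim b) * of_bool (x = y))"
      using avg[of b b'] idx by (auto simp: x y)
    finally have "zre (of_int (\<Sum>g\<in>?G. dual x g * coord y g)) = zre (of_int (int (168 div blockdim b) * of_bool (x = y)))"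
      by (simp only:)
    then show ?thesis
      by (simp only: za_of_int x fst_conv)
  next
    case 2
    have "(\<Sum>g\<in>?G. zrep 4 g k l * zrep b (inv\<^bsub>frame_group\<^esub> g) j i) = 0"
      using avg[of b 4] idx 2 by auto
    then have "(\<Sum>g\<in>?G. zre (rep3 g k l) * irep b (inv\<^bsub>frame_group\<^esub> g) j i) = 0"
      "(\<Sum>g\<in>?G. zim (rep3 g k l) * irep b (inv\<^bsub>frame_group\<^esub> g) j i) = 0"
      using 2 by (simp_all add: za_eq_iff zrep_def)
    then show ?thesis
      using 2 by (auto simp: x y dual_def coord_def mult.commute)
  next
    case 3
    have "(\<Sum>g\<in>?G. zrep b' g k l * zrep 4 (inv\<^bsub>frame_group\<^esub> g) j i) = 0"
      using avg[of 4 b'] idx 3 by auto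
    then have "(\<Sum>g\<in>?G. irep b' g k l * zre (rep3 (inv\<^bsub>frame_group\<^esub> g) j i)) = 0"
      "(\<Sum>g\<in>?G. irep b' g k l * zim (rep3 (inv\<^bsub>frame_group\<^esub> g) j i)) = 0"
      using 3 by (simp_all add: za_eq_iff zrep_def)
    moreover have "(\<Sum>g\<in>?G. (s * f g + t * h g) * r g) = s * (\<Sum>g\<in>?G. r g * f g) + t * (\<Sum>g\<in>?G. r g * h g)"
      for s t :: int and f h r
      unfolding sum_distrib_left sum.distrib[symmetric] by (rule sum.cong[OF refl]) (simp add: algebra_simps)
    ultimately have "(\<Sum>g\<in>?G. (s * zre (rep3 (inv\<^bsub>frame_group\<^esub> g) j i) + t * zim (rep3 (inv\<^bsub>frame_group\<^esub> g) j i)) * irep b' g k l) = 0" for s t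
      by (simp only: mult_zero_right add_0)
    from this[of 2 "- 1"] this[of "- 1" "- 3"] show ?thesis
      using 3 by (auto simp: x y dual_def coord_def Let_def)
  next
    case 4
    let ?r = "\<lambda>g. rep3 (inv\<^bsub>frame_group\<^esub> g) j i" and ?\<rho> = "\<lambda>g. rep3 g k l"
    define xm where "xm = (\<Sum>g\<in>?G. zre (?r g) * zre (?\<rho> g))"
    define xn where "xn = (\<Sum>g\<in>?G. zim (?r g) * zre (?\<rho> g))"
    define ym where "ym = (\<Sum>g\<in>?G. zre (?r g) * zim (?\<rho> g))"
    define yn where "yn = (\<Sum>g\<in>?G. zim (?r g) * zim (?\<rho> g))"
    define D :: int where "D = 56 * of_bool (j = l \<and> k = i)"
    note sums = xm_def xn_def ym_def yn_def
    have ij: "i < 3" "j < 3" "k < 3" "l < 3"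
      using idx 4 by auto
    \<comment> \<open>The relation of \<open>rep3\<close> with itself and the relation with its
      conjugate give two integer equations each, enough to determine the four sums.\<close>
    have "(\<Sum>g\<in>?G. ?\<rho> g * ?r g) = of_int D"
      using avg[of 4 4] ij by (auto simp: zrep_def D_def)
    then have 1: "xm - 2 * yn = D" "xn + ym - yn = 0"
      by (simp_all add: za_eq_iff sums sum.distrib sum_subtractf sum_distrib_left mult.commute)
    have "(\<Sum>g\<in>?G. ?\<rho> g * zcnj (?r g)) = 0"
      using avg[of 5 4] ij by (auto simp: zrep_def)
    then have 2: "xm - xn + 2 * yn = 0" "ym - xn = 0"
      by (simp_all add: za_eq_iff sums sum.distrib sum_subtractf sum_negf sum_distrib_left algebra_simps)
    have coordsum: "(\<Sum>g\<in>?G. (s * zre (?r g) + t * zim (?r g)) * zre (?\<rho> g)) = s * xm + t * xn"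
      "(\<Sum>g\<in>?G. (s * zre (?r g) + t * zim (?r g)) * zim (?\<rho> g)) = s * ym + t * yn" for s t
      by (simp_all add: sums distrib_right sum.distrib mult.assoc sum_distrib_left)
    have final: "2 * xm - xn = D" "2 * ym - yn = 0" "- xm - 3 * xn = 0" "- ym - 3 * yn = D"
      using 1 2 by linarith+
    have D: "int (168 div blockdim (fst x)) * of_bool (x = y) = (if b = b' then D else 0)"
      using 4 by (auto simp: x y D_def)
    show ?thesis
      unfolding D using 4 final coordsum[of 2 "- 1"] coordsum[of "- 1" "- 3"]
      by (auto simp: x y dual_def coord_def Let_def)
  qed
qed

section \<open>The linear group as a set of frames\<close>

definition enc :: "(nat \<Rightarrow> nat \<Rightarrow> int) \<Rightarrow> f2mat" where
  "enc M = ((odd (M 0 0), odd (M 1 0), odd (M 2 0)), (odd (M 0 1), odd (M 1 1), odd (M 2 1)),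
     (odd (M 0 2), odd (M 1 2), odd (M 2 2)))"

definition dec :: "f2mat \<Rightarrow> nat \<Rightarrow> nat \<Rightarrow> int" where
  "dec = (\<lambda>((a, b, c), (a', b', c'), (a'', b'', c'')) i j. if i < 3 \<and> j < 3
     then of_bool ([[a, a', a''], [b, b', b''], [c, c', c'']] ! i ! j) else 0)"

abbreviation "M3F2 \<equiv> mat_ring (residue_ring 2) 3"

lemma F2_cring: "cring (residue_ring 2)"
proof -
  interpret residues 2 "residue_ring 2"
    by unfold_locales auto
  show ?thesis
    by (rule cring)
qed

lemma F2_simps:
  "carrier (residue_ring 2) = {0, 1}" "\<zero>\<^bsub>residue_ring 2\<^esub> = 0" "\<one>\<^bsub>residue_ring 2\<^esub> = 1"
  "x \<oplus>\<^bsub>residue_ring 2\<^esub> y = (x + y) mod 2" "x \<otimes>\<^bsub>residue_ring 2\<^esub> y = (x * y) mod 2"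
  by (auto simp: residue_ring_def)

lemma finsum_F2_3:
  fixes f :: "nat \<Rightarrow> int"
  assumes "\<And>i. i < 3 \<Longrightarrow> f i \<in> {0, 1}"
  shows "(\<Oplus>\<^bsub>residue_ring 2\<^esub>i\<in>{..<3}. f i) = (f 0 + f 1 + f 2) mod 2"
proof -
  interpret cring "residue_ring 2" by (rule F2_cring)
  have "{..<3} = {0, 1, 2::nat}"
    by auto
  then show ?thesis
    using assms[of 0] assms[of 1] assms[of 2] by (simp add: F2_simps mod_add_right_eq add.assoc)
qed

lemma dec_carrier: "dec x \<in> carrier M3F2"
  by (auto simp: mat_ring_def dec_def F2_simps split: prod.splits)

lemma enc_dec: "enc (dec x) = x"
  by (cases x) (auto simp: enc_def dec_def)

lemma M3F2_bit:
  assumes "M \<in> carrier M3F2" "i < 3" "j < 3"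
  shows "M i j \<in> {0, 1}"
proof -
  have "if i < 3 \<and> j < 3 then M i j \<in> carrier (residue_ring 2) else M i j = \<zero>\<^bsub>residue_ring 2\<^esub>"
    using assms(1) unfolding mat_ring_def by simp
  then show ?thesis
    using assms by (simp add: F2_simps)
qed

lemma M3F2_entry: "M \<in> carrier M3F2 \<Longrightarrow> i < 3 \<Longrightarrow> j < 3 \<Longrightarrow> M i j = of_bool (odd (M i j))"
  using M3F2_bit[of M i j] by auto

lemma less_3_cases: "i < 3 \<Longrightarrow> i = 0 \<or> i = 1 \<or> i = (2::nat)"
  by auto

lemma dec_enc:
  assumes "M \<in> carrier M3F2"
  shows "dec (enc M) = M"
proof (intro ext)
  fix i j
  show "dec (enc M) i j = M i j"
  proof (cases "i < 3 \<and> j < 3")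
    case True
    then have "dec (enc M) i j = of_bool (odd (M i j))"
      by (auto simp: dec_def enc_def dest!: less_3_cases)
    then show ?thesis
      using M3F2_entry[OF assms] True by simp
  next
    case False
    then show ?thesis
      using assms by (auto simp: dec_def enc_def mat_ring_def F2_simps split: if_splits)
  qed
qed

lemma f2_app_bits:
  "f2_app ((a, b, c), (a', b', c'), (a'', b'', c'')) (x, y, z) =
    ((a \<and> x) \<noteq> ((a' \<and> y) \<noteq> (a'' \<and> z)), (b \<and> x) \<noteq> ((b' \<and> y) \<noteq> (b'' \<and> z)), (c \<and> x) \<noteq> ((c' \<and> y) \<noteq> (c'' \<and> z)))"
  by (cases x; cases y; cases z; simp add: f2_app.simps)

lemma enc_mult:
  assumes "M \<in> carrier M3F2" "N \<in> carrier M3F2"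
  shows "enc (M \<otimes>\<^bsub>M3F2\<^esub> N) = f2_mult (enc M) (enc N)"
proof -
  have bits: "M i j \<in> {0, 1}" "N i j \<in> {0, 1}" if "i < 3" "j < 3" for i j
    using M3F2_bit[OF assms(1)] M3F2_bit[OF assms(2)] that by auto
  have entry: "odd ((M \<otimes>\<^bsub>M3F2\<^esub> N) i j) \<longleftrightarrow>
      ((odd (M i 0) \<and> odd (N 0 j)) \<noteq> ((odd (M i 1) \<and> odd (N 1 j)) \<noteq> (odd (M i 2) \<and> odd (N 2 j))))"
    if "i < 3" "j < 3" for i j
  proof -
    have "(M \<otimes>\<^bsub>M3F2\<^esub> N) i j = (\<Oplus>\<^bsub>residue_ring 2\<^esub>l\<in>{..<3}. M i l \<otimes>\<^bsub>residue_ring 2\<^esub> N l j)"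
      using that by (simp add: mat_ring_def)
    also have "\<dots> = (M i 0 \<otimes>\<^bsub>residue_ring 2\<^esub> N 0 j + M i 1 \<otimes>\<^bsub>residue_ring 2\<^esub> N 1 j + M i 2 \<otimes>\<^bsub>residue_ring 2\<^esub> N 2 j) mod 2"
      using bits that by (intro finsum_F2_3) (auto simp: F2_simps)
    finally show ?thesis
      by (auto simp: F2_simps)
  qed
  show ?thesis
    by (simp only: enc_def f2_mult.simps f2_app_bits entry zero_less_numeral one_less_numeral_iff numeral_less_iff semiring_norm)
qed

lemma enc_one: "enc \<one>\<^bsub>M3F2\<^esub> = f2_one"
  by (simp add: enc_def mat_ring_def F2_simps f2_one_def)

lemma M3F2_closed: "M \<in> carrier M3F2 \<Longrightarrow> N \<in> carrier M3F2 \<Longrightarrow> M \<otimes>\<^bsub>M3F2\<^esub> N \<in> carrier M3F2"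
proof -
  assume MN: "M \<in> carrier M3F2" "N \<in> carrier M3F2"
  interpret cring "residue_ring 2" by (rule F2_cring)
  show ?thesis
    using MN by (auto simp: mat_ring_def intro!: finsum_closed m_closed)
qed

lemma one_M3F2: "\<one>\<^bsub>M3F2\<^esub> \<in> carrier M3F2"
  by (auto simp: mat_ring_def F2_simps)

lemma Units_M3F2: "Units M3F2 = {M \<in> carrier M3F2. frame (enc M)}"
proof (intro equalityI subsetI CollectI conjI)
  fix M
  assume "M \<in> Units M3F2"
  then obtain N where MN: "M \<in> carrier M3F2" "N \<in> carrier M3F2" "N \<otimes>\<^bsub>M3F2\<^esub> M = \<one>\<^bsub>M3F2\<^esub>"
    by (auto simp: Units_def)
  then show "M \<in> carrier M3F2"
    by simp
  have "f2_mult (enc N) (enc M) = f2_one"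
    using MN by (metis enc_mult enc_one)
  then show "frame (enc M)"
    by (metis f2_app_comp f2_app_one f2_app_zero frame_iff)
next
  fix M
  assume "M \<in> {M \<in> carrier M3F2. frame (enc M)}"
  then have M: "M \<in> carrier M3F2" "frame (enc M)"
    by auto
  interpret group frame_group by (rule group_frame_group)
  define y where "y = inv\<^bsub>frame_group\<^esub> enc M"
  have y: "f2_mult y (enc M) = f2_one" "f2_mult (enc M) y = f2_one"
    using l_inv[of "enc M"] r_inv[of "enc M"] M by (simp_all add: y_def)
  have "dec y \<otimes>\<^bsub>M3F2\<^esub> M = \<one>\<^bsub>M3F2\<^esub>" "M \<otimes>\<^bsub>M3F2\<^esub> dec y = \<one>\<^bsub>M3F2\<^esub>"
    using M(1) y by (metis dec_carrier dec_enc enc_dec enc_mult enc_one M3F2_closed one_M3F2)+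
  then show "M \<in> Units M3F2"
    using M(1) dec_carrier unfolding Units_def by blast
qed

lemma SL32_simps: "carrier SL32 = Units M3F2" "monoid.mult SL32 = monoid.mult M3F2" "\<one>\<^bsub>SL32\<^esub> = \<one>\<^bsub>M3F2\<^esub>"
  by (simp_all add: SL32_def GL_def units_of_def)

lemma enc_iso: "enc \<in> iso SL32 frame_group"
proof (rule isoI)
  show "enc \<in> hom SL32 frame_group"
    by (auto simp: hom_def SL32_simps Units_M3F2 enc_mult simp del: split_paired_All)
  show "bij_betw enc (carrier SL32) (carrier frame_group)"
    by (rule bij_betw_byWitness[where f' = dec])
      (use dec_enc enc_dec dec_carrier in \<open>simp_all add: SL32_simps Units_M3F2 image_subset_iff del: split_paired_All\<close>)
qed

text \<open>The laws are pulled back from the frames along the injective map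
  \<open>enc\<close>.\<close>

lemma monoid_M3F2: "monoid M3F2"
proof -
  have inj: "M = N" if "M \<in> carrier M3F2" "N \<in> carrier M3F2" "enc M = enc N" for M N
    using that dec_enc by metis
  show ?thesis
    by (rule monoidI; (rule inj)?)
      (simp_all add: M3F2_closed one_M3F2 enc_mult enc_one f2_mult_assoc)
qed

lemma group_SL32: "group SL32"
  unfolding SL32_def GL_def by (rule monoid.units_group[OF monoid_M3F2])

lemma finite_SL32: "finite (carrier SL32)" and card_SL32: "card (carrier SL32) = 168"
proof -
  have bij: "bij_betw enc (carrier SL32) (carrier frame_group)"
    using enc_iso by (simp add: iso_def)
  have "finite (carrier frame_group)"
    using card_frame_group card.infinite by fastforce
  then show "finite (carrier SL32)"
    using bij bij_betw_finite by blast
  show "card (carrier SL32) = 168"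
    using bij_betw_same_card[OF bij] card_frame_group by simp
qed

lemma enc_hom: "enc \<in> hom SL32 frame_group" "enc \<one>\<^bsub>SL32\<^esub> = \<one>\<^bsub>frame_group\<^esub>"
  using enc_iso enc_one by (simp_all add: iso_def SL32_simps)

section \<open>The unit group\<close>

definition block_sum :: "('r, 'm) ring_scheme \<Rightarrow> ((nat \<Rightarrow> nat \<Rightarrow> int) \<Rightarrow> 'r) \<Rightarrow> nat \<times> nat \<times> nat \<Rightarrow> 'r" where
  "block_sum R f x = (\<Oplus>\<^bsub>R\<^esub>g\<in>carrier SL32. f g \<otimes>\<^bsub>R\<^esub> ring.emb R (coord x (enc g)))"

text \<open>The required element is the combination of the dual functions with coefficients
  \<open>T x\<close> divided by \<open>168 / d\<close>; these divisors are units in characteristic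
  at least 11.\<close>

lemma (in finite_field) block_sum_surj:
  assumes p: "p \<ge> 11" and T: "\<And>x. x \<in> blocks \<Longrightarrow> T x \<in> carrier R"
  obtains f where "f \<in> carrier (group_algebra R SL32)" "\<And>y. y \<in> blocks \<Longrightarrow> block_sum R f y = T y"
proof -
  let ?N = "\<lambda>x. emb (int (168 div blockdim (fst x)))"
  define c where "c x = T x \<otimes> inv (?N x)" for x
  have unit: "?N x \<in> Units R" if "x \<in> blocks" for x
  proof -
    have "int (168 div blockdim (fst x)) dvd 168"
      using that by (auto simp: blocks_def blockdim_def dest!: less_6_cases less_4_cases)
    then have "?N x \<noteq> \<zero>"
      by (rule emb_dvd_168_nonzero[OF p])
    then show ?thesis
      by (simp add: field_Units emb_simps(1))
  qed
  have c: "c x \<in> carrier R" "c x \<otimes> ?N x = T x" if "x \<in> blocks" for x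
    using unit[OF that] T[OF that] by (simp_all add: c_def m_assoc emb_simps(1))
  define f where "f = (\<lambda>g\<in>carrier SL32. \<Oplus>x\<in>blocks. c x \<otimes> emb (dual x (enc g)))"
  have f: "f \<in> carrier (group_algebra R SL32)"
    by (auto simp: f_def group_algebra_def emb_simps(1) c intro!: finsum_closed)
  have "block_sum R f y = T y" if y: "y \<in> blocks" for y
  proof -
    have "block_sum R f y = (\<Oplus>g\<in>carrier SL32. \<Oplus>x\<in>blocks. c x \<otimes> emb (dual x (enc g) * coord y (enc g)))"
      unfolding block_sum_def
    proof (rule finsum_cong'[OF refl])
      fix g
      assume "g \<in> carrier SL32"
      then have "f g \<otimes> emb (coord y (enc g)) = (\<Oplus>x\<in>blocks. c x \<otimes> emb (dual x (enc g))) \<otimes> emb (coord y (enc g))"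
        by (simp add: f_def)
      also have "\<dots> = (\<Oplus>x\<in>blocks. (c x \<otimes> emb (dual x (enc g))) \<otimes> emb (coord y (enc g)))"
        using finite_blocks by (intro finsum_ldistr) (auto simp: emb_simps(1) c)
      also have "\<dots> = (\<Oplus>x\<in>blocks. c x \<otimes> emb (dual x (enc g) * coord y (enc g)))"
        by (rule finsum_cong'[OF refl]) (auto simp: emb_simps(1,3) c m_assoc)
      finally show "f g \<otimes> emb (coord y (enc g)) = (\<Oplus>x\<in>blocks. c x \<otimes> emb (dual x (enc g) * coord y (enc g)))" .
    qed (auto simp: emb_simps(1) c intro!: finsum_closed)
    also have "\<dots> = (\<Oplus>x\<in>blocks. \<Oplus>g\<in>carrier SL32. c x \<otimes> emb (dual x (enc g) * coord y (enc g)))"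
      using finite_blocks finite_SL32 by (intro finsum_swap) (auto simp: emb_simps(1) c)
    also have "\<dots> = (\<Oplus>x\<in>blocks. if x = y then T x else \<zero>)"
    proof (rule finsum_cong'[OF refl])
      fix x
      assume x: "x \<in> blocks"
      have "(\<Oplus>g\<in>carrier SL32. c x \<otimes> emb (dual x (enc g) * coord y (enc g))) =
          c x \<otimes> (\<Oplus>g\<in>carrier SL32. emb (dual x (enc g) * coord y (enc g)))"
        using finite_SL32 x by (intro finsum_rdistr[symmetric]) (auto simp: emb_simps(1) c)
      also have "(\<Oplus>g\<in>carrier SL32. emb (dual x (enc g) * coord y (enc g))) =
          emb (\<Sum>g\<in>carrier SL32. dual x (enc g) * coord y (enc g))"
        by (rule type_hom_sum[OF type_hom_emb finite_SL32, symmetric])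
      also have "(\<Sum>g\<in>carrier SL32. dual x (enc g) * coord y (enc g)) = (\<Sum>g\<in>carrier frame_group. dual x g * coord y g)"
        using enc_iso by (intro sum.reindex_bij_betw) (simp add: iso_def)
      also have "\<dots> = int (168 div blockdim (fst x)) * of_bool (x = y)"
        by (rule dual_coord[OF x y])
      also have "c x \<otimes> emb (int (168 div blockdim (fst x)) * of_bool (x = y)) = (if x = y then T x else \<zero>)"
        using c[OF x] by (cases "x = y") (auto simp: emb_simps)
      finally show "(\<Oplus>g\<in>carrier SL32. c x \<otimes> emb (dual x (enc g) * coord y (enc g))) = (if x = y then T x else \<zero>)" .
    qed (auto simp: T)
    also have "\<dots> = T y"
      by (rule finsum_only) (auto simp: finite_blocks y T)
    finally show ?thesis .
  qed
  with f show thesis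
    using that by blast
qed

section \<open>Cardinalities and closure of the two sides\<close>

lemma card_mat_ring:
  assumes "finite (carrier R)"
  shows "finite (carrier (mat_ring R d))" "card (carrier (mat_ring R d)) = card (carrier R) ^ (d * d)"
proof -
  let ?E = "({..<d} \<times> {..<d}) \<rightarrow>\<^sub>E carrier R"
  let ?to = "\<lambda>M. \<lambda>(i, j)\<in>{..<d} \<times> {..<d}. M i j"
  let ?from = "\<lambda>F i j. if i < d \<and> j < d then F (i, j) else \<zero>\<^bsub>R\<^esub>"
  have "bij_betw ?to (carrier (mat_ring R d)) ?E"
  proof (rule bij_betw_byWitness[where f' = ?from])
    show "\<forall>M\<in>carrier (mat_ring R d). ?from (?to M) = M"
      by (auto simp: mat_ring_def fun_eq_iff)
    show "\<forall>F\<in>?E. ?to (?from F) = F"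
      by (auto simp: fun_eq_iff PiE_def extensional_def)
    show "?to ` carrier (mat_ring R d) \<subseteq> ?E"
      by (intro image_subsetI, subst restrict_PiE_iff) (auto simp: mat_ring_def)
    show "?from ` ?E \<subseteq> carrier (mat_ring R d)"
      by (auto simp: mat_ring_def PiE_def Pi_def)
  qed
  moreover have "finite ?E"
    using assms by (intro finite_PiE) auto
  moreover have "card ?E = card (carrier R) ^ (d * d)"
    by (simp add: card_PiE)
  ultimately show "finite (carrier (mat_ring R d))" "card (carrier (mat_ring R d)) = card (carrier R) ^ (d * d)"
    using bij_betw_finite bij_betw_same_card by metis+
qed

lemma card_group_algebra:
  assumes "finite (carrier R)" "finite (carrier G)"
  shows "finite (carrier (group_algebra R G))" "card (carrier (group_algebra R G)) = card (carrier R) ^ card (carrier G)"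
  using assms by (simp_all add: group_algebra_def finite_PiE card_PiE)

lemma group_algebra_closed:
  assumes "ring R" "group G" "f \<in> carrier (group_algebra R G)" "h \<in> carrier (group_algebra R G)"
  shows "f \<otimes>\<^bsub>group_algebra R G\<^esub> h \<in> carrier (group_algebra R G)"
proof -
  interpret R: ring R by fact
  interpret G: group G by fact
  show ?thesis
    using assms(3,4) by (auto simp: group_algebra_def intro!: R.finsum_closed)
qed

lemma group_algebra_one: "ring R \<Longrightarrow> \<one>\<^bsub>group_algebra R G\<^esub> \<in> carrier (group_algebra R G)"
  by (auto simp: group_algebra_def ring.ring_simprules)

section \<open>The maps to the matrix blocks\<close>

definition int_map :: "('r, 'm) ring_scheme \<Rightarrow> nat \<Rightarrow> ((nat \<Rightarrow> nat \<Rightarrow> int) \<Rightarrow> 'r) \<Rightarrow> nat \<Rightarrow> nat \<Rightarrow> 'r" where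
  "int_map R b = alg_map R SL32 (\<lambda>x. x) (blockdim b) (\<lambda>g i j. ring.emb R (irep b (enc g) i j))"

definition za_map :: "('k, 'm) ring_scheme \<Rightarrow> ('r \<Rightarrow> 'k) \<Rightarrow> 'k \<Rightarrow> ((nat \<Rightarrow> nat \<Rightarrow> int) \<Rightarrow> 'r) \<Rightarrow> nat \<Rightarrow> nat \<Rightarrow> 'k" where
  "za_map K \<iota> \<alpha> = alg_map K SL32 \<iota> 3 (\<lambda>g i j. ring.emb K (zre (rep3 (enc g) i j)) \<oplus>\<^bsub>K\<^esub> ring.emb K (zim (rep3 (enc g) i j)) \<otimes>\<^bsub>K\<^esub> \<alpha>)"

lemma int_map_rep:
  assumes "cring R" "b < 4"
  shows "group_algebra_rep R R SL32 (\<lambda>x. x) (blockdim b) (\<lambda>g i j. ring.emb R (irep b (enc g) i j))"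
proof -
  interpret R: cring R by fact
  interpret G: group SL32 by (rule group_SL32)
  have "krep R SL32 (blockdim b) (\<lambda>g i j. R.emb (irep b (enc g) i j))"
    by (rule krep_of_mat_rep[OF R.ring_axioms R.type_hom_emb mat_rep_irep[OF assms(2)] enc_hom(1), OF enc_hom(2)])
  then show ?thesis
    by unfold_locales (auto simp: ring_hom_def finite_SL32)
qed

lemma za_map_rep:
  assumes "cring R" "cring K" "\<iota> \<in> ring_hom R K" "\<alpha> \<in> carrier K"
    "\<alpha> \<otimes>\<^bsub>K\<^esub> \<alpha> \<oplus>\<^bsub>K\<^esub> \<alpha> \<oplus>\<^bsub>K\<^esub> ring.emb K 2 = \<zero>\<^bsub>K\<^esub>"
  shows "group_algebra_rep R K SL32 \<iota> 3
    (\<lambda>g i j. ring.emb K (zre (rep3 (enc g) i j)) \<oplus>\<^bsub>K\<^esub> ring.emb K (zim (rep3 (enc g) i j)) \<otimes>\<^bsub>K\<^esub> \<alpha>)"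
proof -
  interpret R: cring R by fact
  interpret K: cring K by fact
  interpret G: group SL32 by (rule group_SL32)
  have "krep K SL32 3 (\<lambda>g i j. K.emb (zre (rep3 (enc g) i j)) \<oplus>\<^bsub>K\<^esub> K.emb (zim (rep3 (enc g) i j)) \<otimes>\<^bsub>K\<^esub> \<alpha>)"
    by (rule krep_of_mat_rep[OF K.ring_axioms K.type_hom_za[OF assms(4,5)] mat_rep_rep3 enc_hom(1), OF enc_hom(2)])
  then show ?thesis
    by unfold_locales (auto simp: finite_SL32 assms(3))
qed

lemma int_map_entry:
  assumes "b < 4" "i < blockdim b" "j < blockdim b"
  shows "int_map R b f i j = block_sum R f (b, i, j)"
  using assms by (simp add: int_map_def alg_map_def block_sum_def coord_def)

lemma ring_hom_emb:
  assumes "ring R" "ring K" "\<iota> \<in> ring_hom R K"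
  shows "\<iota> (ring.emb R n) = ring.emb K n"
proof -
  interpret R: ring R by fact
  interpret K: ring K by fact
  interpret ring_hom_ring R K \<iota>
    by unfold_locales (use assms(3) in auto)
  have nat: "\<iota> (R.emb (int m)) = K.emb (int m)" for m
    by (induction m) (simp_all add: R.emb_simps K.emb_simps)
  show ?thesis
  proof (cases n)
    case (nonneg m)
    then show ?thesis
      using nat by simp
  next
    case (neg m)
    then show ?thesis
      using nat[of "Suc m"] by (simp only: R.emb_simps(6) K.emb_simps(6) R.emb_simps(1) hom_a_inv)
  qed
qed

lemma za_map_entry:
  assumes "cring R" "cring K" "\<iota> \<in> ring_hom R K" "\<alpha> \<in> carrier K"
    and f: "f \<in> carrier (group_algebra R SL32)" and ij: "i < 3" "j < 3"
  shows "za_map K \<iota> \<alpha> f i j = \<iota> (block_sum R f (4, i, j)) \<oplus>\<^bsub>K\<^esub> \<iota> (block_sum R f (5, i, j)) \<otimes>\<^bsub>K\<^esub> \<alpha>"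
proof -
  interpret R: cring R by fact
  interpret K: cring K by fact
  interpret ring_hom_cring R K \<iota>
    by unfold_locales (use assms(3) in auto)
  have emb: "\<iota> (R.emb n) = K.emb n" for n
    by (rule ring_hom_emb[OF R.ring_axioms K.ring_axioms assms(3)])
  have fc: "f g \<in> carrier R" if "g \<in> carrier SL32" for g
    using f that by (auto simp: group_algebra_def)
  let ?x = "\<lambda>g. K.emb (zre (rep3 (enc g) i j))" and ?y = "\<lambda>g. K.emb (zim (rep3 (enc g) i j))"
  have sum: "\<iota> (block_sum R f x) = (\<Oplus>\<^bsub>K\<^esub>g\<in>carrier SL32. \<iota> (f g) \<otimes>\<^bsub>K\<^esub> K.emb (coord x (enc g)))" for x
    unfolding block_sum_def
    by (subst hom_finsum) (auto simp: fc R.emb_simps K.emb_simps emb intro!: K.finsum_cong')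
  have "za_map K \<iota> \<alpha> f i j = (\<Oplus>\<^bsub>K\<^esub>g\<in>carrier SL32. \<iota> (f g) \<otimes>\<^bsub>K\<^esub> ?x g \<oplus>\<^bsub>K\<^esub> (\<iota> (f g) \<otimes>\<^bsub>K\<^esub> ?y g) \<otimes>\<^bsub>K\<^esub> \<alpha>)"
  proof -
    have "za_map K \<iota> \<alpha> f i j = (\<Oplus>\<^bsub>K\<^esub>g\<in>carrier SL32. \<iota> (f g) \<otimes>\<^bsub>K\<^esub> (?x g \<oplus>\<^bsub>K\<^esub> ?y g \<otimes>\<^bsub>K\<^esub> \<alpha>))"
      using ij by (simp add: za_map_def alg_map_def)
    also have "\<dots> = (\<Oplus>\<^bsub>K\<^esub>g\<in>carrier SL32. \<iota> (f g) \<otimes>\<^bsub>K\<^esub> ?x g \<oplus>\<^bsub>K\<^esub> (\<iota> (f g) \<otimes>\<^bsub>K\<^esub> ?y g) \<otimes>\<^bsub>K\<^esub> \<alpha>)"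
      using assms(4) by (intro K.finsum_cong'[OF refl]) (auto simp: fc K.emb_simps K.r_distr K.m_assoc)
    finally show ?thesis .
  qed
  also have "\<dots> = (\<Oplus>\<^bsub>K\<^esub>g\<in>carrier SL32. \<iota> (f g) \<otimes>\<^bsub>K\<^esub> ?x g) \<oplus>\<^bsub>K\<^esub> (\<Oplus>\<^bsub>K\<^esub>g\<in>carrier SL32. (\<iota> (f g) \<otimes>\<^bsub>K\<^esub> ?y g) \<otimes>\<^bsub>K\<^esub> \<alpha>)"
    using assms(4) by (intro K.finsum_addf) (auto simp: fc K.emb_simps)
  also have "(\<Oplus>\<^bsub>K\<^esub>g\<in>carrier SL32. (\<iota> (f g) \<otimes>\<^bsub>K\<^esub> ?y g) \<otimes>\<^bsub>K\<^esub> \<alpha>) = (\<Oplus>\<^bsub>K\<^esub>g\<in>carrier SL32. \<iota> (f g) \<otimes>\<^bsub>K\<^esub> ?y g) \<otimes>\<^bsub>K\<^esub> \<alpha>"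
    using assms(4) finite_SL32 by (intro K.finsum_ldistr[symmetric]) (auto simp: fc K.emb_simps)
  finally show ?thesis
    by (simp add: sum coord_def)
qed

lemma bij_of_surj_card:
  assumes "finite A" "card A = card B" "h \<in> A \<rightarrow> B" "B \<subseteq> h ` A"
  shows "bij_betw h A B"
proof -
  have "h ` A = B"
    using assms by auto
  then show ?thesis
    using assms by (auto simp: bij_betw_def intro!: eq_card_imp_inj_on)
qed

lemma blockdim_0123: "blockdim 0 = 1" "blockdim 1 = 6" "blockdim (Suc 0) = 6" "blockdim 2 = 8" "blockdim 3 = 7"
  by (simp_all add: blockdim_def)

lemma mat_ring_eqI:
  assumes "M \<in> carrier (mat_ring R d)" "N \<in> carrier (mat_ring R d)" "\<And>i j. i < d \<Longrightarrow> j < d \<Longrightarrow> M i j = N i j"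
  shows "M = N"
proof (intro ext)
  fix i j
  have "if i < d \<and> j < d then M i j \<in> carrier R else M i j = \<zero>\<^bsub>R\<^esub>"
    "if i < d \<and> j < d then N i j \<in> carrier R else N i j = \<zero>\<^bsub>R\<^esub>"
    using assms(1,2) unfolding mat_ring_def by simp_all
  then show "M i j = N i j"
    using assms(3)[of i j] by (auto split: if_splits)
qed

lemma mat_ring_entry: "M \<in> carrier (mat_ring R d) \<Longrightarrow> i < d \<Longrightarrow> j < d \<Longrightarrow> M i j \<in> carrier R"
proof -
  assume M: "M \<in> carrier (mat_ring R d)" and ij: "i < d" "j < d"
  have "if i < d \<and> j < d then M i j \<in> carrier R else M i j = \<zero>\<^bsub>R\<^esub>"
    using M unfolding mat_ring_def by simp
  with ij show ?thesis
    by simp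
qed

text \<open>The common part of both cases: \<open>\<Psi>\<close> and \<open>C\<close> stand for what
  becomes of the two coordinate blocks of degree 3. The assumption \<open>solve\<close> translates
  an element of \<open>C\<close> into prescribed block sums, so that \<open>block_sum_surj\<close>
  reaches all components at once.\<close>

lemma units_of_group_algebra_SL32:
  fixes R :: "('a, 'm) ring_scheme" and C :: "'c monoid" and \<Psi>
  defines "A \<equiv> group_algebra R SL32"
  assumes ff: "finite_field R p k" and p: "p \<ge> 11"
    and \<Psi>_closed: "\<And>f. f \<in> carrier A \<Longrightarrow> \<Psi> f \<in> carrier C"
    and \<Psi>_mult: "\<And>f h. f \<in> carrier A \<Longrightarrow> h \<in> carrier A \<Longrightarrow> \<Psi> (f \<otimes>\<^bsub>A\<^esub> h) = \<Psi> f \<otimes>\<^bsub>C\<^esub> \<Psi> h"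
    and \<Psi>_one: "\<Psi> \<one>\<^bsub>A\<^esub> = \<one>\<^bsub>C\<^esub>"
    and card_C: "card (carrier C) = (p ^ k) ^ 18"
    and solve: "\<And>c. c \<in> carrier C \<Longrightarrow> \<exists>U W. (\<forall>i<3. \<forall>j<3. U i j \<in> carrier R \<and> W i j \<in> carrier R) \<and>
      (\<forall>f\<in>carrier A. (\<forall>i<3. \<forall>j<3. block_sum R f (4, i, j) = U i j \<and> block_sum R f (5, i, j) = W i j) \<longrightarrow> \<Psi> f = c)"
  shows "units_of A \<cong> units_of R \<times>\<times> GL R 6 \<times>\<times> GL R 7 \<times>\<times> GL R 8 \<times>\<times> units_of C"
proof -
  interpret R: finite_field R p k by fact
  let ?B = "R \<times>\<times> mat_ring R 6 \<times>\<times> mat_ring R 7 \<times>\<times> mat_ring R 8 \<times>\<times> C"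
  \<comment> \<open>Block 3 has degree 7 and block 2 degree 8, hence the order; the matrix of degree
    1 is replaced by its entry.\<close>
  define \<Phi> where "\<Phi> f = (int_map R 0 f 0 0, int_map R 1 f, int_map R 3 f, int_map R 2 f, \<Psi> f)" for f
  have closed: "int_map R b f \<in> carrier (mat_ring R (blockdim b))" if "b < 4" "f \<in> carrier A" for b f
    using group_algebra_rep.alg_map_closed[OF int_map_rep[OF R.is_cring that(1)]] that(2) by (simp add: int_map_def A_def)
  have mult: "int_map R b (f \<otimes>\<^bsub>A\<^esub> h) = int_map R b f \<otimes>\<^bsub>mat_ring R (blockdim b)\<^esub> int_map R b h"
    if "b < 4" "f \<in> carrier A" "h \<in> carrier A" for b f h
    using group_algebra_rep.alg_map_mult[OF int_map_rep[OF R.is_cring that(1)]] that by (simp add: int_map_def A_def)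
  have one: "int_map R b \<one>\<^bsub>A\<^esub> = \<one>\<^bsub>mat_ring R (blockdim b)\<^esub>" if "b < 4" for b
    using group_algebra_rep.alg_map_one[OF int_map_rep[OF R.is_cring that]] by (simp add: int_map_def A_def)
  note closed' = closed[of 0, unfolded blockdim_0123] closed[of 1, unfolded blockdim_0123]
    closed[of 2, unfolded blockdim_0123] closed[of 3, unfolded blockdim_0123]
  note mult' = mult[of 0, unfolded blockdim_0123] mult[of 1, unfolded blockdim_0123]
    mult[of 2, unfolded blockdim_0123] mult[of 3, unfolded blockdim_0123]
  note one' = one[of 0, unfolded blockdim_0123] one[of 1, unfolded blockdim_0123]
    one[of 2, unfolded blockdim_0123] one[of 3, unfolded blockdim_0123]
  have c0: "int_map R 0 f 0 0 \<in> carrier R" if "f \<in> carrier A" for f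
    using mat_ring_entry[OF closed'(1)] that by simp
  have \<Phi>_closed: "\<Phi> f \<in> carrier ?B" if "f \<in> carrier A" for f
    using that closed' \<Psi>_closed c0 by (simp add: \<Phi>_def)
  have \<Phi>_mult: "\<Phi> (f \<otimes>\<^bsub>A\<^esub> h) = \<Phi> f \<otimes>\<^bsub>?B\<^esub> \<Phi> h" if fh: "f \<in> carrier A" "h \<in> carrier A" for f h
  proof -
    have "int_map R 0 (f \<otimes>\<^bsub>A\<^esub> h) 0 0 = (\<Oplus>\<^bsub>R\<^esub>l\<in>{..<1}. int_map R 0 f 0 l \<otimes>\<^bsub>R\<^esub> int_map R 0 h l 0)"
      using mult'(1)[OF _ fh] by (simp add: mat_ring_def)
    also have "\<dots> = int_map R 0 f 0 0 \<otimes>\<^bsub>R\<^esub> int_map R 0 h 0 0"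
      using c0[OF fh(1)] c0[OF fh(2)] by (simp add: lessThan_Suc)
    finally show ?thesis
      using fh mult' \<Psi>_mult by (simp add: \<Phi>_def)
  qed
  have \<Phi>_one: "\<Phi> \<one>\<^bsub>A\<^esub> = \<one>\<^bsub>?B\<^esub>"
  proof -
    have "int_map R 0 \<one>\<^bsub>A\<^esub> 0 0 = \<one>\<^bsub>R\<^esub>"
      using one'(1) by (simp add: mat_ring_def)
    then show ?thesis
      using one' \<Psi>_one by (simp add: \<Phi>_def)
  qed
  have surj: "carrier ?B \<subseteq> \<Phi> ` carrier A"
  proof
    fix y
    assume "y \<in> carrier ?B"
    then obtain t T6 T7 T8 c where y: "y = (t, T6, T7, T8, c)" and t: "t \<in> carrier R"
      and T: "T6 \<in> carrier (mat_ring R 6)" "T7 \<in> carrier (mat_ring R 7)" "T8 \<in> carrier (mat_ring R 8)"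
      and c: "c \<in> carrier C"
      by auto
    from solve[OF c] obtain U W where UW: "\<forall>i<3. \<forall>j<3. U i j \<in> carrier R \<and> W i j \<in> carrier R"
      and \<Psi>: "\<forall>f\<in>carrier A. (\<forall>i<3. \<forall>j<3. block_sum R f (4, i, j) = U i j \<and> block_sum R f (5, i, j) = W i j) \<longrightarrow> \<Psi> f = c"
      by blast
    define V where "V = (\<lambda>(b, i, j). ([\<lambda>i j. t, T6, T8, T7, U, W] ! b) i j)"
    have "V x \<in> carrier R" if "x \<in> blocks" for x
      using that t UW mat_ring_entry[OF T(1)] mat_ring_entry[OF T(2)] mat_ring_entry[OF T(3)]
      by (auto simp: blocks_def V_def blockdim_0123 dest!: less_6_cases less_4_cases)
    then obtain f where f: "f \<in> carrier A" and fV: "\<And>y. y \<in> blocks \<Longrightarrow> block_sum R f y = V y"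
      using R.block_sum_surj[OF p, of V] unfolding A_def by blast
    have entry: "int_map R b f i j = V (b, i, j)" if "b < 4" "i < blockdim b" "j < blockdim b" for b i j
    proof -
      have "(b, i, j) \<in> blocks"
        using that by (simp add: blocks_def)
      then show ?thesis
        using fV int_map_entry[OF that, of R f] by simp
    qed
    have "int_map R 0 f 0 0 = t"
      using entry[of 0 0 0] by (simp add: blockdim_0123 V_def)
    moreover have "int_map R 1 f = T6"
      using entry[of 1] closed'(2)[OF _ f] T(1) by (intro mat_ring_eqI) (auto simp: blockdim_0123 V_def)
    moreover have "int_map R 2 f = T8"
      using entry[of 2] closed'(3)[OF _ f] T(3) by (intro mat_ring_eqI) (auto simp: blockdim_0123 V_def)
    moreover have "int_map R 3 f = T7"
      using entry[of 3] closed'(4)[OF _ f] T(2) by (intro mat_ring_eqI) (auto simp: blockdim_0123 V_def)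
    moreover have "\<Psi> f = c"
      using \<Psi> f by (auto simp: fV blocks_def V_def)
    ultimately show "y \<in> \<Phi> ` carrier A"
      using f by (auto simp: \<Phi>_def y intro!: image_eqI[of _ _ f])
  qed
  \<comment> \<open>The exponents add up to \<open>1 + 36 + 49 + 64 + 18 = 168\<close>.\<close>
  have "card (carrier ?B) = p ^ k * (p ^ k) ^ 36 * (p ^ k) ^ 49 * (p ^ k) ^ 64 * (p ^ k) ^ 18"
    using card_mat_ring(2)[OF R.finite] card_C R.card by (simp add: card_cartesian_product)
  also have "\<dots> = (p ^ k) ^ 168"
    by (simp flip: power_add power_Suc2 power_Suc)
  also have "\<dots> = card (carrier A)"
    using card_group_algebra(2)[OF R.finite finite_SL32] by (simp add: A_def card_SL32 R.card)
  finally have "bij_betw \<Phi> (carrier A) (carrier ?B)"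
    using card_group_algebra(1)[OF R.finite finite_SL32] \<Phi>_closed surj
    by (intro bij_of_surj_card) (auto simp: A_def)
  then have "units_of A \<cong> units_of ?B"
    using \<Phi>_mult \<Phi>_one group_algebra_closed[OF R.ring_axioms group_SL32] group_algebra_one[OF R.ring_axioms]
    by (intro units_of_cong[of \<Phi>]) (auto simp: A_def)
  then show ?thesis
    by (simp only: GL_def units_of_DirProd)
qed

lemma za_map_hom:
  assumes "cring R" "cring K" "\<iota> \<in> ring_hom R K" "\<alpha> \<in> carrier K"
    "\<alpha> \<otimes>\<^bsub>K\<^esub> \<alpha> \<oplus>\<^bsub>K\<^esub> \<alpha> \<oplus>\<^bsub>K\<^esub> ring.emb K 2 = \<zero>\<^bsub>K\<^esub>"
  shows "f \<in> carrier (group_algebra R SL32) \<Longrightarrow> za_map K \<iota> \<alpha> f \<in> carrier (mat_ring K 3)"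
    and "f \<in> carrier (group_algebra R SL32) \<Longrightarrow> h \<in> carrier (group_algebra R SL32) \<Longrightarrow>
      za_map K \<iota> \<alpha> (f \<otimes>\<^bsub>group_algebra R SL32\<^esub> h) = za_map K \<iota> \<alpha> f \<otimes>\<^bsub>mat_ring K 3\<^esub> za_map K \<iota> \<alpha> h"
    and "za_map K \<iota> \<alpha> \<one>\<^bsub>group_algebra R SL32\<^esub> = \<one>\<^bsub>mat_ring K 3\<^esub>"
  using group_algebra_rep.alg_map_closed[OF za_map_rep[OF assms]]
    group_algebra_rep.alg_map_mult[OF za_map_rep[OF assms]]
    group_algebra_rep.alg_map_one[OF za_map_rep[OF assms]]
  by (simp_all add: za_map_def)

lemma units_of_group_algebra_split:
  fixes R :: "('a, 'm) ring_scheme"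
  assumes ff: "finite_field R p k" and p: "p \<ge> 11" and root: "p mod 7 \<in> {1, 2, 4} \<or> even k"
  shows "units_of (group_algebra R SL32) \<cong>
    units_of R \<times>\<times> GL R 6 \<times>\<times> GL R 7 \<times>\<times> GL R 8 \<times>\<times> GL R 3 \<times>\<times> GL R 3"
proof -
  interpret finite_field R p k by fact
  obtain \<alpha> where \<alpha>: "\<alpha> \<in> carrier R" "\<alpha> \<otimes>\<^bsub>R\<^esub> \<alpha> \<oplus>\<^bsub>R\<^esub> \<alpha> \<oplus>\<^bsub>R\<^esub> emb 2 = \<zero>\<^bsub>R\<^esub>"
    using root_exists[OF p root] by blast
  define \<beta> where "\<beta> = \<ominus>\<^bsub>R\<^esub> \<one>\<^bsub>R\<^esub> \<ominus>\<^bsub>R\<^esub> \<alpha>"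
  have \<beta>: "\<beta> \<in> carrier R" "\<beta> \<otimes>\<^bsub>R\<^esub> \<beta> \<oplus>\<^bsub>R\<^esub> \<beta> \<oplus>\<^bsub>R\<^esub> emb 2 = \<zero>\<^bsub>R\<^esub>"
  proof -
    show "\<beta> \<in> carrier R"
      using \<alpha> by (simp add: \<beta>_def)
    have "\<beta> \<otimes>\<^bsub>R\<^esub> \<beta> \<oplus>\<^bsub>R\<^esub> \<beta> \<oplus>\<^bsub>R\<^esub> t = \<alpha> \<otimes>\<^bsub>R\<^esub> \<alpha> \<oplus>\<^bsub>R\<^esub> \<alpha> \<oplus>\<^bsub>R\<^esub> t" if "t \<in> carrier R" for t
      unfolding \<beta>_def using \<alpha>(1) that by algebra
    then show "\<beta> \<otimes>\<^bsub>R\<^esub> \<beta> \<oplus>\<^bsub>R\<^esub> \<beta> \<oplus>\<^bsub>R\<^esub> emb 2 = \<zero>\<^bsub>R\<^esub>"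
      using \<alpha>(2) emb_simps(1) by simp
  qed
  define \<delta> where "\<delta> = \<alpha> \<ominus>\<^bsub>R\<^esub> \<beta>"
  have "\<delta> \<in> Units R"
  proof -
    have "emb 2 = \<one>\<^bsub>R\<^esub> \<oplus>\<^bsub>R\<^esub> \<one>\<^bsub>R\<^esub>"
      using emb_simps(2)[of 1 1] by (simp add: emb_simps(4))
    then have "emb 2 \<otimes>\<^bsub>R\<^esub> \<alpha> \<oplus>\<^bsub>R\<^esub> \<one>\<^bsub>R\<^esub> = \<alpha> \<oplus>\<^bsub>R\<^esub> \<alpha> \<oplus>\<^bsub>R\<^esub> \<one>\<^bsub>R\<^esub>"
      using \<alpha>(1) by (simp add: l_distr)
    also have "\<dots> = \<delta>"
      unfolding \<delta>_def \<beta>_def using \<alpha>(1) by algebra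
    finally have "\<delta> \<otimes>\<^bsub>R\<^esub> \<delta> = emb (- 7)"
      using root_iff_sqrt[OF \<alpha>(1)] \<alpha> emb_simps(1) by simp
    moreover have "emb (- 7) \<noteq> \<zero>\<^bsub>R\<^esub>"
      by (rule emb_dvd_168_nonzero[OF p]) simp
    ultimately have "\<delta> \<noteq> \<zero>\<^bsub>R\<^esub>"
      by auto
    then show ?thesis
      using \<alpha>(1) \<beta>(1) by (simp add: field_Units \<delta>_def)
  qed
  have id: "(\<lambda>x. x) \<in> ring_hom R R"
    by (simp add: ring_hom_def)
  note A = za_map_hom[OF is_cring is_cring id \<alpha>] and B = za_map_hom[OF is_cring is_cring id \<beta>]
  note entA = za_map_entry[OF is_cring is_cring id \<alpha>(1)] and entB = za_map_entry[OF is_cring is_cring id \<beta>(1)]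
  let ?C = "mat_ring R 3 \<times>\<times> mat_ring R 3" and ?A = "group_algebra R SL32"
  let ?\<Psi> = "\<lambda>f. (za_map R (\<lambda>x. x) \<alpha> f, za_map R (\<lambda>x. x) \<beta> f)"
  have "units_of ?A \<cong> units_of R \<times>\<times> GL R 6 \<times>\<times> GL R 7 \<times>\<times> GL R 8 \<times>\<times> units_of ?C"
  proof (rule units_of_group_algebra_SL32[OF ff p, where \<Psi> = ?\<Psi>])
    show "card (carrier ?C) = (p ^ k) ^ 18"
      using card_mat_ring(2)[OF finite, of 3] card by (simp add: card_cartesian_product flip: power_add)
  next
    fix c
    assume "c \<in> carrier ?C"
    then obtain P Q where c: "c = (P, Q)" and PQ: "P \<in> carrier (mat_ring R 3)" "Q \<in> carrier (mat_ring R 3)"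
      by auto
    \<comment> \<open>Solution of the system \<open>U + W \<alpha> = P\<close>,
      \<open>U + W \<beta> = Q\<close>, entry by entry; \<open>\<delta>\<close> is a unit because
      its square is -7.\<close>
    define W where "W i j = (P i j \<ominus>\<^bsub>R\<^esub> Q i j) \<otimes>\<^bsub>R\<^esub> inv\<^bsub>R\<^esub> \<delta>" for i j
    define U where "U i j = P i j \<ominus>\<^bsub>R\<^esub> W i j \<otimes>\<^bsub>R\<^esub> \<alpha>" for i j
    have cl: "P i j \<in> carrier R" "Q i j \<in> carrier R" "W i j \<in> carrier R" "U i j \<in> carrier R"
      if "i < 3" "j < 3" for i j
      using mat_ring_entry[OF PQ(1) that] mat_ring_entry[OF PQ(2) that] \<open>\<delta> \<in> Units R\<close> \<alpha>(1)
      by (simp_all add: U_def W_def)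
    have eqP: "U i j \<oplus>\<^bsub>R\<^esub> W i j \<otimes>\<^bsub>R\<^esub> \<alpha> = P i j" if "i < 3" "j < 3" for i j
      using cl[OF that] \<alpha>(1) unfolding U_def by (simp add: a_minus_def a_assoc l_neg)
    have eqQ: "U i j \<oplus>\<^bsub>R\<^esub> W i j \<otimes>\<^bsub>R\<^esub> \<beta> = Q i j" if "i < 3" "j < 3" for i j
    proof -
      have "U i j \<oplus>\<^bsub>R\<^esub> W i j \<otimes>\<^bsub>R\<^esub> \<beta> = P i j \<ominus>\<^bsub>R\<^esub> W i j \<otimes>\<^bsub>R\<^esub> \<delta>"
        unfolding U_def \<delta>_def using cl[OF that] \<alpha>(1) \<beta>(1) by algebra
      also have "W i j \<otimes>\<^bsub>R\<^esub> \<delta> = P i j \<ominus>\<^bsub>R\<^esub> Q i j"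
        using cl[OF that] \<open>\<delta> \<in> Units R\<close> by (simp add: W_def m_assoc Units_closed)
      also have "P i j \<ominus>\<^bsub>R\<^esub> (P i j \<ominus>\<^bsub>R\<^esub> Q i j) = Q i j"
        using cl[OF that] by algebra
      finally show ?thesis .
    qed
    show "\<exists>U W. (\<forall>i<3. \<forall>j<3. U i j \<in> carrier R \<and> W i j \<in> carrier R) \<and>
        (\<forall>f\<in>carrier ?A. (\<forall>i<3. \<forall>j<3. block_sum R f (4, i, j) = U i j \<and> block_sum R f (5, i, j) = W i j) \<longrightarrow> (za_map R (\<lambda>x. x) \<alpha> f, za_map R (\<lambda>x. x) \<beta> f) = c)"
    proof (rule exI[of _ U], rule exI[of _ W], intro conjI ballI impI)
      fix f
      assume f: "f \<in> carrier ?A"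
        and *: "\<forall>i<3. \<forall>j<3. block_sum R f (4, i, j) = U i j \<and> block_sum R f (5, i, j) = W i j"
      have "za_map R (\<lambda>x. x) \<alpha> f = P"
        using A(1)[OF f] PQ(1) entA[OF f] * eqP by (intro mat_ring_eqI) auto
      moreover have "za_map R (\<lambda>x. x) \<beta> f = Q"
        using B(1)[OF f] PQ(2) entB[OF f] * eqQ by (intro mat_ring_eqI) auto
      ultimately show "(za_map R (\<lambda>x. x) \<alpha> f, za_map R (\<lambda>x. x) \<beta> f) = c"
        by (simp add: c)
    qed (use cl in auto)
  qed (use A B in auto)
  then show ?thesis
    by (simp only: GL_def units_of_DirProd)
qed

text \<open>Two representations with different \<open>y\<close> would give \<open>\<alpha>\<close>
  as a quotient of elements of the small field. So the \<open>q^2\<close> pairs have distinct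
  values, and these fill the big field.\<close>

lemma quadratic_decomposition:
  assumes R: "finite_field R p k" and S: "finite_field S p (2 * k)" and \<iota>: "\<iota> \<in> ring_hom R S"
    and \<alpha>: "\<alpha> \<in> carrier S" "\<alpha> \<notin> \<iota> ` carrier R" and s: "s \<in> carrier S"
  shows "\<exists>x\<in>carrier R. \<exists>y\<in>carrier R. s = \<iota> x \<oplus>\<^bsub>S\<^esub> \<iota> y \<otimes>\<^bsub>S\<^esub> \<alpha>"
proof -
  interpret R: finite_field R p k by fact
  interpret S: finite_field S p "2 * k" by fact
  interpret ring_hom_cring R S \<iota>
    by unfold_locales (use \<iota> in auto)
  have inj0: "x = \<zero>\<^bsub>R\<^esub>" if "x \<in> carrier R" "\<iota> x = \<zero>\<^bsub>S\<^esub>" for x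
  proof (rule ccontr)
    assume "x \<noteq> \<zero>\<^bsub>R\<^esub>"
    then have "x \<in> Units R"
      using that by (simp add: R.field_Units)
    then have "\<iota> x \<otimes>\<^bsub>S\<^esub> \<iota> (inv\<^bsub>R\<^esub> x) = \<one>\<^bsub>S\<^esub>"
      using that(1) by (metis R.Units_inv_closed R.Units_r_inv hom_mult hom_one)
    then show False
      using that(2) \<open>x \<in> Units R\<close> by simp
  qed
  let ?f = "\<lambda>(x, y). \<iota> x \<oplus>\<^bsub>S\<^esub> \<iota> y \<otimes>\<^bsub>S\<^esub> \<alpha>" and ?D = "carrier R \<times> carrier R"
  have "inj_on ?f ?D"
  proof (rule inj_onI, clarify)
    fix x y x' y'
    assume c: "x \<in> carrier R" "y \<in> carrier R" "x' \<in> carrier R" "y' \<in> carrier R"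
      and eq: "\<iota> x \<oplus>\<^bsub>S\<^esub> \<iota> y \<otimes>\<^bsub>S\<^esub> \<alpha> = \<iota> x' \<oplus>\<^bsub>S\<^esub> \<iota> y' \<otimes>\<^bsub>S\<^esub> \<alpha>"
    define u where "u = y \<ominus>\<^bsub>R\<^esub> y'"
    define w where "w = x' \<ominus>\<^bsub>R\<^esub> x"
    have uw: "u \<in> carrier R" "w \<in> carrier R"
      using c by (simp_all add: u_def w_def)
    have id: "(b \<ominus>\<^bsub>S\<^esub> b') \<otimes>\<^bsub>S\<^esub> \<alpha> = (a' \<ominus>\<^bsub>S\<^esub> a) \<oplus>\<^bsub>S\<^esub> ((a \<oplus>\<^bsub>S\<^esub> b \<otimes>\<^bsub>S\<^esub> \<alpha>) \<ominus>\<^bsub>S\<^esub> (a' \<oplus>\<^bsub>S\<^esub> b' \<otimes>\<^bsub>S\<^esub> \<alpha>))"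
      if "a \<in> carrier S" "b \<in> carrier S" "a' \<in> carrier S" "b' \<in> carrier S" for a b a' b'
      using that \<alpha>(1) by algebra
    have lin: "\<iota> u \<otimes>\<^bsub>S\<^esub> \<alpha> = \<iota> w"
      using id[of "\<iota> x" "\<iota> y" "\<iota> x'" "\<iota> y'"] c eq \<alpha>(1)
      by (simp add: u_def w_def a_minus_def S.r_neg)
    have "u = \<zero>\<^bsub>R\<^esub>"
    proof (rule ccontr)
      assume "u \<noteq> \<zero>\<^bsub>R\<^esub>"
      then have u: "u \<in> Units R"
        using uw by (simp add: R.field_Units)
      have "\<iota> (inv\<^bsub>R\<^esub> u \<otimes>\<^bsub>R\<^esub> w) = \<iota> (inv\<^bsub>R\<^esub> u) \<otimes>\<^bsub>S\<^esub> (\<iota> u \<otimes>\<^bsub>S\<^esub> \<alpha>)"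
        using u uw lin by simp
      also have "\<dots> = \<iota> (inv\<^bsub>R\<^esub> u \<otimes>\<^bsub>R\<^esub> u) \<otimes>\<^bsub>S\<^esub> \<alpha>"
        using u uw(1) \<alpha>(1) by (simp add: S.m_assoc del: R.Units_l_inv)
      also have "\<dots> = \<alpha>"
        using u \<alpha>(1) by simp
      finally show False
        using \<alpha>(2) u uw by (metis R.Units_inv_closed R.m_closed imageI)
    qed
    then have "\<iota> w = \<zero>\<^bsub>S\<^esub>"
      using lin \<alpha>(1) by simp
    then have "x = x'"
      using inj0[OF uw(2)] c by (simp add: w_def)
    moreover have "y = y'"
      using \<open>u = \<zero>\<^bsub>R\<^esub>\<close> c by (simp add: u_def)
    ultimately show "x = x' \<and> y = y'"
      by simp
  qed
  moreover have "?f ` ?D \<subseteq> carrier S"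
    using \<alpha>(1) by auto
  moreover have "card ?D = card (carrier S)"
    using R.card S.card by (simp add: card_cartesian_product mult_2 power_add)
  ultimately have "?f ` ?D = carrier S"
    using S.finite by (metis card_image card_subset_eq)
  with s have "s \<in> ?f ` ?D"
    by simp
  then show ?thesis
    by auto
qed

lemma units_of_group_algebra_nonsplit:
  fixes R :: "('a, 'm) ring_scheme" and S :: "('b, 'n) ring_scheme"
  assumes ff: "finite_field R p k" "finite_field S p (2 * k)" and p: "p \<ge> 11"
    and no: "p mod 7 \<notin> {1, 2, 4}" "odd k"
  shows "units_of (group_algebra R SL32) \<cong> units_of R \<times>\<times> GL R 6 \<times>\<times> GL R 7 \<times>\<times> GL R 8 \<times>\<times> GL S 3"
proof -
  interpret R: finite_field R p k by (rule ff(1))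
  interpret S: finite_field S p "2 * k" by (rule ff(2))
  obtain \<iota> where \<iota>: "\<iota> \<in> ring_hom R S"
    using finite_field_embedding[OF ff] by blast
  interpret ring_hom_cring R S \<iota>
    by unfold_locales (use \<iota> in auto)
  obtain \<alpha> where \<alpha>: "\<alpha> \<in> carrier S" "\<alpha> \<otimes>\<^bsub>S\<^esub> \<alpha> \<oplus>\<^bsub>S\<^esub> \<alpha> \<oplus>\<^bsub>S\<^esub> S.emb 2 = \<zero>\<^bsub>S\<^esub>"
    \<comment> \<open>The exponent \<open>2 * k\<close> is even, so the big field always has a
      root.\<close>
    using S.root_exists[OF p] by auto
  have "\<alpha> \<notin> \<iota> ` carrier R"
  proof
    assume "\<alpha> \<in> \<iota> ` carrier R"
    then obtain r where r: "r \<in> carrier R" "\<alpha> = \<iota> r"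
      by blast
    let ?z = "r \<otimes>\<^bsub>R\<^esub> r \<oplus>\<^bsub>R\<^esub> r \<oplus>\<^bsub>R\<^esub> R.emb 2"
    have z: "?z \<in> carrier R" "?z \<noteq> \<zero>\<^bsub>R\<^esub>"
      using r R.no_root[OF p no] R.emb_simps(1) by simp_all
    then have "?z \<in> Units R"
      by (simp add: R.field_Units)
    then have "\<iota> ?z \<otimes>\<^bsub>S\<^esub> \<iota> (inv\<^bsub>R\<^esub> ?z) = \<one>\<^bsub>S\<^esub>"
      using z by (metis R.Units_inv_closed R.Units_r_inv hom_mult hom_one)
    moreover have "\<iota> ?z = \<zero>\<^bsub>S\<^esub>"
      using r \<alpha>(2) R.emb_simps(1) ring_hom_emb[OF R.ring_axioms S.ring_axioms \<iota>, of 2] by simp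
    ultimately show False
      using \<open>?z \<in> Units R\<close> by simp
  qed
  note dec = quadratic_decomposition[OF ff \<iota> \<alpha>(1) this]
  note A = za_map_hom[OF R.is_cring S.is_cring \<iota> \<alpha>]
  note ent = za_map_entry[OF R.is_cring S.is_cring \<iota> \<alpha>(1)]
  \<comment> \<open>The common lemma takes a plain monoid record. Truncation drops the additive
    fields and leaves the units unchanged.\<close>
  let ?A = "group_algebra R SL32" and ?C = "monoid.truncate (mat_ring S 3)"
  have C: "carrier ?C = carrier (mat_ring S 3)" "monoid.mult ?C = monoid.mult (mat_ring S 3)"
    "\<one>\<^bsub>?C\<^esub> = \<one>\<^bsub>mat_ring S 3\<^esub>" "units_of ?C = GL S 3"
    by (simp_all add: monoid.defs GL_def units_of_def Units_def)
  have "units_of ?A \<cong> units_of R \<times>\<times> GL R 6 \<times>\<times> GL R 7 \<times>\<times> GL R 8 \<times>\<times> units_of ?C"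
  proof (rule units_of_group_algebra_SL32[OF ff(1) p, where \<Psi> = "za_map S \<iota> \<alpha>"], unfold C)
    show "card (carrier (mat_ring S 3)) = (p ^ k) ^ 18"
      using card_mat_ring(2)[OF S.finite, of 3] S.card by (simp add: mult.commute flip: power_mult)
  next
    fix c
    assume c: "c \<in> carrier (mat_ring S 3)"
    have "\<forall>i j. \<exists>x y. i < 3 \<and> j < 3 \<longrightarrow> x \<in> carrier R \<and> y \<in> carrier R \<and> c i j = \<iota> x \<oplus>\<^bsub>S\<^esub> \<iota> y \<otimes>\<^bsub>S\<^esub> \<alpha>"
      using dec mat_ring_entry[OF c] by meson
    then obtain U W where UW: "\<And>i j. i < 3 \<Longrightarrow> j < 3 \<Longrightarrow>
        U i j \<in> carrier R \<and> W i j \<in> carrier R \<and> c i j = \<iota> (U i j) \<oplus>\<^bsub>S\<^esub> \<iota> (W i j) \<otimes>\<^bsub>S\<^esub> \<alpha>"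
      by metis
    show "\<exists>U W. (\<forall>i<3. \<forall>j<3. U i j \<in> carrier R \<and> W i j \<in> carrier R) \<and>
        (\<forall>f\<in>carrier ?A. (\<forall>i<3. \<forall>j<3. block_sum R f (4, i, j) = U i j \<and> block_sum R f (5, i, j) = W i j) \<longrightarrow> za_map S \<iota> \<alpha> f = c)"
    proof (rule exI[of _ U], rule exI[of _ W], intro conjI ballI impI)
      fix f
      assume f: "f \<in> carrier ?A"
        and *: "\<forall>i<3. \<forall>j<3. block_sum R f (4, i, j) = U i j \<and> block_sum R f (5, i, j) = W i j"
      show "za_map S \<iota> \<alpha> f = c"
        using A(1)[OF f] c ent[OF f] * UW by (intro mat_ring_eqI) auto
    qed (use UW in auto)
  qed (use A in auto)
  then show ?thesis
    by (simp only: C)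
qed

text \<open>Modulo 7 the residues 4, 6, 5 are -3, -1, -2. The field of order \<open>q^2\<close> is
  universally quantified, so the second part holds for every model of it.\<close>

theorem theorem4p4:
  fixes R :: "('a, 'c) ring_scheme" and p k :: nat
  assumes "field R" and "finite (carrier R)" and "Factorial_Ring.prime p" and "p \<ge> 11" and "k \<ge> 1"
    and "card (carrier R) = p ^ k"
  shows "((even k \<or> (odd k \<and> (p mod 7 = 1 \<or> p mod 7 = 2 \<or> p mod 7 = 4))) \<longrightarrow>
           units_of (group_algebra R SL32) \<cong>
             units_of R \<times>\<times> GL R 6 \<times>\<times> GL R 7 \<times>\<times> GL R 8 \<times>\<times> GL R 3 \<times>\<times> GL R 3) \<and>
         (odd k \<and> (p mod 7 = 6 \<or> p mod 7 = 5 \<or> p mod 7 = 3) \<longrightarrow>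
           (\<forall>S :: ('b, 'd) ring_scheme. field S \<and> finite (carrier S) \<and> card (carrier S) = (p ^ k) ^ 2
              \<longrightarrow> units_of (group_algebra R SL32) \<cong>
                    units_of R \<times>\<times> GL R 6 \<times>\<times> GL R 7 \<times>\<times> GL R 8 \<times>\<times> GL S 3))"
proof (intro conjI impI allI)
  have R: "finite_field R p k"
    using assms by (simp add: finite_field_def finite_field_axioms_def)
  show "units_of (group_algebra R SL32) \<cong>
      units_of R \<times>\<times> GL R 6 \<times>\<times> GL R 7 \<times>\<times> GL R 8 \<times>\<times> GL R 3 \<times>\<times> GL R 3"
    if "even k \<or> (odd k \<and> (p mod 7 = 1 \<or> p mod 7 = 2 \<or> p mod 7 = 4))"
    using units_of_group_algebra_split[OF R assms(4)] that by auto
  fix S :: "('b, 'd) ring_scheme"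
  assume *: "odd k \<and> (p mod 7 = 6 \<or> p mod 7 = 5 \<or> p mod 7 = 3)"
    and S: "field S \<and> finite (carrier S) \<and> card (carrier S) = (p ^ k) ^ 2"
  have "finite_field S p (2 * k)"
    using S assms(3) by (simp add: finite_field_def finite_field_axioms_def power_mult[symmetric] mult.commute)
  then show "units_of (group_algebra R SL32) \<cong> units_of R \<times>\<times> GL R 6 \<times>\<times> GL R 7 \<times>\<times> GL R 8 \<times>\<times> GL S 3"
    using units_of_group_algebra_nonsplit[OF R _ assms(4)] * by auto
qed

end
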